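(* For an $n\times n$ complex matrix $A$ and a vector $\delta_0\in\mathbb{C}^n$ let $V_k=\operatorname{span}(\delta_0,A\delta_0,A^*\delta_0,\dots,A^k\delta_0,(A^* )^k\delta_0)$. Consider the following conditions on the pair $(A,\delta_0)$: (i) If $n=2k+1$, then $V_k$ has dimension $n$. If $n=2k$, then $\operatorname{span}(V_{k-1}\cup\{A^k\delta_0\})$ has dimension $n$. (ii) If $n=2k+1$, then $A^*$ is an isometry on $\operatorname{span}(V_{k-1}\cup\{A^k\delta_0\})$ and $A$ is an isometry on $\operatorname{span}(V_{k-1}\cup\{(A^* )^k\delta_0\})$. If $n=2k$, then $A^*$ is an isometry on $\operatorname{span}(V_{k-2}\cup\{A^{k-1}\delta_0,A^k\delta_0\})$ and $A$ is an isometry on $V_{k-1}$. (iii) $\|A\|\le 1$. (iv) $A$ is not unitary. Then: (a) If $A$ is an $n\times n$ cutoff CMV matrix and $\delta_0=(1,0,\dots,0)^t$, then (i)--(iv) hold. (b) Conversely, if $A,\delta_0$ are a pair of an $n\times n$ matrix and a vector obeying (i)--(iv), then there is a basis in which $\delta_0=(1,0,\dots,0)^t$ and $A$ is a cutoff CMV matrix. (c) $(A,\delta_0)$ determine the Verblunsky coefficients $(\alpha_0,\dots,\alpha_{n-1})$ uniquely. In particular, two cutoff CMV matrices with distinct $\{\alpha_j\}_{j=0}^{n-1}$ are not unitarily equivalent by a unitary preserving $\delta_0$.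
   Context: For $\alpha\in\mathbb{C}$ with $|\alpha|\le 1$ put $\rho=(1-|\alpha|^2)^{1/2}$ and $\Theta(\alpha)=\begin{pmatrix}\bar\alpha&\rho\\ \rho&-\alpha\end{pmatrix}$. Let $\mathbb{D}=\{z\in\mathbb{C}:|z|<1\}$. Given $\{\alpha_n\}_{n=0}^\infty\subset\mathbb{D}$ (the Verblunsky coefficients), the associated proper CMV matrix is the operator $\mathcal{C}=\mathcal{L}\mathcal{M}$ on $\ell^2(\{0,1,2,\dots\})$, where $\mathcal{L}=\Theta(\alpha_0)\oplus\Theta(\alpha_2)\oplus\Theta(\alpha_4)\oplus\cdots$ and $\mathcal{M}=\mathbf{1}_{1\times1}\oplus\Theta(\alpha_1)\oplus\Theta(\alpha_3)\oplus\cdots$. An $n\times n$ cutoff CMV matrix is the upper left $n\times n$ block (first $n$ rows and first $n$ columns) of a proper CMV matrix; it depends only on $\alpha_0,\dots,\alpha_{n-1}\in\mathbb{D}$, which are called its Verblunsky coefficients. $A^*$ denotes the adjoint of $A$. Saying that $B$ is an isometry on a subspace $S$ means $\|Bv\|=\|v\|$ for all $v\in S$.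
   Formalization: For n=1 and n=2 condition (ii) involves the undefined V_{-1} (reading it as {0} makes (a) false); here (ii) is empty for n=1, and for n=2 it says that A* is an isometry on span(Aδ_0) and A on V_0. *)

theory Defs
  imports
    "Jordan_Normal_Form.VS_Connect"
    "Jordan_Normal_Form.Schur_Decomposition"
    "HOL-Analysis.L2_Norm"
begin

section \<open>CMV matrices\<close>

definition Theta :: "complex \<Rightarrow> complex mat" where
  "Theta a = (let r = complex_of_real (sqrt (1 - (cmod a)\<^sup>2))
     in mat_of_rows_list 2 [[cnj a, r], [r, - a]])"

text \<open>Operators on \<open>\<ell>\<^sup>2\<close> over \<open>{0, 1, 2, \<dots>}\<close> are given by their infinite matrices in the
  standard basis. In \<open>CMV_L\<close> the blocks occupy the index pairs \<open>{2 m, 2 m + 1}\<close>; in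
  \<open>CMV_M\<close> they occupy \<open>{2 m + 1, 2 m + 2}\<close>, after a leading \<open>1 \<times> 1\<close> identity block.\<close>

definition CMV_L :: "(nat \<Rightarrow> complex) \<Rightarrow> nat \<Rightarrow> nat \<Rightarrow> complex" where
  "CMV_L \<alpha> i j =
     (if i div 2 = j div 2 then Theta (\<alpha> (2 * (i div 2))) $$ (i mod 2, j mod 2) else 0)"

definition CMV_M :: "(nat \<Rightarrow> complex) \<Rightarrow> nat \<Rightarrow> nat \<Rightarrow> complex" where
  "CMV_M \<alpha> i j =
     (if i = 0 \<or> j = 0 then (if i = j then 1 else 0)
      else if (i - 1) div 2 = (j - 1) div 2
        then Theta (\<alpha> (2 * ((i - 1) div 2) + 1)) $$ ((i - 1) mod 2, (j - 1) mod 2)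
      else 0)"

text \<open>The series has at most two nonzero terms, since each row of \<open>CMV_L\<close> does.\<close>

definition CMV :: "(nat \<Rightarrow> complex) \<Rightarrow> nat \<Rightarrow> nat \<Rightarrow> complex" where
  "CMV \<alpha> i j = (\<Sum>l. CMV_L \<alpha> i l * CMV_M \<alpha> l j)"

definition verblunsky :: "(nat \<Rightarrow> complex) \<Rightarrow> bool" where
  "verblunsky \<alpha> \<longleftrightarrow> (\<forall>j. cmod (\<alpha> j) < 1)"

definition cutoff_CMV :: "nat \<Rightarrow> (nat \<Rightarrow> complex) \<Rightarrow> complex mat" where
  "cutoff_CMV n \<alpha> = mat n n (\<lambda>(i, j). CMV \<alpha> i j)"


section \<open>Hermitian geometry of complex vectors and matrices\<close>

definition vnorm :: "complex vec \<Rightarrow> real" where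
  "vnorm v = L2_set (\<lambda>i. cmod (v $ i)) {..<dim_vec v}"

definition op_norm :: "complex mat \<Rightarrow> real" where
  "op_norm A = (SUP v \<in> {v \<in> carrier_vec (dim_col A). vnorm v \<le> 1}. vnorm (A *\<^sub>v v))"

definition unitary_mat :: "nat \<Rightarrow> complex mat \<Rightarrow> bool" where
  "unitary_mat n U \<longleftrightarrow> U \<in> carrier_mat n n \<and>
     mat_adjoint U * U = 1\<^sub>m n \<and> U * mat_adjoint U = 1\<^sub>m n"

definition isometry_on :: "complex mat \<Rightarrow> complex vec set \<Rightarrow> bool" where
  "isometry_on B S \<longleftrightarrow> (\<forall>v \<in> S. vnorm (B *\<^sub>v v) = vnorm v)"

abbreviation cspan :: "nat \<Rightarrow> complex vec set \<Rightarrow> complex vec set" where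
  "cspan n S \<equiv> LinearCombinations.module.span class_ring (module_vec TYPE(complex) n) S"

abbreviation cdim :: "nat \<Rightarrow> complex vec set \<Rightarrow> nat" where
  "cdim n W \<equiv> vectorspace.dim class_ring (module_vec TYPE(complex) n\<lparr>carrier := W\<rparr>)"


section \<open>The conditions on the pair of a matrix and a vector\<close>

definition V :: "nat \<Rightarrow> complex mat \<Rightarrow> complex vec \<Rightarrow> nat \<Rightarrow> complex vec set" where
  "V n A \<delta> k = cspan n
     ({(A ^\<^sub>m j) *\<^sub>v \<delta> | j. j \<le> k} \<union> {(mat_adjoint A ^\<^sub>m j) *\<^sub>v \<delta> | j. j \<le> k})"

definition cond_dim :: "nat \<Rightarrow> complex mat \<Rightarrow> complex vec \<Rightarrow> bool" where
  "cond_dim n A \<delta> \<longleftrightarrow> (\<forall>k.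
     (n = 2 * k + 1 \<longrightarrow> cdim n (V n A \<delta> k) = n) \<and>
     (n = 2 * k \<longrightarrow> cdim n (cspan n (V n A \<delta> (k - 1) \<union> {(A ^\<^sub>m k) *\<^sub>v \<delta>})) = n))"

text \<open>The spaces \<open>V\<^sub>k\<^sub>-\<^sub>1\<close> (\<open>n\<close> odd) and \<open>V\<^sub>k\<^sub>-\<^sub>2\<close> (\<open>n\<close> even) are defined only for
  \<open>n \<ge> 3\<close>. To make sense of smaller \<open>n\<close>, put \<open>x\<^sub>j = A\<^sup>j \<delta>\<close> for \<open>j \<ge> 0\<close> and
  \<open>x\<^sub>-\<^sub>j = (A\<^sup>*)\<^sup>j \<delta>\<close> for \<open>j > 0\<close>.
  For \<open>n \<ge> 3\<close> the two spaces on which \<open>A\<^sup>*\<close> and \<open>A\<close> are to be isometric are spanned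
  by the \<open>x\<^sub>j\<close> with \<open>-(k-1) \<le> j \<le> k\<close> and \<open>-k \<le> j \<le> k-1\<close> respectively if \<open>n = 2 k + 1\<close>,
  and with \<open>-(k-2) \<le> j \<le> k\<close> and \<open>-(k-1) \<le> j \<le> k-1\<close> if \<open>n = 2 k\<close>. The same index ranges are
  used for \<open>n < 3\<close>: both are empty if \<open>n = 1\<close> (so nothing is required), and they consist of
  \<open>j = 1\<close> and of \<open>j = 0\<close> if \<open>n = 2\<close>. (Reading \<open>V\<^sub>-\<^sub>1\<close> as \<open>{0}\<close>
  instead would force \<open>A\<close> to be unitary.)\<close>

definition cond_isometry :: "nat \<Rightarrow> complex mat \<Rightarrow> complex vec \<Rightarrow> bool" where
  "cond_isometry n A \<delta> \<longleftrightarrow>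
     (\<forall>k \<ge> 1. n = 2 * k + 1 \<longrightarrow>
        isometry_on (mat_adjoint A) (cspan n (V n A \<delta> (k - 1) \<union> {(A ^\<^sub>m k) *\<^sub>v \<delta>})) \<and>
        isometry_on A (cspan n (V n A \<delta> (k - 1) \<union> {(mat_adjoint A ^\<^sub>m k) *\<^sub>v \<delta>}))) \<and>
     (\<forall>k \<ge> 2. n = 2 * k \<longrightarrow>
        isometry_on (mat_adjoint A)
          (cspan n (V n A \<delta> (k - 2) \<union> {(A ^\<^sub>m (k - 1)) *\<^sub>v \<delta>, (A ^\<^sub>m k) *\<^sub>v \<delta>})) \<and>
        isometry_on A (V n A \<delta> (k - 1))) \<and>
     (n = 2 \<longrightarrow>
        isometry_on (mat_adjoint A) (cspan n {A *\<^sub>v \<delta>}) \<and> isometry_on A (V n A \<delta> 0))"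

definition CMV_conditions :: "nat \<Rightarrow> complex mat \<Rightarrow> complex vec \<Rightarrow> bool" where
  "CMV_conditions n A \<delta> \<longleftrightarrow>
     cond_dim n A \<delta> \<and> cond_isometry n A \<delta> \<and> op_norm A \<le> 1 \<and> \<not> unitary_mat n A"

text \<open>The columns of \<open>P\<close> are a basis in which \<open>\<delta>\<close> is \<open>(1, 0, \<dots>, 0)\<^sup>t\<close> and \<open>A\<close> is the cutoff
  CMV matrix of \<open>\<alpha>\<close>. The basis is required to be orthogonal with all vectors of length
  \<open>\<parallel>\<delta>\<parallel>\<close>: as \<open>\<delta>\<close> is the first basis vector and is not assumed to be a unit vector, orthonormality
  can only be asked for up to this common scale; the basis is orthonormal if \<open>\<parallel>\<delta>\<parallel> = 1\<close>.\<close>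

definition cutoff_CMV_in_basis ::
  "nat \<Rightarrow> complex mat \<Rightarrow> complex vec \<Rightarrow> (nat \<Rightarrow> complex) \<Rightarrow> complex mat \<Rightarrow> bool" where
  "cutoff_CMV_in_basis n A \<delta> \<alpha> P \<longleftrightarrow>
     P \<in> carrier_mat n n \<and>
     mat_adjoint P * P = complex_of_real ((vnorm \<delta>)\<^sup>2) \<cdot>\<^sub>m 1\<^sub>m n \<and>
     P *\<^sub>v unit_vec n 0 = \<delta> \<and>
     (\<exists>Q. similar_mat_wit A (cutoff_CMV n \<alpha>) P Q)"

end

theory Submission
  imports Defs
begin

text \<open>Write \<open>x\<^sub>j = A\<^sup>j \<delta>\<close> for \<open>j \<ge> 0\<close> and \<open>x\<^sub>-\<^sub>j = (A\<^sup>*)\<^sup>j \<delta>\<close> for \<open>j \<ge> 0\<close>; this is the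
  function \<open>krylov\<close>. All the spaces in the conditions are spans of \<open>x\<^sub>j\<close> over intervals of
  integers, the largest being an interval \<open>I\<close> of exactly \<open>n\<close> integers. A contraction \<open>B\<close> that
  preserves the norm of \<open>v\<close> satisfies \<open>B\<^sup>* B v = v\<close>, so the isometry conditions are linear
  equations on the generators. They say precisely that \<open>A\<close> and \<open>A\<^sup>*\<close> move along the sequence
  in opposite directions: \<open>A x\<^sub>j = x\<^sub>j\<^sub>+\<^sub>1\<close> and \<open>A\<^sup>* x\<^sub>j\<^sub>+\<^sub>1 = x\<^sub>j\<close> whenever \<open>j\<close> and
  \<open>j + 1\<close> lie in \<open>I\<close> (\<open>CMV_conditions_iff\<close>). The theorem is thus about a partial shift on a
  basis of \<open>n\<close> vectors.

  The two factors of a CMV matrix are direct sums of blocks \<open>\<Theta>(\<alpha>\<^sub>i)\<close>, each of which couples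
  an index with one neighbour. The factor \<open>s \<in> {0, 1}\<close> pairs \<open>i\<close> with \<open>partner s i\<close>. If the
  integers are listed in the zigzag order \<open>0, 1, -1, 2, -2, \<dots>\<close>, these two pairings become the
  reflections \<open>j \<mapsto> 1 - j\<close> and \<open>j \<mapsto> -j\<close>, whose composition is the shift
  \<open>j \<mapsto> j + 1\<close>. This is why such a product shifts the Krylov sequence.

  Part (a). In zigzag order, the Krylov vectors of a cutoff CMV matrix are triangular with positive
  diagonal: apart from the very first one, which fixes \<open>\<delta>\<close>, every application of a factor moves the
  leading position up by one and multiplies the leading coefficient by some \<open>\<rho> > 0\<close>
  (\<open>leads_krylov_cutoff_CMV\<close>). So they span, and they have
  zeros where the truncated last block fails to be isometric. As \<open>|\<alpha>\<^sub>n\<^sub>-\<^sub>1| < 1\<close>, that block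
  also prevents the matrix from being unitary.

  Part (b). Apply Gram-Schmidt to the \<open>x\<^sub>j\<close>, \<open>j \<in> I\<close>, in zigzag order and also in the
  reflected zigzag order. In these two orthonormal bases a map that exchanges partners in the two
  triangular systems is forced to be a direct sum of blocks \<open>\<Theta>(\<alpha>\<^sub>i)\<close>
  (\<open>partner_swap_eq_Theta_sum\<close>): vanishing entries come from triangularity, and a unitary
  2 by 2 matrix with positive off-diagonal entries is a \<open>\<Theta>(\<alpha>)\<close> with \<open>|\<alpha>| < 1\<close>. The reflections
  \<open>j \<mapsto> 1 - j\<close> and \<open>j \<mapsto> -j\<close> are realised by \<open>A\<close> and the identity, in an order that
  depends on the parity of \<open>n\<close>. The last block is a single number, which has modulus less than 1
  because \<open>A\<close> is a contraction and not unitary.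

  Part (c). A unitary map that intertwines two cutoff CMV matrices and preserves the first basis
  vector maps one triangular positive system to another, hence is the identity
  (\<open>unitary_fixing_leads\<close>). The coefficients can then be read off from the matrix entries one
  after the other (\<open>cutoff_CMV_inj\<close>).\<close>


section \<open>Adjoints, norms and contractions\<close>

lemma mat_adjoint_index [simp]:
  "i < dim_col A \<Longrightarrow> j < dim_row A \<Longrightarrow> mat_adjoint A $$ (i, j) = cnj (A $$ (j, i))"
  by (simp add: mat_adjoint_def mat_of_rows_def conjugate_complex_def)

lemma dim_mat_adjoint [simp]:
  "dim_row (mat_adjoint A) = dim_col A" "dim_col (mat_adjoint A) = dim_row A"
  by (auto simp: mat_adjoint_def)

lemma mat_adjoint_carrier [simp]:
  "A \<in> carrier_mat m n \<Longrightarrow> mat_adjoint A \<in> carrier_mat n m"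
  by (intro carrier_matI) simp_all

lemma mat_adjoint_adjoint [simp]: "mat_adjoint (mat_adjoint A) = (A :: complex mat)"
  by (rule eq_matI) auto

lemma mat_adjoint_mult:
  fixes A B :: "complex mat"
  assumes "A \<in> carrier_mat k m" "B \<in> carrier_mat m n"
  shows "mat_adjoint (A * B) = mat_adjoint B * mat_adjoint A"
proof (rule eq_matI)
  fix i j assume "i < dim_row (mat_adjoint B * mat_adjoint A)" "j < dim_col (mat_adjoint B * mat_adjoint A)"
  then have ij: "i < n" "j < k" using assms by auto
  have "mat_adjoint (A * B) $$ (i, j) = (\<Sum>l<m. cnj (A $$ (j, l)) * cnj (B $$ (l, i)))"
    using ij assms by (simp add: scalar_prod_def atLeast0LessThan)
  also have "\<dots> = (mat_adjoint B * mat_adjoint A) $$ (i, j)"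
    using ij assms by (simp add: scalar_prod_def atLeast0LessThan mult.commute)
  finally show "mat_adjoint (A * B) $$ (i, j) = (mat_adjoint B * mat_adjoint A) $$ (i, j)" .
qed (use assms in auto)

lemma mat_adjoint_one [simp]: "mat_adjoint (1\<^sub>m n :: complex mat) = 1\<^sub>m n"
  by (rule eq_matI) auto

lemma cscalar_prod_mult_mat_vec:
  fixes A :: "complex mat"
  assumes "A \<in> carrier_mat m n" "v \<in> carrier_vec n" "w \<in> carrier_vec m"
  shows "(A *\<^sub>v v) \<bullet>c w = v \<bullet>c (mat_adjoint A *\<^sub>v w)"
proof -
  have "(A *\<^sub>v v) \<bullet>c w = (\<Sum>i<m. \<Sum>j<n. A $$ (i, j) * v $ j * cnj (w $ i))"
    using assms by (auto simp: scalar_prod_def sum_distrib_right conjugate_complex_def atLeast0LessThan)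
  also have "\<dots> = (\<Sum>j<n. \<Sum>i<m. A $$ (i, j) * v $ j * cnj (w $ i))"
    by (rule sum.swap)
  also have "\<dots> = v \<bullet>c (mat_adjoint A *\<^sub>v w)"
    using assms by (auto simp: scalar_prod_def sum_distrib_left conjugate_complex_def atLeast0LessThan
        intro!: sum.cong)
  finally show ?thesis .
qed

lemma vnorm_nonneg [simp]: "vnorm v \<ge> 0"
  by (simp add: vnorm_def L2_set_nonneg)

lemma vnorm_sq: "v \<in> carrier_vec n \<Longrightarrow> (vnorm v)\<^sup>2 = (\<Sum>i<n. (cmod (v $ i))\<^sup>2)"
  by (auto simp: vnorm_def L2_set_def sum_nonneg)

lemma cscalar_prod_self:
  fixes v :: "complex vec"
  assumes "v \<in> carrier_vec n"
  shows "v \<bullet>c v = complex_of_real ((vnorm v)\<^sup>2)"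
  using assms unfolding vnorm_sq[OF assms]
  by (auto simp: scalar_prod_def conjugate_complex_def atLeast0LessThan complex_norm_square
      simp del: of_real_power intro!: sum.cong)

lemma vnorm_eq_0: 
  assumes "v \<in> carrier_vec n" "vnorm v = 0"
  shows "v = 0\<^sub>v n"
proof -
  have "\<forall>i\<in>{..<n}. (cmod (v $ i))\<^sup>2 = 0"
    using vnorm_sq[OF assms(1)] assms(2) by (subst sum_nonneg_eq_0_iff[symmetric]) auto
  then show ?thesis using assms(1) by (intro eq_vecI) auto
qed

lemma vnorm_unit_vec [simp]: "i < n \<Longrightarrow> vnorm (unit_vec n i) = 1"
proof -
  assume i: "i < n"
  have "(vnorm (unit_vec n i))\<^sup>2 = (\<Sum>l<n. if l = i then 1 else 0)"
    unfolding vnorm_sq[OF unit_vec_carrier] using i by (intro sum.cong) (auto simp: unit_vec_def)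
  also have "\<dots> = 1" using i by simp
  finally show ?thesis using vnorm_nonneg[of "unit_vec n i"] by (simp add: power2_eq_1_iff)
qed

lemma vnorm_smult: "vnorm (c \<cdot>\<^sub>v v) = cmod c * vnorm v"
proof -
  have "L2_set (\<lambda>i. cmod ((c \<cdot>\<^sub>v v) $ i)) {..<dim_vec v} = L2_set (\<lambda>i. cmod c * cmod (v $ i)) {..<dim_vec v}"
    by (rule L2_set_cong) (auto simp: norm_mult)
  then show ?thesis by (simp add: vnorm_def L2_set_right_distrib)
qed

lemma cmod_cscalar_prod_le:
  fixes v w :: "complex vec"
  assumes "v \<in> carrier_vec n" "w \<in> carrier_vec n"
  shows "cmod (v \<bullet>c w) \<le> vnorm v * vnorm w"
proof -
  have "cmod (v \<bullet>c w) \<le> (\<Sum>i<n. \<bar>cmod (v $ i)\<bar> * \<bar>cmod (w $ i)\<bar>)"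
    using assms
    by (auto simp: scalar_prod_def conjugate_complex_def atLeast0LessThan
        intro!: sum_norm_le simp: norm_mult)
  also have "\<dots> \<le> vnorm v * vnorm w"
    using assms unfolding vnorm_def by (metis L2_set_mult_ineq carrier_vecD)
  finally show ?thesis .
qed

lemma vnorm_mult_le:
  assumes A: "A \<in> carrier_mat m n" and v: "v \<in> carrier_vec n"
  shows "vnorm (A *\<^sub>v v) \<le> (\<Sum>i<m. \<Sum>j<n. cmod (A $$ (i, j))) * vnorm v"
proof -
  have comp: "cmod (v $ j) \<le> vnorm v" if "j < n" for j
    using that v unfolding vnorm_def by (intro member_le_L2_set) auto
  have "vnorm (A *\<^sub>v v) \<le> (\<Sum>i<m. cmod ((A *\<^sub>v v) $ i))"
    using A unfolding vnorm_def by (intro order_trans[OF L2_set_le_sum]) auto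
  also have "\<dots> \<le> (\<Sum>i<m. \<Sum>j<n. cmod (A $$ (i, j)) * vnorm v)"
    using A v comp by (intro sum_mono)
      (auto simp: scalar_prod_def atLeast0LessThan norm_mult intro!: sum_norm_le mult_left_mono)
  finally show ?thesis by (simp add: sum_distrib_right)
qed

text \<open>The supremum of a set of reals says something about its elements only if the set is bounded, which
  is where \<open>vnorm_mult_le\<close> comes in.\<close>

lemma op_norm_le_1_iff:
  assumes A: "A \<in> carrier_mat n n"
  shows "op_norm A \<le> 1 \<longleftrightarrow> (\<forall>v \<in> carrier_vec n. vnorm (A *\<^sub>v v) \<le> vnorm v)"
proof
  assume R: "\<forall>v \<in> carrier_vec n. vnorm (A *\<^sub>v v) \<le> vnorm v"
  have "0\<^sub>v n \<in> {v \<in> carrier_vec (dim_col A). vnorm v \<le> 1}"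
    using A by (auto simp: vnorm_def L2_set_def)
  then show "op_norm A \<le> 1" unfolding op_norm_def
    using A R by (intro cSUP_least) force+
next
  assume L: "op_norm A \<le> 1"
  show "\<forall>v \<in> carrier_vec n. vnorm (A *\<^sub>v v) \<le> vnorm v"
  proof
    fix v :: "complex vec" assume v: "v \<in> carrier_vec n"
    let ?S = "\<Sum>i<n. \<Sum>j<n. cmod (A $$ (i, j))"
    have "bdd_above ((\<lambda>v. vnorm (A *\<^sub>v v)) ` {v \<in> carrier_vec (dim_col A). vnorm v \<le> 1})"
    proof (rule bdd_aboveI2)
      fix w assume "w \<in> {v \<in> carrier_vec (dim_col A). vnorm v \<le> 1}"
      then have w: "w \<in> carrier_vec n" "vnorm w \<le> 1" using A by auto
      have "?S * vnorm w \<le> ?S" using w(2) by (intro mult_left_le) (auto intro!: sum_nonneg)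
      then show "vnorm (A *\<^sub>v w) \<le> ?S" using vnorm_mult_le[OF A w(1)] by linarith
    qed
    from cSUP_upper[OF _ this] have unit: "vnorm (A *\<^sub>v w) \<le> 1"
      if "w \<in> carrier_vec n" "vnorm w \<le> 1" for w
      using that A L unfolding op_norm_def by fastforce
    show "vnorm (A *\<^sub>v v) \<le> vnorm v"
    proof (cases "vnorm v = 0")
      case True
      then show ?thesis using vnorm_mult_le[OF A v] by simp
    next
      case False
      then have pos: "vnorm v > 0" using vnorm_nonneg[of v] by linarith
      let ?w = "complex_of_real (1 / vnorm v) \<cdot>\<^sub>v v"
      have "vnorm (A *\<^sub>v ?w) \<le> 1" using v pos by (intro unit) (auto simp: vnorm_smult norm_divide)
      then show ?thesis using A v pos
        by (simp add: mult_mat_vec vnorm_smult norm_divide field_simps)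
    qed
  qed
qed

lemma contraction_adjoint:
  assumes A: "A \<in> carrier_mat n n" and contr: "\<And>v. v \<in> carrier_vec n \<Longrightarrow> vnorm (A *\<^sub>v v) \<le> vnorm v"
    and w: "w \<in> carrier_vec n"
  shows "vnorm (mat_adjoint A *\<^sub>v w) \<le> vnorm w"
proof -
  let ?u = "mat_adjoint A *\<^sub>v w"
  have u: "?u \<in> carrier_vec n" using A w by (auto intro!: mult_mat_vec_carrier)
  have "(A *\<^sub>v ?u) \<bullet>c w = complex_of_real ((vnorm ?u)\<^sup>2)"
    using cscalar_prod_mult_mat_vec[OF A u w] cscalar_prod_self[OF u] by simp
  then have "(vnorm ?u)\<^sup>2 = cmod ((A *\<^sub>v ?u) \<bullet>c w)" by (simp add: norm_power)
  also have "\<dots> \<le> vnorm (A *\<^sub>v ?u) * vnorm w"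
    using A u w by (intro cmod_cscalar_prod_le[where n = n]) auto
  also have "\<dots> \<le> vnorm ?u * vnorm w" by (intro mult_right_mono contr u) simp
  finally have "vnorm ?u * vnorm ?u \<le> vnorm ?u * vnorm w" by (simp add: power2_eq_square)
  then show ?thesis using vnorm_nonneg[of ?u] vnorm_nonneg[of w]
    by (cases "vnorm ?u = 0") (auto simp: mult_le_cancel_left)
qed

lemma vnorm_diff_sq:
  fixes u v :: "complex vec"
  assumes "u \<in> carrier_vec n" "v \<in> carrier_vec n"
  shows "complex_of_real ((vnorm (u - v))\<^sup>2) = u \<bullet>c u - u \<bullet>c v - (v \<bullet>c u - v \<bullet>c v)"
proof -
  have d: "u - v \<in> carrier_vec n" using assms by simp
  have "(u - v) \<bullet>c (u - v) = (\<Sum>i<n. (u $ i - v $ i) * cnj (u $ i - v $ i))"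
    using assms by (auto simp: scalar_prod_def conjugate_complex_def atLeast0LessThan intro!: sum.cong)
  also have "\<dots> = u \<bullet>c u - u \<bullet>c v - (v \<bullet>c u - v \<bullet>c v)"
    using assms by (auto simp: scalar_prod_def conjugate_complex_def atLeast0LessThan
      algebra_simps sum_subtractf sum.distrib)
  finally show ?thesis unfolding cscalar_prod_self[OF d] .
qed

text \<open>The square of the norm of \<open>A\<^sup>* A v - v\<close> expands to
  \<open>\<parallel>A\<^sup>* A v\<parallel>\<^sup>2 - \<parallel>v\<parallel>\<^sup>2\<close>, which is not positive. So for a contraction the nonlinear condition of norm
  preservation at \<open>v\<close> becomes a linear equation for \<open>v\<close>.\<close>

lemma contraction_isometric_at:
  assumes A: "A \<in> carrier_mat n n" and contr: "\<And>v. v \<in> carrier_vec n \<Longrightarrow> vnorm (A *\<^sub>v v) \<le> vnorm v"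
    and v: "v \<in> carrier_vec n" and iso: "vnorm (A *\<^sub>v v) = vnorm v"
  shows "mat_adjoint A *\<^sub>v (A *\<^sub>v v) = v"
proof -
  let ?w = "mat_adjoint A *\<^sub>v (A *\<^sub>v v)"
  have w: "?w \<in> carrier_vec n" and Av: "A *\<^sub>v v \<in> carrier_vec n"
    using A v by (auto intro!: mult_mat_vec_carrier)
  have wv: "v \<bullet>c ?w = complex_of_real ((vnorm v)\<^sup>2)"
    using cscalar_prod_mult_mat_vec[OF A v Av] cscalar_prod_self[OF Av] iso by simp
  have vw: "?w \<bullet>c v = complex_of_real ((vnorm v)\<^sup>2)"
    using cscalar_prod_mult_mat_vec[OF mat_adjoint_carrier[OF A] Av v] cscalar_prod_self[OF Av] iso by simp
  have le: "vnorm ?w \<le> vnorm v" using contraction_adjoint[OF A contr Av] iso by simp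
  have d: "?w - v \<in> carrier_vec n" using w v by simp
  have "complex_of_real ((vnorm (?w - v))\<^sup>2) = ?w \<bullet>c ?w - ?w \<bullet>c v - (v \<bullet>c ?w - v \<bullet>c v)"
    by (rule vnorm_diff_sq[OF w v])
  also have "\<dots> = complex_of_real ((vnorm ?w)\<^sup>2 - (vnorm v)\<^sup>2)"
    unfolding wv vw cscalar_prod_self[OF v] cscalar_prod_self[OF w] by simp
  finally have "(vnorm (?w - v))\<^sup>2 = (vnorm ?w)\<^sup>2 - (vnorm v)\<^sup>2" by (simp only: of_real_eq_iff)
  moreover have "(vnorm ?w)\<^sup>2 \<le> (vnorm v)\<^sup>2" using le by (intro power_mono) auto
  ultimately have "(vnorm (?w - v))\<^sup>2 \<le> 0" by linarith
  then have "vnorm (?w - v) = 0" by simp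
  then have "?w - v = 0\<^sub>v n" using vnorm_eq_0[OF d] by simp
  show ?thesis
  proof (rule eq_vecI)
    fix i assume "i < dim_vec v"
    then show "?w $ i = v $ i"
      using arg_cong[OF \<open>?w - v = 0\<^sub>v n\<close>, of "\<lambda>u. u $ i"] v w by auto
  qed (use A v w in auto)
qed

lemma isometric_atI:
  assumes A: "A \<in> carrier_mat n n" and v: "v \<in> carrier_vec n"
    and "mat_adjoint A *\<^sub>v (A *\<^sub>v v) = v"
  shows "vnorm (A *\<^sub>v v) = vnorm v"
proof -
  have Av: "A *\<^sub>v v \<in> carrier_vec n"
    using A v by (auto intro!: mult_mat_vec_carrier)
  have "complex_of_real ((vnorm (A *\<^sub>v v))\<^sup>2) = (A *\<^sub>v v) \<bullet>c (A *\<^sub>v v)"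
    by (rule cscalar_prod_self[OF Av, symmetric])
  also have "\<dots> = v \<bullet>c v" unfolding cscalar_prod_mult_mat_vec[OF A v Av] assms(3) ..
  also have "\<dots> = complex_of_real ((vnorm v)\<^sup>2)" by (rule cscalar_prod_self[OF v])
  finally have "complex_of_real ((vnorm (A *\<^sub>v v))\<^sup>2) = complex_of_real ((vnorm v)\<^sup>2)" .
  then have "(vnorm (A *\<^sub>v v))\<^sup>2 = (vnorm v)\<^sup>2" by (simp only: of_real_eq_iff)
  then show ?thesis by (rule power2_eq_imp_eq) simp_all
qed


section \<open>Spans\<close>

lemma cspan_carrier:
  assumes "S \<subseteq> carrier_vec n" shows "cspan n S \<subseteq> carrier_vec n"
proof -
  interpret vec_space "TYPE(complex)" n .
  show ?thesis using span_is_subset2[of S] assms by simp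
qed

lemma in_cspan: assumes "S \<subseteq> carrier_vec n" shows "S \<subseteq> cspan n S"
proof -
  interpret vec_space "TYPE(complex)" n .
  show ?thesis using in_own_span[of S] assms by simp
qed

text \<open>The vectors that satisfy a property closed under linear operations form a subspace.\<close>

lemma cspan_induct:
  assumes v: "v \<in> cspan n S" and S: "\<And>v. v \<in> S \<Longrightarrow> v \<in> carrier_vec n \<and> P v"
    and zero: "P (0\<^sub>v n)"
    and add: "\<And>v w. v \<in> carrier_vec n \<Longrightarrow> w \<in> carrier_vec n \<Longrightarrow> P v \<Longrightarrow> P w \<Longrightarrow> P (v + w)"
    and smult: "\<And>c v. v \<in> carrier_vec n \<Longrightarrow> P v \<Longrightarrow> P (c \<cdot>\<^sub>v v)"
  shows "P v"
proof -
  interpret vec_space "TYPE(complex)" n .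
  have "submodule class_ring {v \<in> carrier_vec n. P v} V"
    using zero add smult by (unfold_locales) auto
  then have "span S \<subseteq> {v \<in> carrier_vec n. P v}" using S by (intro span_is_subset) auto
  then show ?thesis using v by auto
qed

lemma cdim_carrier: "cdim n (carrier_vec n) = n"
proof -
  interpret vec_space "TYPE(complex)" n .
  have "vs (carrier_vec n) = V" by (simp add: module_vec_def)
  then show ?thesis by (simp only: dim_is_n)
qed

text \<open>A basis of the span has \<open>n\<close> elements and is linearly independent in the whole space, so it is
  a basis of the whole space.\<close>

lemma cspan_eq_carrier_if_cdim:
  assumes finS: "finite S" and S: "S \<subseteq> carrier_vec n" and dim: "cdim n (cspan n S) = n"
  shows "cspan n S = carrier_vec n"
proof -
  interpret vec_space "TYPE(complex)" n .
  have sub: "submodule class_ring (span S) V" using S by (intro span_is_submodule) simp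
  have W: "vectorspace class_ring (vs (span S))"
    by (intro subspace_is_vs span_is_subspace) (simp add: S)
  have fd: "vectorspace.fin_dim class_ring (vs (span S))"
    using finS S by (intro fin_dim_span) auto
  obtain B where B: "finite B" "vectorspace.basis class_ring (vs (span S)) B"
    using vectorspace.finite_basis_exists[OF W fd] by blast
  have cardB: "card B = n" using vectorspace.dim_basis[OF W B] dim by (simp only:)
  note B' = B(2)[unfolded vectorspace.basis_def[OF W]]
  have BS: "B \<subseteq> span S" using B' by simp
  have li: "\<not> lin_dep B"
    using B' span_li_not_depend(2)[OF BS sub] by simp
  have Bc: "B \<subseteq> carrier_vec n" using BS cspan_carrier[OF S] by auto
  have "basis B" by (rule dim_li_is_basis) (use cardB li B(1) Bc dim_is_n in auto)
  then have "span B = carrier_vec n" unfolding basis_def by simp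
  moreover have "span B \<subseteq> span S" using BS sub by (intro span_is_subset)
  ultimately show ?thesis using cspan_carrier[OF S] by auto
qed

lemma cspan_add:
  assumes "S \<subseteq> carrier_vec n" "v \<in> cspan n S" "w \<in> cspan n S" shows "v + w \<in> cspan n S"
proof -
  interpret vec_space "TYPE(complex)" n .
  show ?thesis using span_add1[of S v w] assms by simp
qed

lemma cspan_smult:
  assumes "S \<subseteq> carrier_vec n" "v \<in> cspan n S" shows "c \<cdot>\<^sub>v v \<in> cspan n S"
proof -
  interpret vec_space "TYPE(complex)" n .
  show ?thesis using smult_in_span[of S v c] assms by simp
qed

lemma cspan_zero: "0\<^sub>v n \<in> cspan n S"
proof -
  interpret vec_space "TYPE(complex)" n .
  show ?thesis using span_zero[of S] by simp
qed

lemma cspan_subset: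
  assumes "S \<subseteq> carrier_vec n" "T \<subseteq> cspan n S" shows "cspan n T \<subseteq> cspan n S"
proof
  fix v assume "v \<in> cspan n T"
  then show "v \<in> cspan n S"
  proof (rule cspan_induct)
    fix w assume "w \<in> T"
    then show "w \<in> carrier_vec n \<and> w \<in> cspan n S" using assms(2) cspan_carrier[OF assms(1)] by blast
  qed (rule cspan_zero, erule (1) cspan_add[OF assms(1)], erule cspan_smult[OF assms(1)])
qed

lemma cspan_absorb:
  assumes "S \<subseteq> carrier_vec n" "T \<subseteq> carrier_vec n"
  shows "cspan n (cspan n S \<union> T) = cspan n (S \<union> T)"
proof
  have U: "S \<union> T \<subseteq> carrier_vec n" using assms by simp
  have "cspan n S \<subseteq> cspan n (S \<union> T)" using in_cspan[OF U] by (intro cspan_subset[OF U]) simp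
  then show "cspan n (cspan n S \<union> T) \<subseteq> cspan n (S \<union> T)"
    using in_cspan[OF U] by (intro cspan_subset[OF U]) simp
  have W: "cspan n S \<union> T \<subseteq> carrier_vec n" using assms cspan_carrier[OF assms(1)] by simp
  show "cspan n (S \<union> T) \<subseteq> cspan n (cspan n S \<union> T)"
    using in_cspan[OF W] in_cspan[OF assms(1)] by (intro cspan_subset[OF W]) blast
qed


section \<open>Direct sums of 2 by 2 blocks\<close>

text \<open>The index that shares a block with \<open>i\<close> when the blocks are the pairs \<open>{j, j + 1}\<close> with
  \<open>j mod 2 = s\<close>. Truncated subtraction makes \<open>0\<close> its own partner if \<open>s = 1\<close>, in accordance with
  the leading 1 by 1 block of \<open>\<M>\<close>.\<close>

definition partner :: "nat \<Rightarrow> nat \<Rightarrow> nat" where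
  "partner s i = (if i mod 2 = s then i + 1 else i - 1)"

text \<open>The case \<open>s = 0\<close> is the factor \<open>\<L>\<close> and \<open>s = 1\<close> the factor \<open>\<M>\<close> (\<open>CMV_L_eq\<close>,
  \<open>CMV_M_eq\<close>). The block of the pair \<open>{j, j + 1}\<close> carries the coefficient with index \<open>j\<close>, for
  both factors.\<close>

definition Theta_entry :: "nat \<Rightarrow> (nat \<Rightarrow> complex) \<Rightarrow> nat \<Rightarrow> nat \<Rightarrow> complex" where
  "Theta_entry s \<alpha> i j =
     (if j = i then if i mod 2 = s then cnj (\<alpha> i) else if i = 0 then 1 else - \<alpha> (i - 1)
      else if j = partner s i then complex_of_real (sqrt (1 - (cmod (\<alpha> (min i j)))\<^sup>2))
      else 0)"

definition Theta_sum :: "nat \<Rightarrow> nat \<Rightarrow> (nat \<Rightarrow> complex) \<Rightarrow> complex mat" where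
  "Theta_sum n s \<alpha> = mat n n (\<lambda>(i, j). Theta_entry s \<alpha> i j)"

lemma Theta_index:
  "Theta a $$ (0, 0) = cnj a" "Theta a $$ (Suc 0, Suc 0) = - a"
  "Theta a $$ (0, Suc 0) = complex_of_real (sqrt (1 - (cmod a)\<^sup>2))"
  "Theta a $$ (Suc 0, 0) = complex_of_real (sqrt (1 - (cmod a)\<^sup>2))"
  by (simp_all add: Theta_def Let_def mat_of_rows_list_def)

lemma nat_parity_cases:
  fixes i :: nat
  obtains m where "i = 2 * m" | m where "i = Suc (2 * m)"
  by (metis evenE oddE Suc_eq_plus1)

lemma double_div_mod:
  fixes m :: nat
  shows "2 * m div 2 = m" "Suc (2 * m) div 2 = m" "2 * m mod 2 = 0" "Suc (2 * m) mod 2 = Suc 0"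
  by simp_all

lemma CMV_L_eq: "CMV_L \<alpha> i j = Theta_entry 0 \<alpha> i j"
proof -
  consider m k where "i = 2 * m" "j = 2 * k" | m k where "i = 2 * m" "j = Suc (2 * k)"
    | m k where "i = Suc (2 * m)" "j = 2 * k" | m k where "i = Suc (2 * m)" "j = Suc (2 * k)"
    by (metis nat_parity_cases)
  then show ?thesis
  proof cases
    case 1 show ?thesis unfolding 1 CMV_L_def Theta_entry_def partner_def double_div_mod
      by (simp add: Theta_index)
  next
    case 2 show ?thesis unfolding 2 CMV_L_def Theta_entry_def partner_def double_div_mod
      by (simp add: Theta_index)
  next
    case 3 show ?thesis unfolding 3 CMV_L_def Theta_entry_def partner_def double_div_mod
      by (simp add: Theta_index min_def)
  next
    case 4 show ?thesis unfolding 4 CMV_L_def Theta_entry_def partner_def double_div_mod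
      by (simp add: Theta_index)
  qed
qed

lemma CMV_M_eq: "CMV_M \<alpha> i j = Theta_entry 1 \<alpha> i j"
proof (cases "i = 0 \<or> j = 0")
  case True
  then show ?thesis by (auto simp: CMV_M_def Theta_entry_def partner_def)
next
  case False
  then obtain i' j' where [simp]: "i = Suc i'" "j = Suc j'" by (metis not0_implies_Suc)
  have "CMV_M \<alpha> i j = (if i' div 2 = j' div 2 then Theta (\<alpha> (2 * (i' div 2) + 1)) $$ (i' mod 2, j' mod 2) else 0)"
    by (simp add: CMV_M_def)
  also have "\<dots> = Theta_entry 1 \<alpha> i j"
  proof -
    have par: "Suc (2 * m) mod 2 = 1" "Suc (Suc (2 * m)) mod 2 \<noteq> 1" for m by simp_all
    consider m k where "i' = 2 * m" "j' = 2 * k" | m k where "i' = 2 * m" "j' = Suc (2 * k)"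
      | m k where "i' = Suc (2 * m)" "j' = 2 * k" | m k where "i' = Suc (2 * m)" "j' = Suc (2 * k)"
      by (metis nat_parity_cases)
    then show ?thesis
    proof cases
      case 1 show ?thesis unfolding 1 Theta_entry_def partner_def double_div_mod
        using par[of m] par[of k] by (simp add: Theta_index 1)
    next
      case 2 show ?thesis unfolding 2 Theta_entry_def partner_def double_div_mod
        using par[of m] par[of k] by (simp add: Theta_index 2)
    next
      case 3 show ?thesis unfolding 3 Theta_entry_def partner_def double_div_mod
        using par[of m] par[of k] by (simp add: Theta_index min_def 3)
    next
      case 4 show ?thesis unfolding 4 Theta_entry_def partner_def double_div_mod
        using par[of m] par[of k] by (simp add: Theta_index 4)
    qed
  qed
  finally show ?thesis .
qed

lemma partner_partner: "s < 2 \<Longrightarrow> partner s (partner s i) = i"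
proof -
  assume "s < 2"
  then have "s = 0 \<or> s = 1" by linarith
  consider "i = 0" | m where "i = Suc (2 * m)" | m where "i = Suc (Suc (2 * m))"
    by (cases i; cases rule: nat_parity_cases[of "i - 1"]) simp_all
  then show ?thesis
    by cases (use \<open>s = 0 \<or> s = 1\<close> in \<open>elim disjE; simp add: partner_def\<close>)+
qed

lemma Theta_entry_commute: "s < 2 \<Longrightarrow> Theta_entry s \<alpha> i j = Theta_entry s \<alpha> j i"
proof (cases "i = j")
  case False
  assume s: "s < 2"
  have "partner s i = j \<longleftrightarrow> partner s j = i" using partner_partner[OF s] by metis
  then show ?thesis using False by (auto simp: Theta_entry_def min.commute)
qed simp

lemma one_less_2: "(1::nat) < 2" by simp

lemma Theta_entry_eq_0: "j \<noteq> i \<Longrightarrow> j \<noteq> partner s i \<Longrightarrow> Theta_entry s \<alpha> i j = 0"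
  by (simp add: Theta_entry_def)

lemma Theta_sum_carrier [simp]: "Theta_sum n s \<alpha> \<in> carrier_mat n n"
  by (simp add: Theta_sum_def)

lemma Theta_sum_dim [simp]: "dim_row (Theta_sum n s \<alpha>) = n" "dim_col (Theta_sum n s \<alpha>) = n"
  by (simp_all add: Theta_sum_def)

text \<open>The truncation of the product is the product of the truncations: an index \<open>l \<ge> n\<close>
  contributes to an entry of the upper left block only if \<open>n - 1\<close> and \<open>n\<close> are partners in
  both direct sums, and consecutive indices are partners in just one of them.\<close>

lemma cutoff_CMV_eq: "cutoff_CMV n \<alpha> = Theta_sum n 0 \<alpha> * Theta_sum n 1 \<alpha>"
proof (rule eq_matI)
  fix i j assume "i < dim_row (Theta_sum n 0 \<alpha> * Theta_sum n 1 \<alpha>)"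
    "j < dim_col (Theta_sum n 0 \<alpha> * Theta_sum n 1 \<alpha>)"
  then have ij: "i < n" "j < n" by auto
  have "CMV \<alpha> i j = (\<Sum>l<n. CMV_L \<alpha> i l * CMV_M \<alpha> l j)"
    unfolding CMV_def
  proof (rule suminf_finite)
    fix l assume "l \<notin> {..<n}"
    then have l: "l \<ge> n" by simp
    show "CMV_L \<alpha> i l * CMV_M \<alpha> l j = 0"
    proof (rule ccontr)
      assume "CMV_L \<alpha> i l * CMV_M \<alpha> l j \<noteq> 0"
      then have "Theta_entry 0 \<alpha> i l \<noteq> 0" "Theta_entry 1 \<alpha> j l \<noteq> 0"
        unfolding CMV_L_eq CMV_M_eq Theta_entry_commute[OF one_less_2, of \<alpha> l j]
        by auto
      moreover have "l \<noteq> i" "l \<noteq> j" using ij l by auto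
      ultimately have "l = partner 0 i" "l = partner 1 j"
        using Theta_entry_eq_0 by blast+
      then have "i mod 2 = 0" "l = i + 1" "j mod 2 = 1" "l = j + 1"
        using ij l unfolding partner_def by (auto split: if_splits)
      then show False by simp
    qed
  qed simp
  then show "cutoff_CMV n \<alpha> $$ (i, j) = (Theta_sum n 0 \<alpha> * Theta_sum n 1 \<alpha>) $$ (i, j)"
    using ij unfolding CMV_L_eq CMV_M_eq
    by (simp add: cutoff_CMV_def Theta_sum_def scalar_prod_def atLeast0LessThan)
qed (simp_all add: cutoff_CMV_def)

lemma cutoff_CMV_carrier [simp]: "cutoff_CMV n \<alpha> \<in> carrier_mat n n"
  by (simp add: cutoff_CMV_def)

lemma mat_adjoint_Theta_sum:
  assumes "s < 2"
  shows "mat_adjoint (Theta_sum n s \<alpha>) = Theta_sum n s (\<lambda>i. cnj (\<alpha> i))"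
proof (rule eq_matI)
  fix i j assume ij: "i < dim_row (Theta_sum n s (\<lambda>i. cnj (\<alpha> i)))"
    "j < dim_col (Theta_sum n s (\<lambda>i. cnj (\<alpha> i)))"
  have "cnj (Theta_entry s \<alpha> j i) = Theta_entry s (\<lambda>i. cnj (\<alpha> i)) j i"
    by (simp add: Theta_entry_def)
  then show "mat_adjoint (Theta_sum n s \<alpha>) $$ (i, j) = Theta_sum n s (\<lambda>i. cnj (\<alpha> i)) $$ (i, j)"
    using ij assms by (simp add: Theta_sum_def Theta_entry_commute[of s _ i j])
qed auto

lemma Theta_sum_mult_vec:
  assumes v: "v \<in> carrier_vec n" and i: "i < n"
  shows "(Theta_sum n s \<alpha> *\<^sub>v v) $ i = Theta_entry s \<alpha> i i * v $ i +
    (if partner s i \<noteq> i \<and> partner s i < n then Theta_entry s \<alpha> i (partner s i) * v $ partner s i else 0)"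
proof -
  let ?f = "\<lambda>l. Theta_entry s \<alpha> i l * v $ l"
  have "(Theta_sum n s \<alpha> *\<^sub>v v) $ i = (\<Sum>l<n. ?f l)"
    using v i by (simp add: Theta_sum_def scalar_prod_def atLeast0LessThan)
  also have "\<dots> = (\<Sum>l \<in> {i} \<union> ({partner s i} \<inter> {..<n}). ?f l)"
    using i by (intro sum.mono_neutral_right) (auto simp: Theta_entry_def)
  also have "\<dots> = ?f i + (if partner s i \<noteq> i \<and> partner s i < n then ?f (partner s i) else 0)"
    by (cases "partner s i = i"; cases "partner s i < n") auto
  finally show ?thesis .
qed

lemma Theta_sum_mult_vec_opener:
  assumes v: "v \<in> carrier_vec n" and i: "i < n" "i mod 2 = s"
  shows "(Theta_sum n s \<alpha> *\<^sub>v v) $ i = cnj (\<alpha> i) * v $ i +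
    (if Suc i < n then complex_of_real (sqrt (1 - (cmod (\<alpha> i))\<^sup>2)) * v $ Suc i else 0)"
  unfolding Theta_sum_mult_vec[OF v i(1)] using i(2)
  by (auto simp: partner_def Theta_entry_def)

lemma Theta_sum_mult_vec_closer:
  assumes v: "v \<in> carrier_vec n" and i: "Suc i < n" "i mod 2 = s"
  shows "(Theta_sum n s \<alpha> *\<^sub>v v) $ Suc i =
    complex_of_real (sqrt (1 - (cmod (\<alpha> i))\<^sup>2)) * v $ i - \<alpha> i * v $ Suc i"
proof -
  have "Suc i mod 2 \<noteq> s" using i(2) by (auto simp: mod_Suc)
  then show ?thesis
    unfolding Theta_sum_mult_vec[OF v i(1)] using i(1)
    by (auto simp: partner_def Theta_entry_def)
qed

lemma Theta_sum_mult_vec_0: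
  assumes v: "v \<in> carrier_vec n" and n: "0 < n"
  shows "(Theta_sum n (Suc 0) \<alpha> *\<^sub>v v) $ 0 = v $ 0"
  unfolding Theta_sum_mult_vec[OF v n] by (auto simp: partner_def Theta_entry_def)

text \<open>Each 2 by 2 block is unitary. If \<open>(n - 1) mod 2 = s\<close>, the truncation cuts the last block down to
  its upper left entry \<open>cnj \<alpha>\<^sub>n\<^sub>-\<^sub>1\<close>, and this is the only place where isometry can fail.\<close>

lemma Theta_sum_gram:
  assumes s: "s < 2" and \<alpha>: "\<And>i. cmod (\<alpha> i) \<le> 1" and v: "v \<in> carrier_vec n" and i: "i < n"
  shows "(mat_adjoint (Theta_sum n s \<alpha>) *\<^sub>v (Theta_sum n s \<alpha> *\<^sub>v v)) $ i =
    (if Suc i = n \<and> i mod 2 = s then complex_of_real ((cmod (\<alpha> i))\<^sup>2) else 1) * v $ i"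
proof -
  define w where "w = Theta_sum n s \<alpha> *\<^sub>v v"
  define r where "r j = complex_of_real (sqrt (1 - (cmod (\<alpha> j))\<^sup>2))" for j
  have w: "w \<in> carrier_vec n" using v unfolding w_def by (intro mult_mat_vec_carrier) auto
  have rr: "r j * r j = 1 - \<alpha> j * cnj (\<alpha> j)" for j
  proof -
    have "(cmod (\<alpha> j))\<^sup>2 \<le> 1" using \<alpha>[of j] by (simp add: power_le_one)
    then have "r j * r j = complex_of_real (1 - (cmod (\<alpha> j))\<^sup>2)"
      unfolding r_def of_real_mult[symmetric] by simp
    then show ?thesis by (simp add: complex_norm_square del: of_real_power)
  qed
  have rrx: "r j * (r j * x) = (1 - \<alpha> j * cnj (\<alpha> j)) * x" for j x
    by (metis rr mult.assoc)
  have adj: "mat_adjoint (Theta_sum n s \<alpha>) *\<^sub>v w = Theta_sum n s (\<lambda>i. cnj (\<alpha> i)) *\<^sub>v w"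
    by (simp only: mat_adjoint_Theta_sum[OF s])
  note opener = Theta_sum_mult_vec_opener[where s = s]
  note closer = Theta_sum_mult_vec_closer[where s = s]
  have "(mat_adjoint (Theta_sum n s \<alpha>) *\<^sub>v w) $ i =
    (if Suc i = n \<and> i mod 2 = s then complex_of_real ((cmod (\<alpha> i))\<^sup>2) else 1) * v $ i"
  proof (cases "i mod 2 = s")
    case True
    show ?thesis
    proof (cases "Suc i < n")
      case S: True
      have w1: "w $ i = cnj (\<alpha> i) * v $ i + r i * v $ Suc i"
        "w $ Suc i = r i * v $ i - \<alpha> i * v $ Suc i"
        unfolding w_def r_def opener[OF v i True] closer[OF v S True] using S by auto
      have "(mat_adjoint (Theta_sum n s \<alpha>) *\<^sub>v w) $ i = \<alpha> i * w $ i + r i * w $ Suc i"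
        unfolding adj opener[OF w i True] r_def using S by simp
      also have "\<dots> = v $ i" unfolding w1 by (simp add: algebra_simps rrx)
      finally show ?thesis using S by simp
    next
      case False
      then have n: "n = Suc i" using i by simp
      have "w $ i = cnj (\<alpha> i) * v $ i" unfolding w_def opener[OF v i True] using n by simp
      then have "(mat_adjoint (Theta_sum n s \<alpha>) *\<^sub>v w) $ i = \<alpha> i * cnj (\<alpha> i) * v $ i"
        unfolding adj opener[OF w i True] using n by simp
      then show ?thesis using True n by (simp add: complex_norm_square del: of_real_power)
    qed
  next
    case False
    show ?thesis
    proof (cases i)
      case 0
      then have s1: "s = Suc 0" using False s by auto
      have "w $ 0 = v $ 0" unfolding w_def s1 using 0 i by (intro Theta_sum_mult_vec_0 v) auto
      moreover have "(mat_adjoint (Theta_sum n s \<alpha>) *\<^sub>v w) $ 0 = w $ 0"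
        unfolding adj unfolding s1 using 0 i by (intro Theta_sum_mult_vec_0 w) auto
      ultimately show ?thesis using 0 False by simp
    next
      case (Suc j)
      have j: "j mod 2 = s" using False s Suc by (simp add: mod_Suc split: if_splits)
      have S: "Suc j < n" using Suc i by simp
      have w1: "w $ j = cnj (\<alpha> j) * v $ j + r j * v $ Suc j"
        "w $ Suc j = r j * v $ j - \<alpha> j * v $ Suc j"
        unfolding w_def r_def opener[OF v Suc_lessD[OF S] j] closer[OF v S j] using S by auto
      have "(mat_adjoint (Theta_sum n s \<alpha>) *\<^sub>v w) $ Suc j = r j * w $ j - cnj (\<alpha> j) * w $ Suc j"
        unfolding adj closer[OF w S j] r_def by simp
      also have "\<dots> = v $ Suc j" unfolding w1 by (simp add: algebra_simps rrx)
      finally show ?thesis using Suc False by simp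
    qed
  qed
  then show ?thesis unfolding w_def .
qed

lemma partner_ge: "l - 1 \<le> partner s l"
  unfolding partner_def by (cases "l mod 2 = s") simp_all

lemma partner_le: "partner s i \<le> Suc i"
  unfolding partner_def by (cases "i mod 2 = s") simp_all

text \<open>A support in an initial segment grows by at most one index.\<close>

lemma Theta_sum_support:
  assumes v: "v \<in> carrier_vec n" and z: "\<And>l. m \<le> l \<Longrightarrow> l < n \<Longrightarrow> v $ l = 0" and l: "m < l" "l < n"
  shows "(Theta_sum n s \<alpha> *\<^sub>v v) $ l = 0"
  unfolding Theta_sum_mult_vec[OF v l(2)] using z[of l] z[of "partner s l"] partner_ge[of l s] l by simp

lemma Theta_sum_unit_vec_0: "Theta_sum n 1 \<alpha> *\<^sub>v unit_vec n 0 = unit_vec n 0"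
proof (rule eq_vecI)
  fix i assume "i < dim_vec (unit_vec n 0 :: complex vec)"
  then have i: "i < n" by simp
  have "partner 1 i \<noteq> 0 \<or> i = 0"
  proof (rule disjCI)
    assume "i \<noteq> 0"
    moreover have "partner 1 0 = 0" by (simp add: partner_def)
    ultimately show "partner 1 i \<noteq> 0" using partner_partner[OF one_less_2, of i] by metis
  qed
  then show "(Theta_sum n 1 \<alpha> *\<^sub>v unit_vec n 0) $ i = unit_vec n 0 $ i"
    unfolding Theta_sum_mult_vec[OF unit_vec_carrier i] using i
    by (cases "i = 0") (simp_all add: unit_vec_def Theta_entry_def partner_def)
qed simp

lemma mat_mult_vec_carrier [simp]:
  "A \<in> carrier_mat n n \<Longrightarrow> v \<in> carrier_vec n \<Longrightarrow> A *\<^sub>v v \<in> carrier_vec n"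
  by (rule mult_mat_vec_carrier)

lemma Theta_sum_isometric:
  assumes "s < 2" "\<And>i. cmod (\<alpha> i) \<le> 1" and v: "v \<in> carrier_vec n"
    and last: "(n - 1) mod 2 = s \<Longrightarrow> v $ (n - 1) = 0"
  shows "mat_adjoint (Theta_sum n s \<alpha>) *\<^sub>v (Theta_sum n s \<alpha> *\<^sub>v v) = v"
proof (rule eq_vecI)
  fix i assume "i < dim_vec v"
  then have i: "i < n" using v by simp
  show "(mat_adjoint (Theta_sum n s \<alpha>) *\<^sub>v (Theta_sum n s \<alpha> *\<^sub>v v)) $ i = v $ i"
    unfolding Theta_sum_gram[OF assms(1,2) v i] using last by (cases "Suc i = n") force+
qed (use v in simp)

lemma Theta_sum_contraction:
  assumes "s < 2" "\<And>i. cmod (\<alpha> i) \<le> 1" and v: "v \<in> carrier_vec n"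
  shows "vnorm (Theta_sum n s \<alpha> *\<^sub>v v) \<le> vnorm v"
proof -
  let ?w = "Theta_sum n s \<alpha> *\<^sub>v v"
  define d where "d i = (if Suc i = n \<and> i mod 2 = s then (cmod (\<alpha> i))\<^sup>2 else 1)" for i
  have w: "?w \<in> carrier_vec n" using v by simp
  have "complex_of_real ((vnorm ?w)\<^sup>2) = ?w \<bullet>c ?w" by (rule cscalar_prod_self[OF w, symmetric])
  also have "\<dots> = v \<bullet>c (mat_adjoint (Theta_sum n s \<alpha>) *\<^sub>v ?w)"
    by (rule cscalar_prod_mult_mat_vec[OF Theta_sum_carrier v w])
  also have "\<dots> = (\<Sum>i<n. v $ i * cnj ((mat_adjoint (Theta_sum n s \<alpha>) *\<^sub>v ?w) $ i))"
    using v by (simp add: scalar_prod_def atLeast0LessThan)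
  also have "\<dots> = (\<Sum>i<n. complex_of_real (d i * (cmod (v $ i))\<^sup>2))"
  proof (rule sum.cong[OF refl])
    fix i assume "i \<in> {..<n}"
    then have i: "i < n" by simp
    have "(mat_adjoint (Theta_sum n s \<alpha>) *\<^sub>v ?w) $ i = complex_of_real (d i) * v $ i"
      unfolding Theta_sum_gram[OF assms(1,2) v i] d_def by simp
    then show "v $ i * cnj ((mat_adjoint (Theta_sum n s \<alpha>) *\<^sub>v ?w) $ i) =
        complex_of_real (d i * (cmod (v $ i))\<^sup>2)"
      by (simp add: complex_norm_square del: of_real_power)
  qed
  finally have "complex_of_real ((vnorm ?w)\<^sup>2) = complex_of_real (\<Sum>i<n. d i * (cmod (v $ i))\<^sup>2)"
    by simp
  then have "(vnorm ?w)\<^sup>2 = (\<Sum>i<n. d i * (cmod (v $ i))\<^sup>2)" by (simp only: of_real_eq_iff)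
  also have "\<dots> \<le> (\<Sum>i<n. 1 * (cmod (v $ i))\<^sup>2)"
    using assms(2) by (intro sum_mono mult_right_mono) (simp_all add: d_def power_le_one)
  also have "\<dots> = (vnorm v)\<^sup>2" by (simp add: vnorm_sq[OF v])
  finally show ?thesis by (rule power2_le_imp_le) simp
qed

lemma Theta_sum_last:
  assumes n: "n = Suc m" and s: "s < 2" "m mod 2 = s"
  shows "Theta_sum n s \<alpha> *\<^sub>v unit_vec n m = cnj (\<alpha> m) \<cdot>\<^sub>v unit_vec n m"
proof (rule eq_vecI)
  fix i assume "i < dim_vec (cnj (\<alpha> m) \<cdot>\<^sub>v unit_vec n m)"
  then have i: "i < n" by simp
  have "partner s m = n" using n s by (simp add: partner_def)
  then have "partner s i \<noteq> m" using partner_partner[OF s(1), of i] i by fastforce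
  then show "(Theta_sum n s \<alpha> *\<^sub>v unit_vec n m) $ i = (cnj (\<alpha> m) \<cdot>\<^sub>v unit_vec n m) $ i"
    unfolding Theta_sum_mult_vec[OF unit_vec_carrier i] using i n s
    by (cases "i = m") (simp_all add: unit_vec_def Theta_entry_def)
qed simp

lemma Theta_sum_cong:
  assumes s: "s < 2" and eq: "\<And>i. i < n \<Longrightarrow> i mod 2 = s \<Longrightarrow> \<alpha> i = \<beta> i"
  shows "Theta_sum n s \<alpha> = Theta_sum n s \<beta>"
proof (rule eq_matI)
  fix i j assume "i < dim_row (Theta_sum n s \<beta>)" "j < dim_col (Theta_sum n s \<beta>)"
  then have ij: "i < n" "j < n" by simp_all
  have "Theta_entry s \<alpha> i j = Theta_entry s \<beta> i j"
  proof (cases "i mod 2 = s")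
    case True
    then show ?thesis using eq[OF ij(1) True] by (simp add: Theta_entry_def partner_def min_def)
  next
    case False
    show ?thesis
    proof (cases i)
      case 0
      then show ?thesis using False by (simp add: Theta_entry_def partner_def)
    next
      case (Suc k)
      then have "k mod 2 = s" using False s by (simp add: mod_Suc split: if_splits)
      then have "\<alpha> k = \<beta> k" using eq[of k] ij Suc by simp
      then show ?thesis using False Suc by (simp add: Theta_entry_def partner_def min_def)
    qed
  qed
  then show "Theta_sum n s \<alpha> $$ (i, j) = Theta_sum n s \<beta> $$ (i, j)" using ij by (simp add: Theta_sum_def)
qed simp_all

lemma cutoff_CMV_mult_vec:
  assumes v: "v \<in> carrier_vec n"
  shows "cutoff_CMV n \<alpha> *\<^sub>v v = Theta_sum n 0 \<alpha> *\<^sub>v (Theta_sum n 1 \<alpha> *\<^sub>v v)"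
    "mat_adjoint (cutoff_CMV n \<alpha>) *\<^sub>v v =
      mat_adjoint (Theta_sum n 1 \<alpha>) *\<^sub>v (mat_adjoint (Theta_sum n 0 \<alpha>) *\<^sub>v v)"
  unfolding cutoff_CMV_eq mat_adjoint_mult[OF Theta_sum_carrier Theta_sum_carrier]
  by (rule assoc_mult_mat_vec[where ?n\<^sub>1.0 = n and ?n\<^sub>2.0 = n and ?n\<^sub>3.0 = n]; simp add: v)+


section \<open>Square and unitary matrices\<close>

lemma mult_mat_vec_zero: "B \<in> carrier_mat m n \<Longrightarrow> B *\<^sub>v 0\<^sub>v n = 0\<^sub>v m" for B :: "complex mat"
  by (intro eq_vecI) simp_all

lemma square_mat_assoc:
  fixes A B C :: "complex mat"
  assumes "A \<in> carrier_mat n n" "B \<in> carrier_mat n n" "C \<in> carrier_mat n n"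
  shows "A * B * C = A * (B * C)"
  by (rule assoc_mult_mat[OF assms])

lemma square_mat_one:
  fixes A :: "complex mat"
  assumes "A \<in> carrier_mat n n"
  shows "A * 1\<^sub>m n = A" "1\<^sub>m n * A = A"
  using right_mult_one_mat[OF assms] left_mult_one_mat[OF assms] by blast+

lemma square_mat_mult_carrier:
  fixes A B :: "complex mat"
  assumes "A \<in> carrier_mat n n" "B \<in> carrier_mat n n"
  shows "A * B \<in> carrier_mat n n"
  by (rule mult_carrier_mat[OF assms])

lemmas square_mat = square_mat_assoc square_mat_one square_mat_mult_carrier

lemma unitary_mat_carrier: "unitary_mat n U \<Longrightarrow> U \<in> carrier_mat n n"
  by (simp add: unitary_mat_def)

lemma unitary_mat_adjoint: "unitary_mat n U \<Longrightarrow> unitary_mat n (mat_adjoint U)"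
  by (simp add: unitary_mat_def)

lemma unitary_mat_mult:
  assumes U: "unitary_mat n U" and W: "unitary_mat n W"
  shows "unitary_mat n (U * W)"
proof -
  have c: "U \<in> carrier_mat n n" "W \<in> carrier_mat n n" "mat_adjoint U \<in> carrier_mat n n" "mat_adjoint W \<in> carrier_mat n n"
    using U W by (simp_all add: unitary_mat_def)
  have UW: "U * W \<in> carrier_mat n n" using c(1,2) by (rule square_mat_mult_carrier)
  have "mat_adjoint (U * W) * (U * W) = mat_adjoint W * ((mat_adjoint U * U) * W)"
    unfolding mat_adjoint_mult[OF c(1,2)] using c by (simp only: square_mat[where n = n])
  also have "\<dots> = 1\<^sub>m n" using U W c by (simp only: unitary_mat_def square_mat_one)
  finally have l: "mat_adjoint (U * W) * (U * W) = 1\<^sub>m n" .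
  then show ?thesis unfolding unitary_mat_def
    using UW mat_mult_left_right_inverse[OF mat_adjoint_carrier[OF UW] UW l] by blast
qed

lemma unitary_mat_mult_adjoint_vec:
  assumes U: "unitary_mat n U" and v: "v \<in> carrier_vec n"
  shows "U *\<^sub>v (mat_adjoint U *\<^sub>v v) = v"
proof -
  have c: "U \<in> carrier_mat n n" "mat_adjoint U \<in> carrier_mat n n" and e: "U * mat_adjoint U = 1\<^sub>m n"
    using U by (simp_all add: unitary_mat_def)
  show ?thesis unfolding assoc_mult_mat_vec[OF c v, symmetric] e by (rule one_mult_mat_vec[OF v])
qed

lemma unitary_mat_vnorm:
  assumes U: "unitary_mat n U" and v: "v \<in> carrier_vec n"
  shows "vnorm (U *\<^sub>v v) = vnorm v" "vnorm (mat_adjoint U *\<^sub>v v) = vnorm v"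
proof -
  have c: "U \<in> carrier_mat n n" "mat_adjoint U \<in> carrier_mat n n" using U by (simp_all add: unitary_mat_def)
  have "mat_adjoint U *\<^sub>v (U *\<^sub>v v) = v"
    using U assoc_mult_mat_vec[OF c(2,1) v] v by (simp add: unitary_mat_def)
  then show "vnorm (U *\<^sub>v v) = vnorm v" by (rule isometric_atI[OF c(1) v])
  have "U *\<^sub>v (mat_adjoint U *\<^sub>v v) = v"
    using U assoc_mult_mat_vec[OF c v] v by (simp add: unitary_mat_def)
  then show "vnorm (mat_adjoint U *\<^sub>v v) = vnorm v" by (intro isometric_atI[OF c(2) v]) simp
qed

lemma Theta_sum_unitary:
  assumes s: "s < 2" and \<alpha>: "\<And>i. cmod (\<alpha> i) \<le> 1" and last: "cmod (\<alpha> (n - 1)) = 1"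
  shows "unitary_mat n (Theta_sum n s \<alpha>)"
proof -
  let ?G = "Theta_sum n s \<alpha>"
  have G: "?G \<in> carrier_mat n n" "mat_adjoint ?G \<in> carrier_mat n n" by simp_all
  have "mat_adjoint ?G * ?G = 1\<^sub>m n"
  proof (rule eq_matI)
    fix i j assume "i < dim_row (1\<^sub>m n :: complex mat)" "j < dim_col (1\<^sub>m n :: complex mat)"
    then have ij: "i < n" "j < n" by simp_all
    have e: "unit_vec n j \<in> carrier_vec n" by (rule unit_vec_carrier)
    have "(mat_adjoint ?G * ?G) $$ (i, j) = ((mat_adjoint ?G * ?G) *\<^sub>v unit_vec n j) $ i"
      using ij G by simp
    also have "\<dots> = (mat_adjoint ?G *\<^sub>v (?G *\<^sub>v unit_vec n j)) $ i"
      unfolding assoc_mult_mat_vec[OF G(2,1) e] ..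
    also have "\<dots> = unit_vec n j $ i"
    proof -
      have "complex_of_real ((cmod (\<alpha> i))\<^sup>2) = 1" if "Suc i = n" using last that by auto
      then show ?thesis unfolding Theta_sum_gram[OF s \<alpha> e ij(1)] by simp
    qed
    finally show "(mat_adjoint ?G * ?G) $$ (i, j) = 1\<^sub>m n $$ (i, j)" using ij by (simp add: unit_vec_def eq_commute)
  qed simp_all
  then show ?thesis unfolding unitary_mat_def
    using G mat_mult_left_right_inverse[OF G(2,1)] by blast
qed


section \<open>The two-sided Krylov sequence\<close>

text \<open>The two-sided orbit of \<open>\<delta>\<close>, with powers of the adjoint as a substitute for negative powers of
  \<open>A\<close>.\<close>

definition krylov :: "complex mat \<Rightarrow> complex vec \<Rightarrow> int \<Rightarrow> complex vec" where
  "krylov A \<delta> j = (if j \<ge> 0 then (A ^\<^sub>m nat j) *\<^sub>v \<delta> else (mat_adjoint A ^\<^sub>m nat (- j)) *\<^sub>v \<delta>)"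

lemma pow_mat_Suc_mult_vec:
  assumes A: "A \<in> carrier_mat n n" and v: "v \<in> carrier_vec n"
  shows "(A ^\<^sub>m Suc k) *\<^sub>v v = A *\<^sub>v ((A ^\<^sub>m k) *\<^sub>v v)"
  using v
proof (induction k arbitrary: v)
  case 0
  then show ?case using A by simp
next
  case (Suc k)
  have p: "A ^\<^sub>m k \<in> carrier_mat n n" "A ^\<^sub>m Suc k \<in> carrier_mat n n" for k
    using A by (simp_all add: pow_carrier_mat del: pow_mat.simps)
  have Av: "A *\<^sub>v v \<in> carrier_vec n" using A Suc.prems by simp
  have "(A ^\<^sub>m Suc (Suc k)) *\<^sub>v v = (A ^\<^sub>m Suc k) *\<^sub>v (A *\<^sub>v v)"
    unfolding pow_mat.simps(2)[of A "Suc k"] by (rule assoc_mult_mat_vec[OF p(2) A Suc.prems])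
  also have "\<dots> = A *\<^sub>v ((A ^\<^sub>m k) *\<^sub>v (A *\<^sub>v v))" by (rule Suc.IH[OF Av])
  also have "(A ^\<^sub>m k) *\<^sub>v (A *\<^sub>v v) = (A ^\<^sub>m Suc k) *\<^sub>v v"
    unfolding pow_mat.simps(2)[of A k] by (rule assoc_mult_mat_vec[OF p(1) A Suc.prems, symmetric])
  finally show ?case .
qed

lemma pow_mat_intertwine:
  assumes A: "A \<in> carrier_mat n n" and B: "B \<in> carrier_mat n n" and U: "U \<in> carrier_mat n n"
    and v: "v \<in> carrier_vec n" and BU: "B * U = U * A"
  shows "(B ^\<^sub>m k) *\<^sub>v (U *\<^sub>v v) = U *\<^sub>v ((A ^\<^sub>m k) *\<^sub>v v)"
proof (induction k)
  case 0
  show ?case using A B U v by simp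
next
  case (Suc k)
  let ?w = "(A ^\<^sub>m k) *\<^sub>v v"
  have Uv: "U *\<^sub>v v \<in> carrier_vec n" using U v by simp
  have w: "?w \<in> carrier_vec n" using A v pow_carrier_mat[OF A, of k] by simp
  have "(B ^\<^sub>m Suc k) *\<^sub>v (U *\<^sub>v v) = B *\<^sub>v (U *\<^sub>v ?w)"
    unfolding pow_mat_Suc_mult_vec[OF B Uv] Suc ..
  also have "\<dots> = (B * U) *\<^sub>v ?w" by (rule assoc_mult_mat_vec[OF B U w, symmetric])
  also have "\<dots> = U *\<^sub>v (A *\<^sub>v ?w)" unfolding BU by (rule assoc_mult_mat_vec[OF U A w])
  also have "A *\<^sub>v ?w = (A ^\<^sub>m Suc k) *\<^sub>v v" by (rule pow_mat_Suc_mult_vec[OF A v, symmetric])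
  finally show ?case .
qed

context
  fixes n :: nat and A :: "complex mat" and \<delta> :: "complex vec"
  assumes A: "A \<in> carrier_mat n n" and \<delta>: "\<delta> \<in> carrier_vec n"
begin

lemma krylov_carrier [simp]: "krylov A \<delta> j \<in> carrier_vec n"
  using A \<delta> by (auto simp: krylov_def intro!: mult_mat_vec_carrier[of _ n n] pow_carrier_mat)

lemma krylov_0: "krylov A \<delta> 0 = \<delta>"
  using A \<delta> by (simp add: krylov_def)

lemma krylov_of_nat: "krylov A \<delta> (int j) = (A ^\<^sub>m j) *\<^sub>v \<delta>"
  by (simp add: krylov_def)

lemma krylov_minus_of_nat: "krylov A \<delta> (- int j) = (mat_adjoint A ^\<^sub>m j) *\<^sub>v \<delta>"
proof (cases j)
  case 0
  then show ?thesis using A \<delta> by (simp add: krylov_def)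
next
  case (Suc k)
  then have "\<not> - int j \<ge> 0" "nat (- (- int j)) = j" by simp_all
  then show ?thesis unfolding krylov_def by (simp only: if_False)
qed

lemma krylov_up: "j \<ge> 0 \<Longrightarrow> krylov A \<delta> (j + 1) = A *\<^sub>v krylov A \<delta> j"
  using pow_mat_Suc_mult_vec[OF A \<delta>, of "nat j"]
  by (simp add: krylov_def nat_add_distrib Suc_nat_eq_nat_zadd1[symmetric] add.commute del: pow_mat.simps)

lemma krylov_down: "j \<le> 0 \<Longrightarrow> krylov A \<delta> (j - 1) = mat_adjoint A *\<^sub>v krylov A \<delta> j"
  using pow_mat_Suc_mult_vec[OF mat_adjoint_carrier[OF A] \<delta>, of "nat (- j)"]
    krylov_minus_of_nat[of "nat (- j)"] krylov_minus_of_nat[of "Suc (nat (- j))"]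
  by (simp add: algebra_simps del: pow_mat.simps)

end

text \<open>The enumeration \<open>0, 1, -1, 2, -2, \<dots>\<close> of the integers, in which the CMV basis is obtained from
  the Krylov sequence.\<close>

definition zigzag :: "nat \<Rightarrow> int" where
  "zigzag i = (if even i then - int (i div 2) else int (Suc i div 2))"

lemma zigzag_simps [simp]: "zigzag 0 = 0" "zigzag (2 * m) = - int m" "zigzag (Suc (2 * m)) = int m + 1"
  by (simp_all add: zigzag_def)

lemma zigzag_add_2: "zigzag (Suc (Suc i)) = (if even i then zigzag i - 1 else zigzag i + 1)"
  by (cases rule: nat_parity_cases[of i]) (simp_all add: zigzag_def)

lemma zigzag_nonpos: "even i \<Longrightarrow> zigzag i \<le> 0"
  by (simp add: zigzag_def)

lemma zigzag_pos: "odd i \<Longrightarrow> zigzag i > 0"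
  by (cases rule: nat_parity_cases[of i]) simp_all

text \<open>In zigzag order the pairing for \<open>s = 1\<close> is the reflection \<open>j \<mapsto> -j\<close>, and the one
  for \<open>s = 0\<close> is \<open>j \<mapsto> 1 - j\<close>.\<close>

lemma zigzag_partner: "s < 2 \<Longrightarrow> zigzag (partner s i) = 1 - int s - zigzag i"
proof -
  assume "s < 2"
  then have "s = 0 \<or> s = 1" by linarith
  consider "i = 0" | m where "i = Suc (2 * m)" | m where "i = 2 * Suc m"
    by (cases i; cases rule: nat_parity_cases[of "i - 1"]) simp_all
  then show ?thesis
  proof cases
    case (3 m)
    show ?thesis using \<open>s = 0 \<or> s = 1\<close> unfolding 3 
      by (elim disjE) (simp_all add: partner_def zigzag_def)
  next
    case (2 m)
    show ?thesis using \<open>s = 0 \<or> s = 1\<close> unfolding 2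
      by (elim disjE) (simp_all add: partner_def zigzag_def)
  qed (use \<open>s = 0 \<or> s = 1\<close> in \<open>elim disjE; simp add: partner_def zigzag_def\<close>)
qed

text \<open>The Krylov vectors that are to form a basis are those with indices \<open>-k, \<dots>, k\<close> if
  \<open>n = 2 k + 1\<close>, and \<open>-(k-1), \<dots>, k\<close> if \<open>n = 2 k\<close>; these are the first \<open>n\<close> integers in
  zigzag order.\<close>

definition krylov_lo :: "nat \<Rightarrow> int" where "krylov_lo n = - int ((n - 1) div 2)"

definition krylov_hi :: "nat \<Rightarrow> int" where "krylov_hi n = int (n div 2)"

lemma less_iff_zigzag: "i < n \<longleftrightarrow> krylov_lo n \<le> zigzag i \<and> zigzag i \<le> krylov_hi n" if "n \<ge> 1"
  using that by (cases rule: nat_parity_cases[of i]; cases rule: nat_parity_cases[of n]; simp add: krylov_lo_def krylov_hi_def; linarith)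

lemma zigzag_surj: obtains i where "zigzag i = j"
proof (cases "j \<le> 0")
  case True
  then have "zigzag (2 * nat (- j)) = j" by simp
  then show ?thesis by (rule that)
next
  case False
  then have "zigzag (Suc (2 * nat (j - 1))) = j" by simp
  then show ?thesis by (rule that)
qed

lemma zigzag_image: "n \<ge> 1 \<Longrightarrow> zigzag ` {..<n} = {krylov_lo n..krylov_hi n}"
proof (intro equalityI subsetI)
  fix j assume n: "n \<ge> 1" and j: "j \<in> {krylov_lo n..krylov_hi n}"
  obtain i where "zigzag i = j" by (rule zigzag_surj)
  then show "j \<in> zigzag ` {..<n}" using less_iff_zigzag[OF n, of i] j by auto
qed (use less_iff_zigzag in auto)


section \<open>The conditions as shift equations\<close>

text \<open>By linearity of the equation for norm preservation it suffices to look at the generators.\<close>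

lemma isometry_on_cspan_iff:
  assumes B: "B \<in> carrier_mat n n" and contr: "\<And>v. v \<in> carrier_vec n \<Longrightarrow> vnorm (B *\<^sub>v v) \<le> vnorm v"
    and S: "S \<subseteq> carrier_vec n"
  shows "isometry_on B (cspan n S) \<longleftrightarrow> (\<forall>v\<in>S. mat_adjoint B *\<^sub>v (B *\<^sub>v v) = v)"
proof
  assume L: "isometry_on B (cspan n S)"
  show "\<forall>v\<in>S. mat_adjoint B *\<^sub>v (B *\<^sub>v v) = v"
  proof
    fix v assume v: "v \<in> S"
    then have "vnorm (B *\<^sub>v v) = vnorm v" using L in_cspan[OF S] unfolding isometry_on_def by blast
    then show "mat_adjoint B *\<^sub>v (B *\<^sub>v v) = v"
      using v S by (intro contraction_isometric_at[OF B contr]) blast+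
  qed
next
  assume R: "\<forall>v\<in>S. mat_adjoint B *\<^sub>v (B *\<^sub>v v) = v"
  show "isometry_on B (cspan n S)" unfolding isometry_on_def
  proof
    fix v assume v: "v \<in> cspan n S"
    have B': "mat_adjoint B \<in> carrier_mat n n" using B by simp
    from v have "mat_adjoint B *\<^sub>v (B *\<^sub>v v) = v"
    proof (rule cspan_induct)
      show "mat_adjoint B *\<^sub>v (B *\<^sub>v 0\<^sub>v n) = 0\<^sub>v n"
        using mult_mat_vec_zero[OF B] mult_mat_vec_zero[OF B'] by simp
    next
      fix v w :: "complex vec"
      assume "v \<in> carrier_vec n" "w \<in> carrier_vec n"
        "mat_adjoint B *\<^sub>v (B *\<^sub>v v) = v" "mat_adjoint B *\<^sub>v (B *\<^sub>v w) = w"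
      then show "mat_adjoint B *\<^sub>v (B *\<^sub>v (v + w)) = v + w"
        using B B' by (simp add: mult_add_distrib_mat_vec[where nr = n and nc = n])
    next
      fix c :: complex and v :: "complex vec"
      assume "v \<in> carrier_vec n" "mat_adjoint B *\<^sub>v (B *\<^sub>v v) = v"
      then show "mat_adjoint B *\<^sub>v (B *\<^sub>v (c \<cdot>\<^sub>v v)) = c \<cdot>\<^sub>v v"
        using B B' by (simp add: mult_mat_vec[where nr = n and nc = n])
    qed (use R S in blast)
    then show "vnorm (B *\<^sub>v v) = vnorm v"
      using v cspan_carrier[OF S] by (intro isometric_atI[OF B]) blast+
  qed
qed

context
  fixes n :: nat and A :: "complex mat" and \<delta> :: "complex vec"
  assumes A: "A \<in> carrier_mat n n" and \<delta>: "\<delta> \<in> carrier_vec n"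
begin

lemma V_eq: "V n A \<delta> k = cspan n (krylov A \<delta> ` {- int k..int k})"
proof -
  have set: "{f j |j. j \<le> k} = f ` {0..k}" for f :: "nat \<Rightarrow> complex vec"
    unfolding image_def by auto
  have I: "{0..int k} = int ` {0..k}" by (simp add: image_int_atLeastAtMost)
  have "{- int k..0} = uminus ` {0..int k}" by simp
  then have I': "{- int k..0} = uminus ` int ` {0..k}" unfolding I .
  have "{(A ^\<^sub>m j) *\<^sub>v \<delta> | j. j \<le> k} = krylov A \<delta> ` {0..int k}"
    unfolding krylov_of_nat[OF A \<delta>, symmetric] set I image_image ..
  moreover have "{(mat_adjoint A ^\<^sub>m j) *\<^sub>v \<delta> | j. j \<le> k} = krylov A \<delta> ` {- int k..0}"
    unfolding krylov_minus_of_nat[OF A \<delta>, symmetric] set I' image_image ..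
  moreover have "{0..int k} \<union> {- int k..0} = {- int k..int k}" by auto
  ultimately show ?thesis unfolding V_def by (metis image_Un)
qed

lemma cspan_V_Un:
  assumes "T = krylov A \<delta> ` J"
  shows "cspan n (V n A \<delta> k \<union> T) = cspan n (krylov A \<delta> ` ({- int k..int k} \<union> J))"
  unfolding V_eq assms image_Un using krylov_carrier[OF A \<delta>] by (intro cspan_absorb) blast+

lemma cond_dim_iff:
  assumes n: "n \<ge> 1"
  shows "cond_dim n A \<delta> \<longleftrightarrow> cspan n (krylov A \<delta> ` {krylov_lo n..krylov_hi n}) = carrier_vec n"
proof -
  let ?W = "cspan n (krylov A \<delta> ` {krylov_lo n..krylov_hi n})"
  have "cond_dim n A \<delta> \<longleftrightarrow> cdim n ?W = n"
  proof (cases rule: nat_parity_cases[of n])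
    case (1 k)
    then have k: "k \<ge> 1" using n by simp
    have "{- int (k - 1)..int (k - 1)} \<union> {int k} = {krylov_lo n..krylov_hi n}"
      using k by (auto simp: krylov_lo_def krylov_hi_def 1 of_nat_diff)
    then have "cspan n (V n A \<delta> (k - 1) \<union> {(A ^\<^sub>m k) *\<^sub>v \<delta>}) = ?W"
      by (subst cspan_V_Un[of _ "{int k}"]) (simp_all add: krylov_of_nat[OF A \<delta>])
    moreover have "2 * k \<noteq> 2 * m + 1" "2 * k = 2 * m \<longleftrightarrow> m = k" for m by presburger+
    ultimately show ?thesis unfolding cond_dim_def using 1 by simp
  next
    case (2 k)
    have "krylov_lo n = - int k" "krylov_hi n = int k" by (simp_all add: krylov_lo_def krylov_hi_def 2)
    then have "V n A \<delta> k = ?W" using V_eq[of k] by simp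
    moreover have "n \<noteq> 2 * m" "n = 2 * m + 1 \<longleftrightarrow> m = k" for m unfolding 2 by presburger+
    ultimately show ?thesis unfolding cond_dim_def by simp
  qed
  also have "\<dots> \<longleftrightarrow> ?W = carrier_vec n"
  proof
    have sub: "krylov A \<delta> ` {krylov_lo n..krylov_hi n} \<subseteq> carrier_vec n" using krylov_carrier[OF A \<delta>] by blast
    assume "cdim n ?W = n"
    then show "?W = carrier_vec n"
      by (rule cspan_eq_carrier_if_cdim[OF finite_imageI[OF finite_atLeastAtMost_int] sub])
  qed (simp only: cdim_carrier)
  finally show ?thesis .
qed

text \<open>In terms of index intervals the cases of the definition coincide: the adjoint is tested on
  all basis indices but the lowest, and \<open>A\<close> on all but the highest.\<close>

lemma cond_isometry_iff:
  assumes n: "n \<ge> 1"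
  shows "cond_isometry n A \<delta> \<longleftrightarrow>
    isometry_on (mat_adjoint A) (cspan n (krylov A \<delta> ` {krylov_lo n + 1..krylov_hi n})) \<and>
    isometry_on A (cspan n (krylov A \<delta> ` {krylov_lo n..krylov_hi n - 1}))"
proof -
  note kr = krylov_of_nat[OF A \<delta>] krylov_minus_of_nat[OF A \<delta>]
  consider "n = 1" | "n = 2" | k where "k \<ge> 2" "n = 2 * k" | k where "k \<ge> 1" "n = 2 * k + 1"
    using n by (cases rule: nat_parity_cases[of n]) force+
  then show ?thesis
  proof cases
    case 1
    have z: "v = 0\<^sub>v n" if "v \<in> cspan n {}" for v using that
      by (rule cspan_induct, simp_all, intro eq_vecI, simp_all)
    have "isometry_on B (cspan n {})" if "B \<in> carrier_mat n n" for B
      unfolding isometry_on_def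
    proof
      fix v assume "v \<in> cspan n {}"
      then have "v = 0\<^sub>v n" by (rule z)
      then show "vnorm (B *\<^sub>v v) = vnorm v" by (simp add: mult_mat_vec_zero[OF that])
    qed
    then show ?thesis unfolding cond_isometry_def using 1 A by (simp add: krylov_lo_def krylov_hi_def)
  next
    case 2
    have "krylov_lo n = 0" "krylov_hi n = 1" by (simp_all add: krylov_lo_def krylov_hi_def 2)
    moreover have "krylov A \<delta> 1 = A *\<^sub>v \<delta>" using A \<delta> by (simp add: krylov_def)
    ultimately show ?thesis unfolding cond_isometry_def V_eq using 2 by simp
  next
    case (3 k)
    have "{- int (k - 2)..int (k - 2)} \<union> {int (k - 1), int k} = {krylov_lo n + 1..krylov_hi n}"
      "{- int (k - 1)..int (k - 1)} = {krylov_lo n..krylov_hi n - 1}"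
      using 3(1) by (auto simp: krylov_lo_def krylov_hi_def 3(2) of_nat_diff)
    note sets = this
    have "cspan n (V n A \<delta> (k - 2) \<union> {(A ^\<^sub>m (k - 1)) *\<^sub>v \<delta>, (A ^\<^sub>m k) *\<^sub>v \<delta>}) =
        cspan n (krylov A \<delta> ` {krylov_lo n + 1..krylov_hi n})"
      unfolding sets(1)[symmetric] by (rule cspan_V_Un) (simp only: kr image_insert image_empty)
    moreover have "V n A \<delta> (k - 1) = cspan n (krylov A \<delta> ` {krylov_lo n..krylov_hi n - 1})"
      unfolding V_eq sets(2) ..
    moreover have "n \<noteq> 2 * m + 1" "n = 2 * m \<longleftrightarrow> m = k" "n \<noteq> 2" for m
      using 3 by presburger+
    ultimately show ?thesis unfolding cond_isometry_def using 3(1) by simp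
  next
    case (4 k)
    have "{- int (k - 1)..int (k - 1)} \<union> {int k} = {krylov_lo n + 1..krylov_hi n}"
      "{- int (k - 1)..int (k - 1)} \<union> {- int k} = {krylov_lo n..krylov_hi n - 1}"
      using 4(1) by (auto simp: krylov_lo_def krylov_hi_def 4(2) of_nat_diff)
    moreover have "cspan n (V n A \<delta> (k - 1) \<union> {(A ^\<^sub>m k) *\<^sub>v \<delta>}) =
        cspan n (krylov A \<delta> ` ({- int (k - 1)..int (k - 1)} \<union> {int k}))"
      "cspan n (V n A \<delta> (k - 1) \<union> {(mat_adjoint A ^\<^sub>m k) *\<^sub>v \<delta>}) =
        cspan n (krylov A \<delta> ` ({- int (k - 1)..int (k - 1)} \<union> {- int k}))"
      by (rule cspan_V_Un, simp only: kr image_insert image_empty)+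
    moreover have "n = 2 * m + 1 \<longleftrightarrow> m = k" "n \<noteq> 2 * m" "n \<noteq> 2" for m
      using 4 by presburger+
    ultimately show ?thesis unfolding cond_isometry_def using 4(1) by simp
  qed
qed

text \<open>For \<open>j \<ge> 0\<close> the vector \<open>x\<^sub>j\<^sub>+\<^sub>1\<close> is by definition \<open>A x\<^sub>j\<close>, and for \<open>j < 0\<close> the vector \<open>x\<^sub>j\<close>
  is \<open>A\<^sup>* x\<^sub>j\<^sub>+\<^sub>1\<close>. So in each case one of the two shift equations is automatic, and the other one
  holds if and only if \<open>A\<close> is isometric at \<open>x\<^sub>j\<close> and \<open>A\<^sup>*\<close> at \<open>x\<^sub>j\<^sub>+\<^sub>1\<close>.\<close>

lemma CMV_conditions_iff:
  assumes n: "n \<ge> 1"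
  shows "CMV_conditions n A \<delta> \<longleftrightarrow>
    cspan n (krylov A \<delta> ` {krylov_lo n..krylov_hi n}) = carrier_vec n \<and>
    (\<forall>j. krylov_lo n \<le> j \<and> j < krylov_hi n \<longrightarrow>
      A *\<^sub>v krylov A \<delta> j = krylov A \<delta> (j + 1) \<and> mat_adjoint A *\<^sub>v krylov A \<delta> (j + 1) = krylov A \<delta> j) \<and>
    (\<forall>v \<in> carrier_vec n. vnorm (A *\<^sub>v v) \<le> vnorm v) \<and> \<not> unitary_mat n A"
proof -
  let ?x = "krylov A \<delta>"
  have iso: "cond_isometry n A \<delta> \<longleftrightarrow>
    (\<forall>j. krylov_lo n \<le> j \<and> j < krylov_hi n \<longrightarrow> A *\<^sub>v ?x j = ?x (j + 1) \<and> mat_adjoint A *\<^sub>v ?x (j + 1) = ?x j)"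
    if contr: "\<forall>v \<in> carrier_vec n. vnorm (A *\<^sub>v v) \<le> vnorm v"
  proof -
    have sub: "?x ` J \<subseteq> carrier_vec n" for J using krylov_carrier[OF A \<delta>] by blast
    have c: "vnorm (A *\<^sub>v v) \<le> vnorm v" "vnorm (mat_adjoint A *\<^sub>v v) \<le> vnorm v"
      if "v \<in> carrier_vec n" for v
      using that contr contraction_adjoint[OF A _ that] by blast+
    have "cond_isometry n A \<delta> \<longleftrightarrow>
      (\<forall>j. krylov_lo n + 1 \<le> j \<and> j \<le> krylov_hi n \<longrightarrow> A *\<^sub>v (mat_adjoint A *\<^sub>v ?x j) = ?x j) \<and>
      (\<forall>j. krylov_lo n \<le> j \<and> j \<le> krylov_hi n - 1 \<longrightarrow> mat_adjoint A *\<^sub>v (A *\<^sub>v ?x j) = ?x j)"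
    proof -
      have i: "isometry_on A (cspan n (?x ` J)) \<longleftrightarrow> (\<forall>j\<in>J. mat_adjoint A *\<^sub>v (A *\<^sub>v ?x j) = ?x j)"
        "isometry_on (mat_adjoint A) (cspan n (?x ` J)) \<longleftrightarrow>
          (\<forall>j\<in>J. A *\<^sub>v (mat_adjoint A *\<^sub>v ?x j) = ?x j)" for J
        using isometry_on_cspan_iff[OF A c(1) sub] isometry_on_cspan_iff[OF mat_adjoint_carrier[OF A] c(2) sub]
        by (simp_all only: ball_simps mat_adjoint_adjoint)
      show ?thesis unfolding cond_isometry_iff[OF n] i by (simp only: atLeastAtMost_iff Ball_def)
    qed
    also have "\<dots> \<longleftrightarrow> (\<forall>j. krylov_lo n \<le> j \<and> j < krylov_hi n \<longrightarrow>
      A *\<^sub>v (mat_adjoint A *\<^sub>v ?x (j + 1)) = ?x (j + 1) \<and> mat_adjoint A *\<^sub>v (A *\<^sub>v ?x j) = ?x j)"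
      (is "?P \<and> ?Q \<longleftrightarrow> ?R")
    proof
      assume R: ?R
      have ?P
      proof (intro allI impI)
        fix j assume "krylov_lo n + 1 \<le> j \<and> j \<le> krylov_hi n"
        then show "A *\<^sub>v (mat_adjoint A *\<^sub>v ?x j) = ?x j" using R[rule_format, of "j - 1"] by simp
      qed
      moreover have ?Q using R by simp
      ultimately show "?P \<and> ?Q" ..
    qed simp
    also have "\<dots> \<longleftrightarrow> (\<forall>j. krylov_lo n \<le> j \<and> j < krylov_hi n \<longrightarrow>
      A *\<^sub>v ?x j = ?x (j + 1) \<and> mat_adjoint A *\<^sub>v ?x (j + 1) = ?x j)"
    proof -
      have "(A *\<^sub>v (mat_adjoint A *\<^sub>v ?x (j + 1)) = ?x (j + 1) \<and> mat_adjoint A *\<^sub>v (A *\<^sub>v ?x j) = ?x j) \<longleftrightarrow>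
        (A *\<^sub>v ?x j = ?x (j + 1) \<and> mat_adjoint A *\<^sub>v ?x (j + 1) = ?x j)" for j
      proof (cases "j \<ge> 0")
        case True
        show ?thesis using krylov_up[OF A \<delta> True] by metis
      next
        case False
        then show ?thesis using krylov_down[OF A \<delta>, of "j + 1"] by force
      qed
      then show ?thesis by simp
    qed
    finally show ?thesis .
  qed
  show ?thesis
    unfolding CMV_conditions_def cond_dim_iff[OF n] op_norm_le_1_iff[OF A] using iso by blast
qed

end


section \<open>Triangular systems of vectors\<close>

text \<open>A family \<open>v\<^sub>i\<close> with \<open>leads n i (v\<^sub>i)\<close> for all \<open>i < n\<close> consists of the columns of an upper
  triangular matrix with positive diagonal. There is no requirement on the entry at \<open>i\<close> if
  \<open>i \<ge> n\<close>, so that the vectors may run out of the truncated space.\<close>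

definition leads :: "nat \<Rightarrow> nat \<Rightarrow> complex vec \<Rightarrow> bool" where
  "leads n i v \<longleftrightarrow> (\<forall>l<n. i < l \<longrightarrow> v $ l = 0) \<and> (i < n \<longrightarrow> (\<exists>r>0. v $ i = complex_of_real r))"

lemma leads_mult_vec:
  assumes G: "G \<in> carrier_mat n n" and p: "p \<in> carrier_vec n" "leads n j p" and j: "j < n" and i: "i < n"
  shows "(G *\<^sub>v p) $ i = (\<Sum>l<j. G $$ (i, l) * p $ l) + G $$ (i, j) * p $ j"
proof -
  have "(G *\<^sub>v p) $ i = (\<Sum>l<n. G $$ (i, l) * p $ l)"
    using G p(1) i by (simp add: scalar_prod_def atLeast0LessThan)
  also have "\<dots> = (\<Sum>l<Suc j. G $$ (i, l) * p $ l)"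
    using j p(2) by (intro sum.mono_neutral_right) (simp_all add: leads_def)
  finally show ?thesis by simp
qed

text \<open>Triangular elimination: as the columns before \<open>i\<close> are known to be unit vectors, the equation
  \<open>D p\<^sub>i = p\<^sub>i\<close> determines column \<open>i\<close>. Only an initial segment of the vectors is assumed to be
  fixed, since the last one is lost in a truncated block.\<close>

lemma leads_fixed_cols:
  assumes D: "D \<in> carrier_mat n n" and m: "m \<le> n"
    and p: "\<And>i. i < m \<Longrightarrow> p i \<in> carrier_vec n" "\<And>i. i < m \<Longrightarrow> leads n i (p i)"
    and fixed: "\<And>i. i < m \<Longrightarrow> D *\<^sub>v p i = p i"
    and i: "i < m" and k: "k < n"
  shows "D $$ (k, i) = (if k = i then 1 else 0)"
  using i k
proof (induction i arbitrary: k rule: less_induct)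
  case (less i)
  have i: "i < n" using less.prems m by simp
  obtain r where r: "r > 0" "p i $ i = complex_of_real r"
    using p(2)[OF less.prems(1)] i unfolding leads_def by blast
  have "p i $ k = (\<Sum>l<i. D $$ (k, l) * p i $ l) + D $$ (k, i) * p i $ i"
    using leads_mult_vec[OF D p(1)[OF less.prems(1)] p(2)[OF less.prems(1)] i less.prems(2)]
      fixed[OF less.prems(1)] by simp
  also have "(\<Sum>l<i. D $$ (k, l) * p i $ l) = (\<Sum>l<i. if l = k then p i $ l else 0)"
    using less by (intro sum.cong refl) simp
  also have "\<dots> = (if k < i then p i $ k else 0)" by simp
  finally have e: "p i $ k = (if k < i then p i $ k else 0) + D $$ (k, i) * p i $ i" .
  consider "k < i" | "k = i" | "k > i" by linarith
  then show ?case
  proof cases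
    case 1
    then show ?thesis using e r by simp
  next
    case 2
    then show ?thesis using e r by simp
  next
    case 3
    then have "p i $ k = 0" using p(2)[OF less.prems(1)] less.prems(2) unfolding leads_def by blast
    then show ?thesis using e r 3 by simp
  qed
qed

text \<open>Back substitution: the last nonzero entry of a vector can be removed by subtracting a multiple of
  the \<open>y\<^sub>i\<close> that ends at the same position.\<close>

lemma cspan_leads:
  assumes y: "\<And>i. i < n \<Longrightarrow> y i \<in> carrier_vec n \<and> leads n i (y i)"
  shows "cspan n (y ` {..<n}) = carrier_vec n"
proof -
  let ?S = "y ` {..<n}"
  have S: "?S \<subseteq> carrier_vec n" using y by blast
  have "\<forall>v\<in>carrier_vec n. (\<forall>l<n. m \<le> l \<longrightarrow> v $ l = 0) \<longrightarrow> v \<in> cspan n ?S" if "m \<le> n" for m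
    using that
  proof (induction m)
    case 0
    show ?case
    proof (intro ballI impI)
      fix v :: "complex vec" assume "v \<in> carrier_vec n" "\<forall>l<n. 0 \<le> l \<longrightarrow> v $ l = 0"
      then have "v = 0\<^sub>v n" by (intro eq_vecI) simp_all
      then show "v \<in> cspan n ?S" using cspan_zero by simp
    qed
  next
    case (Suc m)
    show ?case
    proof (intro ballI impI)
      fix v :: "complex vec" assume v: "v \<in> carrier_vec n" "\<forall>l<n. Suc m \<le> l \<longrightarrow> v $ l = 0"
      have m: "m < n" using Suc.prems by simp
      obtain r where r: "r > 0" "y m $ m = complex_of_real r" and z: "\<And>l. l < n \<Longrightarrow> m < l \<Longrightarrow> y m $ l = 0"
        using y[OF m] m unfolding leads_def by blast
      have ym: "y m \<in> carrier_vec n" using y[OF m] by simp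
      define c where "c = v $ m / complex_of_real r"
      have "v - c \<cdot>\<^sub>v y m \<in> cspan n ?S"
      proof (rule Suc.IH[THEN bspec, THEN mp])
        show "\<forall>l<n. m \<le> l \<longrightarrow> (v - c \<cdot>\<^sub>v y m) $ l = 0"
        proof (intro allI impI)
          fix l assume l: "l < n" "m \<le> l"
          show "(v - c \<cdot>\<^sub>v y m) $ l = 0"
          proof (cases "l = m")
            case True
            then show ?thesis using ym v m r by (simp add: c_def)
          next
            case False
            then show ?thesis using ym v l z[of l] by simp
          qed
        qed
      qed (use m v ym in simp_all)
      moreover have "c \<cdot>\<^sub>v y m \<in> cspan n ?S" using m in_cspan[OF S] by (intro cspan_smult[OF S]) blast
      ultimately have "(v - c \<cdot>\<^sub>v y m) + c \<cdot>\<^sub>v y m \<in> cspan n ?S" by (rule cspan_add[OF S])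
      moreover have "(v - c \<cdot>\<^sub>v y m) + c \<cdot>\<^sub>v y m = v" using v(1) ym by (intro eq_vecI) simp_all
      ultimately show "v \<in> cspan n ?S" by simp
    qed
  qed
  from this[of n] show ?thesis using cspan_carrier[OF S] by force
qed

text \<open>Uniqueness of the QR decomposition. Given that the columns before \<open>i\<close> are unit vectors,
  triangularity of the images kills the entries of column \<open>i\<close> below the diagonal, orthogonality to the
  earlier columns kills those above it, and the diagonal entry is a positive number of modulus 1.\<close>

lemma unitary_fixing_leads:
  assumes U: "U \<in> carrier_mat n n" "mat_adjoint U * U = 1\<^sub>m n"
    and p: "\<And>i. i < n \<Longrightarrow> p i \<in> carrier_vec n \<and> leads n i (p i)"
    and q: "\<And>i. i < n \<Longrightarrow> leads n i (U *\<^sub>v p i)"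
  shows "U = 1\<^sub>m n"
proof -
  have orth: "(\<Sum>m<n. cnj (U $$ (m, k)) * U $$ (m, i)) = (if k = i then 1 else 0)" if "k < n" "i < n" for k i
    using arg_cong[OF U(2), of "\<lambda>B. B $$ (k, i)"] that U(1) by (simp add: scalar_prod_def atLeast0LessThan)
  have "\<forall>k<n. U $$ (k, i) = (if k = i then 1 else 0)" if "i < n" for i
    using that
  proof (induction i rule: less_induct)
    case (less i)
    have pi: "p i \<in> carrier_vec n" using p less.prems by blast
    obtain r where r: "r > 0" "p i $ i = complex_of_real r" using p less.prems unfolding leads_def by blast
    obtain r' where r': "r' > 0" "(U *\<^sub>v p i) $ i = complex_of_real r'"
      using q less.prems unfolding leads_def by blast
    have IH: "U $$ (k, l) = (if k = l then 1 else 0)" if "l < i" "k < n" for k l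
      using less.IH[OF that(1)] less.prems that by simp
    have Up: "(U *\<^sub>v p i) $ k = U $$ (k, i) * p i $ i" if k: "k < n" "i \<le> k" for k
    proof -
      have "(U *\<^sub>v p i) $ k = (\<Sum>l<n. U $$ (k, l) * p i $ l)"
        using U(1) pi k by (simp add: scalar_prod_def atLeast0LessThan)
      also have "\<dots> = (\<Sum>l\<in>{i}. U $$ (k, l) * p i $ l)"
      proof (rule sum.mono_neutral_right)
        show "\<forall>l\<in>{..<n} - {i}. U $$ (k, l) * p i $ l = 0"
        proof
          fix l assume l: "l \<in> {..<n} - {i}"
          show "U $$ (k, l) * p i $ l = 0"
          proof (cases "l < i")
            case True
            then show ?thesis using IH[OF True k(1)] k by simp
          next
            case False
            then have "p i $ l = 0" using p[OF less.prems] l unfolding leads_def by simp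
            then show ?thesis by simp
          qed
        qed
      qed (use less.prems in simp_all)
      finally show ?thesis by simp
    qed
    have below: "U $$ (k, i) = 0" if k: "k < n" "i < k" for k
    proof -
      have "(U *\<^sub>v p i) $ k = 0" using q[OF less.prems] k unfolding leads_def by blast
      then show ?thesis using Up[of k] k r by simp
    qed
    have above: "U $$ (k, i) = 0" if k: "k < i" for k
    proof -
      have kn: "k < n" using k less.prems by simp
      have "(\<Sum>m<n. cnj (U $$ (m, k)) * U $$ (m, i)) = (\<Sum>m<n. if m = k then U $$ (m, i) else 0)"
        using IH[OF k] by (intro sum.cong) simp_all
      then show ?thesis using orth[OF kn less.prems] k kn by simp
    qed
    have off: "U $$ (k, i) = 0" if "k < n" "k \<noteq> i" for k
      using that below[of k] above[of k] by linarith
    have diag: "U $$ (i, i) = complex_of_real (r' / r)"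
      using Up[of i] less.prems r r' by (simp add: field_simps)
    have "(\<Sum>m<n. cnj (U $$ (m, i)) * U $$ (m, i)) =
        (\<Sum>m<n. if m = i then cnj (U $$ (i, i)) * U $$ (i, i) else 0)"
      using off by (intro sum.cong) simp_all
    then have "cnj (U $$ (i, i)) * U $$ (i, i) = 1" using orth[of i i] less.prems by simp
    then have "complex_of_real ((r' / r) * (r' / r)) = complex_of_real 1" unfolding diag by simp
    then have "(r' / r)\<^sup>2 = 1" unfolding power2_eq_square by (simp only: of_real_eq_iff)
    then have "r' / r = 1" using r r' by (simp only: power2_eq_1_iff) (simp add: field_simps)
    then show ?case using off diag by simp
  qed
  then show ?thesis using U(1) by (intro eq_matI) simp_all
qed

text \<open>Gram-Schmidt, by induction on the number \<open>m\<close> of vectors treated. Besides orthonormality the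
  induction carries triangular expansions in both directions. That of \<open>f\<^sub>i\<close> in the \<open>y\<^sub>k\<close>
  is needed to see that the next residual is nonzero: it is a combination of the \<open>y\<^sub>k\<close> in which
  \<open>y\<^sub>m\<close> has coefficient 1. That of \<open>y\<^sub>i\<close> in the \<open>f\<^sub>j\<close> yields the positive diagonal.\<close>

lemma gram_schmidt_leading:
  fixes y :: "nat \<Rightarrow> nat \<Rightarrow> complex"
  assumes indep: "\<And>c. (\<And>l. l < n \<Longrightarrow> (\<Sum>k<n. c k * y k l) = 0) \<Longrightarrow> (\<And>k. k < n \<Longrightarrow> c k = 0)"
    and m: "m \<le> n"
  shows "\<exists>f. (\<forall>i<m. \<forall>j<m. (\<Sum>l<n. f i l * cnj (f j l)) = (if i = j then 1 else 0)) \<and>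
    (\<forall>i<m. \<exists>t. (\<forall>k. i < k \<longrightarrow> t k = 0) \<and> (\<forall>l<n. f i l = (\<Sum>k<n. t k * y k l))) \<and>
    (\<forall>i<m. \<exists>c r. (\<forall>l<n. y i l = (\<Sum>j<i. c j * f j l) + complex_of_real r * f i l) \<and> r > 0)"
  using m
proof (induction m)
  case 0
  show ?case by simp
next
  case (Suc m)
  have mn: "m < n" using Suc.prems by simp
  from Suc.IH[OF less_imp_le_nat[OF mn]] obtain f
    where F: "\<forall>i<m. \<forall>j<m. (\<Sum>l<n. f i l * cnj (f j l)) = (if i = j then 1 else 0)"
      "\<forall>i<m. \<exists>t. (\<forall>k. i < k \<longrightarrow> t k = 0) \<and> (\<forall>l<n. f i l = (\<Sum>k<n. t k * y k l))"
      "\<forall>i<m. \<exists>c r. (\<forall>l<n. y i l = (\<Sum>j<i. c j * f j l) + complex_of_real r * f i l) \<and> r > 0"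
    by (elim exE conjE) (rule that)
  note orth = F(1)[rule_format] and gen = F(2)[rule_format] and exp = F(3)[rule_format]
  have "\<forall>i. \<exists>t. i < m \<longrightarrow> (\<forall>k. i < k \<longrightarrow> t k = 0) \<and> (\<forall>l<n. f i l = (\<Sum>k<n. t k * y k l))"
    using F(2) by blast
  from choice[OF this] obtain t where T: "\<forall>i. i < m \<longrightarrow> (\<forall>k. i < k \<longrightarrow> t i k = 0) \<and>
      (\<forall>l<n. f i l = (\<Sum>k<n. t i k * y k l))"
    by (elim exE) (rule that)
  have t: "\<And>i k. i < m \<Longrightarrow> i < k \<Longrightarrow> t i k = 0"
    "\<And>i l. i < m \<Longrightarrow> l < n \<Longrightarrow> f i l = (\<Sum>k<n. t i k * y k l)"
    using T by blast+
  define c where "c j = (\<Sum>l<n. y m l * cnj (f j l))" for j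
  define w where "w l = y m l - (\<Sum>j<m. c j * f j l)" for l
  \<comment> \<open>the coefficients of the residual \<open>w\<close> with respect to the \<open>y\<^sub>k\<close>\<close>
  define tw where "tw k = (if k = m then 1 else 0) - (\<Sum>j<m. c j * t j k)" for k
  have w_tw: "w l = (\<Sum>k<n. tw k * y k l)" if l: "l < n" for l
  proof -
    have "(\<Sum>k<n. tw k * y k l) = (\<Sum>k<n. (if k = m then y k l else 0)) - (\<Sum>k<n. \<Sum>j<m. c j * t j k * y k l)"
      unfolding tw_def sum_subtractf[symmetric]
      by (intro sum.cong refl) (simp add: left_diff_distrib sum_distrib_right)
    also have "(\<Sum>k<n. (if k = m then y k l else 0)) = y m l" using mn by simp
    also have "(\<Sum>k<n. \<Sum>j<m. c j * t j k * y k l) = (\<Sum>j<m. c j * f j l)"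
      unfolding sum.swap[of _ "{..<m}" "{..<n}"] using t(2) l
      by (intro sum.cong refl) (simp add: sum_distrib_left mult.assoc)
    finally show ?thesis unfolding w_def by simp
  qed
  have tw_m: "tw m = 1" unfolding tw_def using t(1) by simp
  have tw_0: "tw k = 0" if "m < k" for k unfolding tw_def using t(1) that by simp
  define r where "r = sqrt (\<Sum>l<n. (cmod (w l))\<^sup>2)"
  have "\<exists>l<n. w l \<noteq> 0"
  proof (rule ccontr)
    assume "\<not> ?thesis"
    then have "(\<Sum>k<n. tw k * y k l) = 0" if "l < n" for l using w_tw that by metis
    then show False using indep[of tw m] mn tw_m by simp
  qed
  then have "(\<Sum>l<n. (cmod (w l))\<^sup>2) > 0" by (auto intro!: sum_pos2)
  then have r: "r > 0" "r\<^sup>2 = (\<Sum>l<n. (cmod (w l))\<^sup>2)" unfolding r_def by simp_all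
  have ww: "(\<Sum>l<n. w l * cnj (w l)) = complex_of_real (r\<^sup>2)"
    unfolding r(2) by (simp add: complex_norm_square del: of_real_power)
  define g where "g = f(m := \<lambda>l. w l / complex_of_real r)"
  have g: "g m = (\<lambda>l. w l / complex_of_real r)" "\<And>i. i < m \<Longrightarrow> g i = f i" unfolding g_def by simp_all
  have wf: "(\<Sum>l<n. w l * cnj (f i l)) = 0" if i: "i < m" for i
  proof -
    have "(\<Sum>l<n. w l * cnj (f i l)) = c i - (\<Sum>l<n. \<Sum>j<m. c j * (f j l * cnj (f i l)))"
      unfolding w_def c_def[of i] sum_subtractf[symmetric]
      by (intro sum.cong refl) (simp add: left_diff_distrib sum_distrib_right mult.assoc)
    also have "(\<Sum>l<n. \<Sum>j<m. c j * (f j l * cnj (f i l))) = (\<Sum>j<m. c j * (\<Sum>l<n. f j l * cnj (f i l)))"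
      unfolding sum.swap[of _ "{..<m}" "{..<n}"] by (simp add: sum_distrib_left)
    also have "\<dots> = (\<Sum>j<m. if j = i then c j else 0)" using orth i by (intro sum.cong refl) simp
    also have "\<dots> = c i" using i by simp
    finally show ?thesis by simp
  qed
  have fw: "(\<Sum>l<n. f i l * cnj (w l)) = 0" if i: "i < m" for i
  proof -
    have "(\<Sum>l<n. f i l * cnj (w l)) = cnj (\<Sum>l<n. w l * cnj (f i l))" by (simp add: mult.commute)
    then show ?thesis using wf[OF i] by simp
  qed
  have "(\<Sum>l<n. g i l * cnj (g j l)) = (if i = j then 1 else 0)" if ij: "i < Suc m" "j < Suc m" for i j
  proof -
    consider "i < m" "j < m" | "i < m" "j = m" | "i = m" "j < m" | "i = m" "j = m"
      using ij by linarith
    then show ?thesis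
    proof cases
      case 1
      then show ?thesis using orth by (simp add: g)
    next
      case 2
      have "(\<Sum>l<n. g i l * cnj (g j l)) = (\<Sum>l<n. f i l * cnj (w l)) / complex_of_real r"
        using 2 by (simp add: g sum_divide_distrib)
      then show ?thesis using 2 fw by simp
    next
      case 3
      have "(\<Sum>l<n. g i l * cnj (g j l)) = (\<Sum>l<n. w l * cnj (f j l)) / complex_of_real r"
        using 3 by (simp add: g sum_divide_distrib)
      then show ?thesis using 3 wf by simp
    next
      case 4
      have "(\<Sum>l<n. g i l * cnj (g j l)) = (\<Sum>l<n. w l * cnj (w l)) / complex_of_real (r\<^sup>2)"
        using 4 by (simp add: g sum_divide_distrib power2_eq_square)
      also have "\<dots> = 1" unfolding ww using r(1) by simp
      finally show ?thesis using 4 by simp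
    qed
  qed
  moreover have "\<exists>t. (\<forall>k. i < k \<longrightarrow> t k = 0) \<and> (\<forall>l<n. g i l = (\<Sum>k<n. t k * y k l))" if i: "i < Suc m" for i
  proof (cases "i = m")
    case True
    have "\<forall>l<n. g m l = (\<Sum>k<n. (tw k / complex_of_real r) * y k l)"
      using w_tw by (simp add: g sum_divide_distrib)
    moreover have "\<forall>k. m < k \<longrightarrow> tw k / complex_of_real r = 0" using tw_0 by simp
    ultimately show ?thesis unfolding True by (intro exI[of _ "\<lambda>k. tw k / complex_of_real r"]) blast
  next
    case False
    then show ?thesis using i gen[of i] g(2)[of i] by simp
  qed
  moreover have "\<exists>c r. (\<forall>l<n. y i l = (\<Sum>j<i. c j * g j l) + complex_of_real r * g i l) \<and> r > 0"
    if i: "i < Suc m" for i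
  proof (cases "i = m")
    case True
    have "\<forall>l<n. y m l = (\<Sum>j<m. c j * g j l) + complex_of_real r * g m l"
      using r(1) by (simp add: g w_def)
    then show ?thesis unfolding True using r(1) by blast
  next
    case False
    then have im: "i < m" using i by simp
    have "(\<Sum>j<i. c j * g j l) = (\<Sum>j<i. c j * f j l)" for c l using im by (intro sum.cong refl) (simp add: g)
    then show ?thesis using exp[OF im] im by (simp add: g)
  qed
  ultimately show ?case by (intro exI[of _ g]) blast
qed

text \<open>Existence of the QR decomposition of the matrix with columns \<open>y\<^sub>i\<close>, which is invertible because
  its columns span the space.\<close>

lemma exists_unitary_leading:
  assumes y: "\<And>i. i < n \<Longrightarrow> y i \<in> carrier_vec n" and span: "cspan n (y ` {..<n}) = carrier_vec n"
  obtains Y where "unitary_mat n Y" "\<And>i. i < n \<Longrightarrow> leads n i (mat_adjoint Y *\<^sub>v y i)"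
proof -
  define K where "K = mat n n (\<lambda>(l, k). y k $ l)"
  have K: "K \<in> carrier_mat n n" unfolding K_def by simp
  have surj: "\<exists>u\<in>carrier_vec n. K *\<^sub>v u = v" if v: "v \<in> carrier_vec n" for v
  proof -
    have "v \<in> cspan n (y ` {..<n})" using v span by simp
    then show ?thesis
    proof (rule cspan_induct)
      fix v assume "v \<in> y ` {..<n}"
      then obtain i where i: "i < n" "v = y i" by blast
      have "K *\<^sub>v unit_vec n i = y i"
        using i(1) y[OF i(1)] by (intro eq_vecI) (simp_all add: K_def)
      then show "v \<in> carrier_vec n \<and> (\<exists>u\<in>carrier_vec n. K *\<^sub>v u = v)"
        using i y unit_vec_carrier by blast
    next
      show "\<exists>u\<in>carrier_vec n. K *\<^sub>v u = 0\<^sub>v n" using mult_mat_vec_zero[OF K] zero_carrier_vec by blast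
    next
      fix v w :: "complex vec"
      assume "\<exists>u\<in>carrier_vec n. K *\<^sub>v u = v" "\<exists>u\<in>carrier_vec n. K *\<^sub>v u = w"
      then show "\<exists>u\<in>carrier_vec n. K *\<^sub>v u = v + w"
        using mult_add_distrib_mat_vec[OF K] by (metis add_carrier_vec)
    next
      fix c :: complex and v :: "complex vec"
      assume "\<exists>u\<in>carrier_vec n. K *\<^sub>v u = v"
      then show "\<exists>u\<in>carrier_vec n. K *\<^sub>v u = c \<cdot>\<^sub>v v"
        using mult_mat_vec[OF K] by (metis smult_carrier_vec)
    qed
  qed
  have "\<forall>i. \<exists>u. u \<in> carrier_vec n \<and> K *\<^sub>v u = unit_vec n i"
    using surj[OF unit_vec_carrier] by blast
  from choice[OF this] obtain T where T: "\<And>i. i < n \<Longrightarrow> T i \<in> carrier_vec n \<and> K *\<^sub>v T i = unit_vec n i"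
    by blast
  define S where "S = mat n n (\<lambda>(l, k). T k $ l)"
  have S: "S \<in> carrier_mat n n" unfolding S_def by simp
  have "K * S = 1\<^sub>m n"
  proof (rule eq_matI)
    fix l k assume "l < dim_row (1\<^sub>m n :: complex mat)" "k < dim_col (1\<^sub>m n :: complex mat)"
    then have lk: "l < n" "k < n" by simp_all
    have Tk: "T k \<in> carrier_vec n" using T[OF lk(2)] by blast
    have "col S k = T k" using carrier_vecD[OF Tk] lk by (intro eq_vecI) (simp_all add: S_def)
    then have "(K * S) $$ (l, k) = (K *\<^sub>v T k) $ l" using K S lk by simp
    then show "(K * S) $$ (l, k) = (1\<^sub>m n) $$ (l, k)" using T[OF lk(2)] lk by simp
  qed (use K S in simp_all)
  then have SK: "S * K = 1\<^sub>m n" using mat_mult_left_right_inverse[OF K S] by simp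
  have "\<exists>f. (\<forall>i<n. \<forall>j<n. (\<Sum>l<n. f i l * cnj (f j l)) = (if i = j then 1 else 0)) \<and>
    (\<forall>i<n. \<exists>t. (\<forall>k. i < k \<longrightarrow> t k = 0) \<and> (\<forall>l<n. f i l = (\<Sum>k<n. t k * y k $ l))) \<and>
    (\<forall>i<n. \<exists>c r. (\<forall>l<n. y i $ l = (\<Sum>j<i. c j * f j l) + complex_of_real r * f i l) \<and> r > 0)"
  proof (rule gram_schmidt_leading[OF _ order_refl])
    fix c k assume c: "\<And>l. l < n \<Longrightarrow> (\<Sum>k<n. c k * y k $ l) = 0" and k: "k < n"
    have v: "vec n c \<in> carrier_vec n" by simp
    have "K *\<^sub>v vec n c = 0\<^sub>v n"
      using c by (intro eq_vecI) (simp_all add: K_def scalar_prod_def atLeast0LessThan mult.commute)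
    then have "(S * K) *\<^sub>v vec n c = 0\<^sub>v n"
      unfolding assoc_mult_mat_vec[OF S K v] using mult_mat_vec_zero[OF S] by simp
    then have "vec n c = 0\<^sub>v n" unfolding SK one_mult_mat_vec[OF v] .
    then have "vec n c $ k = 0\<^sub>v n $ k" by simp
    then show "c k = 0" using k by simp
  qed
  then obtain f
    where F: "\<forall>i<n. \<forall>j<n. (\<Sum>l<n. f i l * cnj (f j l)) = (if i = j then 1 else 0)"
      "\<forall>i<n. \<exists>c r. (\<forall>l<n. y i $ l = (\<Sum>j<i. c j * f j l) + complex_of_real r * f i l) \<and> r > 0"
    by (elim exE conjE) (rule that)
  note orth = F(1)[rule_format] and exp = F(2)[rule_format]
  define Y where "Y = mat n n (\<lambda>(l, k). f k l)"
  have Y: "Y \<in> carrier_mat n n" unfolding Y_def by simp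
  have YY: "mat_adjoint Y * Y = 1\<^sub>m n"
  proof (rule eq_matI)
    fix i j assume "i < dim_row (1\<^sub>m n :: complex mat)" "j < dim_col (1\<^sub>m n :: complex mat)"
    then have ij: "i < n" "j < n" by simp_all
    then have "(mat_adjoint Y * Y) $$ (i, j) = (\<Sum>l<n. f j l * cnj (f i l))"
      by (simp add: Y_def scalar_prod_def atLeast0LessThan mult.commute)
    then show "(mat_adjoint Y * Y) $$ (i, j) = 1\<^sub>m n $$ (i, j)" using orth[OF ij(2,1)] ij by simp
  qed (simp_all add: Y_def)
  have U: "unitary_mat n Y"
    unfolding unitary_mat_def using Y YY mat_mult_left_right_inverse[OF mat_adjoint_carrier[OF Y] Y YY] by blast
  moreover have "leads n i (mat_adjoint Y *\<^sub>v y i)" if i: "i < n" for i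
  proof -
    obtain c r where e: "\<And>l. l < n \<Longrightarrow> y i $ l = (\<Sum>j<i. c j * f j l) + complex_of_real r * f i l" and r: "r > 0"
      using exp[OF i] by blast
    have ent: "(mat_adjoint Y *\<^sub>v y i) $ k = (if k = i then complex_of_real r else 0)" if k: "k < n" "i \<le> k" for k
    proof -
      have "(mat_adjoint Y *\<^sub>v y i) $ k = (\<Sum>l<n. y i $ l * cnj (f k l))"
        using k y[OF i] Y by (simp add: Y_def scalar_prod_def atLeast0LessThan mult.commute)
      also have "\<dots> = (\<Sum>l<n. (\<Sum>j<i. c j * (f j l * cnj (f k l))) + complex_of_real r * (f i l * cnj (f k l)))"
        using e by (intro sum.cong refl) (simp add: distrib_right sum_distrib_right mult.assoc)
      also have "\<dots> = (\<Sum>j<i. c j * (\<Sum>l<n. f j l * cnj (f k l))) + complex_of_real r * (\<Sum>l<n. f i l * cnj (f k l))"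
        unfolding sum.distrib sum.swap[of _ "{..<i}" "{..<n}"] by (simp add: sum_distrib_left)
      also have "(\<Sum>j<i. c j * (\<Sum>l<n. f j l * cnj (f k l))) = 0"
        using orth k i by (intro sum.neutral) simp
      finally show ?thesis using orth[OF i k(1)] by simp
    qed
    show ?thesis unfolding leads_def
    proof (intro conjI allI impI)
      fix l assume "l < n" "i < l"
      then show "(mat_adjoint Y *\<^sub>v y i) $ l = 0" using ent[of l] by simp
    next
      show "\<exists>r>0. (mat_adjoint Y *\<^sub>v y i) $ i = complex_of_real r" using ent[OF i] r by auto
    qed
  qed
  ultimately show ?thesis by (rule that)
qed


section \<open>Cutoff CMV matrices satisfy the conditions\<close>

text \<open>If \<open>i\<close> opens a block, the factor moves the leading position to its partner \<open>i + 1\<close> and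
  multiplies the leading coefficient by \<open>\<rho>\<^sub>i > 0\<close>.\<close>

lemma leads_Theta_sum:
  assumes v: "v \<in> carrier_vec n" and \<alpha>: "cmod (\<alpha> i) < 1" and lead: "leads n i v" and i: "i mod 2 = s"
  shows "leads n (Suc i) (Theta_sum n s \<alpha> *\<^sub>v v)"
  unfolding leads_def
proof (intro conjI allI impI)
  fix l assume "l < n" "Suc i < l"
  then show "(Theta_sum n s \<alpha> *\<^sub>v v) $ l = 0"
    using lead by (intro Theta_sum_support[where m = "Suc i"] v) (simp_all add: leads_def)
next
  assume S: "Suc i < n"
  then obtain r where r: "r > 0" "v $ i = complex_of_real r" and z: "v $ Suc i = 0"
    using lead unfolding leads_def by (metis Suc_lessD lessI)
  have "(cmod (\<alpha> i))\<^sup>2 < 1" using \<alpha> by (simp add: power_less_one_iff)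
  then have "sqrt (1 - (cmod (\<alpha> i))\<^sup>2) * r > 0" using r(1) by simp
  moreover have "(Theta_sum n s \<alpha> *\<^sub>v v) $ Suc i = complex_of_real (sqrt (1 - (cmod (\<alpha> i))\<^sup>2) * r)"
    unfolding Theta_sum_mult_vec_closer[OF v S i] z r(2) by simp
  ultimately show "\<exists>r>0. (Theta_sum n s \<alpha> *\<^sub>v v) $ Suc i = complex_of_real r" by blast
qed

text \<open>Two steps in zigzag order are one application of \<open>\<L> \<M>\<close> at odd positions, and of
  \<open>\<M>\<^sup>* \<L>\<^sup>*\<close> at even ones. In both cases the parities are such that each factor finds the leading
  position at the opening of a block.\<close>

lemma leads_krylov_cutoff_CMV:
  assumes \<alpha>: "verblunsky \<alpha>"
  shows "leads n i (krylov (cutoff_CMV n \<alpha>) (unit_vec n 0) (zigzag i))"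
proof -
  let ?C = "cutoff_CMV n \<alpha>" and ?e = "unit_vec n 0 :: complex vec"
  let ?L = "Theta_sum n 0 \<alpha>" and ?M = "Theta_sum n 1 \<alpha>"
  let ?x = "\<lambda>i. krylov ?C ?e (zigzag i)"
  have \<alpha>1: "cmod (\<alpha> j) < 1" "cmod (cnj (\<alpha> j)) < 1" for j using \<alpha> by (simp_all add: verblunsky_def)
  have x: "?x i \<in> carrier_vec n" for i by simp
  have C: "?C *\<^sub>v v = ?L *\<^sub>v (?M *\<^sub>v v)" if "v \<in> carrier_vec n" for v
    unfolding cutoff_CMV_eq by (rule assoc_mult_mat_vec[OF Theta_sum_carrier Theta_sum_carrier that])
  have C': "mat_adjoint ?C *\<^sub>v v =
      Theta_sum n 1 (\<lambda>i. cnj (\<alpha> i)) *\<^sub>v (Theta_sum n 0 (\<lambda>i. cnj (\<alpha> i)) *\<^sub>v v)"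
    if "v \<in> carrier_vec n" for v
    unfolding cutoff_CMV_eq mat_adjoint_mult[OF Theta_sum_carrier Theta_sum_carrier]
    by (subst (1 2) mat_adjoint_Theta_sum, simp, simp, rule assoc_mult_mat_vec[OF Theta_sum_carrier Theta_sum_carrier that])
  have lead0: "leads n 0 ?e"
    by (auto simp: leads_def unit_vec_def intro: exI[of _ 1])
  show ?thesis
  proof (induction i rule: less_induct)
    case (less i)
    consider "i = 0" | "i = 1" | k where "i = Suc (Suc k)" by (metis One_nat_def not0_implies_Suc)
    then show ?case
    proof cases
      case 1
      then show ?thesis using lead0
        by (simp add: krylov_0[OF cutoff_CMV_carrier unit_vec_carrier])
    next
      case 2
      have "?x 1 = ?C *\<^sub>v ?e"
        using krylov_up[of ?C n ?e 0] zigzag_simps(3)[of 0]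
        by (simp add: krylov_0[OF cutoff_CMV_carrier unit_vec_carrier])
      also have "\<dots> = ?L *\<^sub>v ?e" by (simp only: C[OF unit_vec_carrier] Theta_sum_unit_vec_0)
      finally show ?thesis using leads_Theta_sum[OF unit_vec_carrier \<alpha>1(1) lead0, of 0] 2 by simp
    next
      case (3 k)
      have IH: "leads n k (?x k)" using less 3 by simp
      show ?thesis
      proof (cases "even k")
        case True
        have "?x i = mat_adjoint ?C *\<^sub>v ?x k"
          using krylov_down[of ?C n ?e "zigzag k"] zigzag_nonpos[OF True] True 3 by (simp add: zigzag_add_2)
        moreover have "leads n (Suc (Suc k))
           (Theta_sum n 1 (\<lambda>i. cnj (\<alpha> i)) *\<^sub>v (Theta_sum n 0 (\<lambda>i. cnj (\<alpha> i)) *\<^sub>v ?x k))"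
          using True IH \<alpha>1 by (intro leads_Theta_sum) (simp_all add: even_iff_mod_2_eq_zero mod_Suc)
        ultimately show ?thesis using 3 by (simp only: C'[OF x])
      next
        case False
        have "?x i = ?C *\<^sub>v ?x k"
          using krylov_up[of ?C n ?e "zigzag k"] zigzag_pos[OF False] False 3 by (simp add: zigzag_add_2)
        moreover have "leads n (Suc (Suc k)) (?L *\<^sub>v (?M *\<^sub>v ?x k))"
          using False IH \<alpha>1 by (intro leads_Theta_sum) (simp_all add: odd_iff_mod_2_eq_one mod_Suc)
        ultimately show ?thesis using 3 by (simp only: C[OF x])
      qed
    qed
  qed
qed

text \<open>One of the two factors is unitary, and the other one is isometric on vectors whose last entry
  vanishes. By triangularity the Krylov vectors concerned have this zero when they reach the
  defective factor. Applied to the last unit vector, that factor exposes the number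
  \<open>\<alpha>\<^sub>n\<^sub>-\<^sub>1\<close> and thereby shows that the product is not unitary.\<close>

theorem CMV_conditions_cutoff_CMV:
  assumes n: "n \<ge> 1" and \<alpha>: "verblunsky \<alpha>"
  shows "CMV_conditions n (cutoff_CMV n \<alpha>) (unit_vec n 0)"
proof -
  let ?C = "cutoff_CMV n \<alpha>" and ?e = "unit_vec n 0 :: complex vec"
  let ?L = "Theta_sum n 0 \<alpha>" and ?M = "Theta_sum n 1 \<alpha>"
  let ?x = "krylov ?C ?e"
  have C: "?C \<in> carrier_mat n n" and e: "?e \<in> carrier_vec n" by simp_all
  have \<alpha>1: "cmod (\<alpha> j) < 1" for j using \<alpha> by (simp add: verblunsky_def)
  then have \<alpha>2: "cmod (\<alpha> j) \<le> 1" "cmod (cnj (\<alpha> j)) \<le> 1" for j by (simp_all add: less_imp_le)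
  have x: "?x j \<in> carrier_vec n" for j by (rule krylov_carrier[OF C e])
  have adj: "Theta_sum n 0 (\<lambda>i. cnj (\<alpha> i)) = mat_adjoint ?L" "Theta_sum n 1 (\<lambda>i. cnj (\<alpha> i)) = mat_adjoint ?M"
    by (simp_all add: mat_adjoint_Theta_sum)
  have zero: "?x (zigzag i) $ l = 0" if "i < l" "l < n" for i l
    using leads_krylov_cutoff_CMV[OF \<alpha>, of n i] that by (simp add: leads_def)
  have "cspan n (?x ` {krylov_lo n..krylov_hi n}) = cspan n ((\<lambda>i. ?x (zigzag i)) ` {..<n})"
    unfolding zigzag_image[OF n, symmetric] image_image ..
  also have "\<dots> = carrier_vec n" using leads_krylov_cutoff_CMV[OF \<alpha>] x by (intro cspan_leads) blast
  finally have span: "cspan n (?x ` {krylov_lo n..krylov_hi n}) = carrier_vec n" .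
  moreover have "?C *\<^sub>v ?x j = ?x (j + 1) \<and> mat_adjoint ?C *\<^sub>v ?x (j + 1) = ?x j"
    if j: "krylov_lo n \<le> j" "j < krylov_hi n" for j
  proof (cases "j \<ge> 0")
    case True
    obtain i where i: "zigzag i = j" by (rule zigzag_surj)
    have i1: "Suc i < n" and i2: "odd n \<Longrightarrow> Suc (Suc i) < n"
      using True j(2) unfolding i[symmetric] krylov_hi_def
      by (cases rule: nat_parity_cases[of i]; cases "i = 0"; simp; presburger)+
    have "?M *\<^sub>v ?x j \<in> carrier_vec n" using x by simp
    moreover have "(?M *\<^sub>v ?x j) $ (n - 1) = 0" if "(n - 1) mod 2 = 0"
    proof (rule Theta_sum_support[OF x, where m = "Suc i"])
      show "Suc i < n - 1" using i2 that n by presburger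
    qed (use n zero[of i] i in auto)
    ultimately have "mat_adjoint ?L *\<^sub>v (?L *\<^sub>v (?M *\<^sub>v ?x j)) = ?M *\<^sub>v ?x j"
      using \<alpha>2 by (intro Theta_sum_isometric) simp_all
    moreover have "mat_adjoint ?M *\<^sub>v (?M *\<^sub>v ?x j) = ?x j"
      using \<alpha>2 x zero[of i "n - 1"] i1 i by (intro Theta_sum_isometric) simp_all
    ultimately have "mat_adjoint ?C *\<^sub>v (?C *\<^sub>v ?x j) = ?x j"
      by (simp only: cutoff_CMV_mult_vec mat_mult_vec_carrier C x Theta_sum_carrier)
    then show ?thesis using krylov_up[OF C e True] by simp
  next
    case False
    then have down: "?x j = mat_adjoint ?C *\<^sub>v ?x (j + 1)" using krylov_down[OF C e, of "j + 1"] by simp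
    obtain i where i: "zigzag i = j + 1" by (rule zigzag_surj)
    have i2: "Suc (Suc i) < n"
    proof (cases rule: nat_parity_cases[of i])
      case (1 m)
      then have "int m + 1 \<le> int ((n - 1) div 2)" using i j(1) by (simp add: krylov_lo_def)
      then have "m + 1 \<le> (n - 1) div 2" by linarith
      then show ?thesis using 1 by linarith
    next
      case 2
      then show ?thesis using False i by simp
    qed
    have "mat_adjoint ?L *\<^sub>v ?x (j + 1) \<in> carrier_vec n" using x by simp
    moreover have "(mat_adjoint ?L *\<^sub>v ?x (j + 1)) $ (n - 1) = 0"
      unfolding adj[symmetric] using i2 zero[of i] i
      by (intro Theta_sum_support[OF x, where m = "Suc i"]) auto
    ultimately have "mat_adjoint (mat_adjoint ?M) *\<^sub>v (mat_adjoint ?M *\<^sub>v (mat_adjoint ?L *\<^sub>v ?x (j + 1))) =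
        mat_adjoint ?L *\<^sub>v ?x (j + 1)"
      unfolding adj(2)[symmetric] using \<alpha>2 by (intro Theta_sum_isometric) simp_all
    moreover have "mat_adjoint (mat_adjoint ?L) *\<^sub>v (mat_adjoint ?L *\<^sub>v ?x (j + 1)) = ?x (j + 1)"
      unfolding adj(1)[symmetric] using \<alpha>2 x zero[of i "n - 1"] i2 i by (intro Theta_sum_isometric) simp_all
    ultimately have "?C *\<^sub>v (mat_adjoint ?C *\<^sub>v ?x (j + 1)) = ?x (j + 1)"
      by (simp only: cutoff_CMV_mult_vec mat_mult_vec_carrier mat_adjoint_carrier C x Theta_sum_carrier
          mat_adjoint_adjoint)
    then show ?thesis using down by simp
  qed
  moreover have contr: "vnorm (?C *\<^sub>v v) \<le> vnorm v" if v: "v \<in> carrier_vec n" for v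
  proof -
    have "?M *\<^sub>v v \<in> carrier_vec n" using v by simp
    then have "vnorm (?L *\<^sub>v (?M *\<^sub>v v)) \<le> vnorm (?M *\<^sub>v v)"
      by (intro Theta_sum_contraction \<alpha>2) simp_all
    also have "\<dots> \<le> vnorm v" by (intro Theta_sum_contraction \<alpha>2 v) simp
    finally show ?thesis unfolding cutoff_CMV_mult_vec[OF v] .
  qed
  moreover have "\<not> unitary_mat n ?C"
  proof
    assume U: "unitary_mat n ?C"
    obtain m where m: "n = Suc m" using n by (cases n) auto
    let ?f = "unit_vec n m :: complex vec"
    have f: "?f \<in> carrier_vec n" by simp
    have small: "vnorm (c \<cdot>\<^sub>v ?f) < 1" if "cmod c < 1" for c using that m by (simp add: vnorm_smult)
    consider "m mod 2 = 0" | "m mod 2 = 1" by linarith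
    then show False
    proof cases
      case 1
      have "mat_adjoint ?L *\<^sub>v ?f = \<alpha> m \<cdot>\<^sub>v ?f"
        unfolding adj[symmetric] using Theta_sum_last[OF m _ 1] by simp
      then have "vnorm (mat_adjoint ?L *\<^sub>v ?f) < 1" using small[of "\<alpha> m"] \<alpha>1 by simp
      moreover have "vnorm (mat_adjoint ?M *\<^sub>v (mat_adjoint ?L *\<^sub>v ?f)) \<le> vnorm (mat_adjoint ?L *\<^sub>v ?f)"
        unfolding adj(2)[symmetric] using \<alpha>2 by (intro Theta_sum_contraction) simp_all
      ultimately have "vnorm (mat_adjoint ?C *\<^sub>v ?f) < 1"
        unfolding cutoff_CMV_mult_vec[OF f] by linarith
      then show False using unitary_mat_vnorm(2)[OF U f] m by simp
    next
      case 2
      have "?M *\<^sub>v ?f = cnj (\<alpha> m) \<cdot>\<^sub>v ?f" using Theta_sum_last[OF m _ 2] by simp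
      then have "vnorm (?M *\<^sub>v ?f) < 1" using small[of "cnj (\<alpha> m)"] \<alpha>1 by simp
      moreover have "vnorm (?L *\<^sub>v (?M *\<^sub>v ?f)) \<le> vnorm (?M *\<^sub>v ?f)"
        using \<alpha>2 by (intro Theta_sum_contraction) simp_all
      ultimately have "vnorm (?C *\<^sub>v ?f) < 1"
        unfolding cutoff_CMV_mult_vec[OF f] by linarith
      then show False using unitary_mat_vnorm(1)[OF U f] m by simp
    qed
  qed
  ultimately show ?thesis unfolding CMV_conditions_iff[OF C e n] by blast
qed


section \<open>Reconstruction of a cutoff CMV matrix\<close>

context
  fixes n s :: nat and G :: "complex mat" and p q :: "nat \<Rightarrow> complex vec"
  assumes s: "s < 2" and G: "G \<in> carrier_mat n n"
    and p: "\<And>i. i < n \<Longrightarrow> p i \<in> carrier_vec n" "\<And>i. i < n \<Longrightarrow> leads n i (p i)"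
    and q: "\<And>i. i < n \<Longrightarrow> leads n i (q i)"
    and Gp: "\<And>i. i < n \<Longrightarrow> partner s i < n \<Longrightarrow> G *\<^sub>v p i = q (partner s i)"
begin

text \<open>By induction on the column, only the leading coefficient of \<open>p\<^sub>j\<close> contributes to entry
  \<open>i\<close> of \<open>G p\<^sub>j\<close>, which therefore is a nonzero multiple of the entry of \<open>G\<close>. It vanishes
  because the image \<open>q\<close> ends at the partner of \<open>j\<close>.\<close>

lemma partner_swap_lower_zero:
  assumes "i < n" "j < i" "i \<noteq> partner s j"
  shows "G $$ (i, j) = 0"
  using assms
proof (induction j rule: less_induct)
  case (less j)
  have j: "j < n" using less.prems by simp
  have \<sigma>: "partner s j < i" using less.prems partner_le[of s j] by linarith
  then have \<sigma>n: "partner s j < n" using less.prems by simp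
  obtain r where r: "r > 0" "p j $ j = complex_of_real r" using p(2)[OF j] j unfolding leads_def by blast
  have "(\<Sum>l<j. G $$ (i, l) * p j $ l) = 0"
  proof (intro sum.neutral ballI)
    fix l assume "l \<in> {..<j}"
    then have "l < j" by simp
    moreover have "i \<noteq> partner s l" using partner_le[of s l] \<open>l < j\<close> less.prems by linarith
    ultimately show "G $$ (i, l) * p j $ l = 0" using less by simp
  qed
  then have "q (partner s j) $ i = G $$ (i, j) * p j $ j"
    using leads_mult_vec[OF G p(1)[OF j] p(2)[OF j] j less.prems(1)] Gp[OF j \<sigma>n] by simp
  moreover have "q (partner s j) $ i = 0" using q[OF \<sigma>n] \<sigma> less.prems(1) unfolding leads_def by blast
  ultimately show ?case using r by simp
qed

lemma partner_swap_lower_pos: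
  assumes "partner s j < n" "j \<le> partner s j"
  shows "\<exists>r>0. G $$ (partner s j, j) = complex_of_real r"
proof -
  let ?i = "partner s j"
  have j: "j < n" using assms by simp
  obtain r where r: "r > 0" "p j $ j = complex_of_real r" using p(2)[OF j] j unfolding leads_def by blast
  obtain r' where r': "r' > 0" "q ?i $ ?i = complex_of_real r'"
    using q[OF assms(1)] assms(1) unfolding leads_def by blast
  have "(\<Sum>l<j. G $$ (?i, l) * p j $ l) = 0"
  proof (intro sum.neutral ballI)
    fix l assume "l \<in> {..<j}"
    then have "l < j" by simp
    moreover have "?i \<noteq> partner s l" using partner_partner[OF s] \<open>l < j\<close> by (metis less_irrefl)
    ultimately show "G $$ (?i, l) * p j $ l = 0" using assms partner_swap_lower_zero[of ?i l] by simp
  qed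
  then have "q ?i $ ?i = G $$ (?i, j) * p j $ j"
    using leads_mult_vec[OF G p(1)[OF j] p(2)[OF j] j assms(1)] Gp[OF j assms(1)] by simp
  then have "G $$ (?i, j) = complex_of_real (r' / r)" using r r' by (simp add: field_simps)
  then show ?thesis using r r' by (intro exI[of _ "r' / r"]) simp
qed

end

text \<open>Applying the entrywise lemmas to \<open>G\<close> and, with the two systems exchanged, to its adjoint shows that
  \<open>G\<close> couples partners only, with positive off-diagonal entries. Rows and columns that belong to
  complete blocks are orthonormal, since \<open>G\<^sup>* G\<close> fixes every \<open>p\<^sub>i\<close> whose partner is less than \<open>n\<close>.
  A unitary 2 by 2 matrix with positive off-diagonal entries \<open>r\<close>, \<open>r'\<close> and upper left entry \<open>a\<close> has
  \<open>r = r' = sqrt (1 - |a|\<^sup>2)\<close> and lower right entry \<open>- cnj a\<close>.\<close>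

lemma partner_swap_eq_Theta_sum:
  assumes s: "s < 2" and G: "G \<in> carrier_mat n n"
    and p: "\<And>i. i < n \<Longrightarrow> p i \<in> carrier_vec n" "\<And>i. i < n \<Longrightarrow> leads n i (p i)"
    and q: "\<And>i. i < n \<Longrightarrow> q i \<in> carrier_vec n" "\<And>i. i < n \<Longrightarrow> leads n i (q i)"
    and Gp: "\<And>i. i < n \<Longrightarrow> partner s i < n \<Longrightarrow> G *\<^sub>v p i = q (partner s i)"
    and Gq: "\<And>i. i < n \<Longrightarrow> partner s i < n \<Longrightarrow> mat_adjoint G *\<^sub>v q i = p (partner s i)"
  shows "G = Theta_sum n s (\<lambda>i. cnj (G $$ (i, i)))"
    and "\<And>i. i mod 2 = s \<Longrightarrow> Suc i < n \<Longrightarrow> cmod (G $$ (i, i)) < 1"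
proof -
  let ?G' = "mat_adjoint G"
  have G': "?G' \<in> carrier_mat n n" using G by simp
  \<comment> \<open>the indices whose partner is less than \<open>n\<close> are those less than \<open>m\<close>\<close>
  define m where "m = (if (n - 1) mod 2 = s then n - 1 else n)"
  have m: "m \<le> n" unfolding m_def by simp
  have m_less: "partner s i < n" "i < n" if "i < m" for i
  proof -
    show i: "i < n" using that m by simp
    have "Suc i < n \<or> i mod 2 \<noteq> s"
    proof (cases "Suc i = n")
      case True
      then show ?thesis using that unfolding m_def by (cases "(n - 1) mod 2 = s") auto
    qed (use i in simp)
    then show "partner s i < n" using i partner_le[of s i] by (auto simp: partner_def)
  qed
  have less_m: "i < m" if "Suc i < n \<or> Suc i = n \<and> i mod 2 \<noteq> s" for i
    using that by (auto simp: m_def)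
  have sum_form: "(mat_adjoint B * B) $$ (k, i) = (\<Sum>l<n. cnj (B $$ (l, k)) * B $$ (l, i))"
    if "B \<in> carrier_mat n n" "k < n" "i < n" for B k i
    using that by (simp add: scalar_prod_def atLeast0LessThan)
  have \<sigma>\<sigma>: "partner s (partner s i) = i" for i by (rule partner_partner[OF s])
  have colG: "(\<Sum>l<n. cnj (G $$ (l, k)) * G $$ (l, i)) = (if k = i then 1 else 0)" if "i < m" "k < n" for i k
  proof -
    have "(?G' * G) $$ (k, i) = (if k = i then 1 else 0)"
    proof (rule leads_fixed_cols[OF mult_carrier_mat[OF G' G] m _ _ _ that, where p = p])
      fix i assume i: "i < m"
      have "(?G' * G) *\<^sub>v p i = ?G' *\<^sub>v (G *\<^sub>v p i)"
        by (rule assoc_mult_mat_vec[OF G' G p(1)[OF m_less(2)[OF i]]])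
      also have "\<dots> = p i" using Gp[OF m_less(2,1)[OF i]] Gq[of "partner s i"] m_less[OF i] \<sigma>\<sigma> by simp
      finally show "(?G' * G) *\<^sub>v p i = p i" .
    qed (use p m_less in blast)+
    then show ?thesis using sum_form[OF G that(2) m_less(2)[OF that(1)]] by simp
  qed
  have rowG: "(\<Sum>l<n. G $$ (k, l) * cnj (G $$ (i, l))) = (if k = i then 1 else 0)" if "i < m" "k < n" for i k
  proof -
    have i: "i < n" using m_less that by blast
    have "(mat_adjoint ?G' * ?G') $$ (k, i) = (if k = i then 1 else 0)"
    proof (rule leads_fixed_cols[OF _ m _ _ _ that, where p = q])
      show "mat_adjoint ?G' * ?G' \<in> carrier_mat n n" using mult_carrier_mat[OF G G'] by simp
      fix i assume i: "i < m"
      have "(mat_adjoint ?G' * ?G') *\<^sub>v q i = G *\<^sub>v (?G' *\<^sub>v q i)"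
        using assoc_mult_mat_vec[OF G G' q(1)[OF m_less(2)[OF i]]] by simp
      also have "\<dots> = q i" using Gq[OF m_less(2,1)[OF i]] Gp[of "partner s i"] m_less[OF i] \<sigma>\<sigma> by simp
      finally show "(mat_adjoint ?G' * ?G') *\<^sub>v q i = q i" .
    qed (use q m_less in blast)+
    moreover have "(mat_adjoint ?G' * ?G') $$ (k, i) = (\<Sum>l<n. G $$ (k, l) * cnj (G $$ (i, l)))"
      using sum_form[OF G' that(2) i] G that(2) i by simp
    ultimately show ?thesis by simp
  qed
  have zero: "G $$ (i, j) = 0" if ij: "i < n" "j < n" "j \<noteq> i" "j \<noteq> partner s i" for i j
  proof (cases "j < i")
    case True
    have "i \<noteq> partner s j" using ij(4) \<sigma>\<sigma>[of j] by metis
    then show ?thesis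
      using partner_swap_lower_zero[OF s G p q(2) Gp, of i j] ij True by blast
  next
    case False
    then have "i < j" using ij by simp
    then have "?G' $$ (j, i) = 0"
      using partner_swap_lower_zero[OF s G' q p(2) Gq, of j i] ij by blast
    then show ?thesis using ij G by simp
  qed
  have two: "(\<Sum>l<n. f l) = f j + f (Suc j)"
    if "Suc j < n" "\<And>l. l < n \<Longrightarrow> l \<noteq> j \<Longrightarrow> l \<noteq> Suc j \<Longrightarrow> f l = 0" for f :: "nat \<Rightarrow> complex" and j
  proof -
    have "(\<Sum>l<n. f l) = (\<Sum>l\<in>{j, Suc j}. f l)"
      using that by (intro sum.mono_neutral_right) auto
    then show ?thesis by simp
  qed
  have block: "cmod (G $$ (j, j)) < 1 \<and>
      G $$ (Suc j, j) = complex_of_real (sqrt (1 - (cmod (G $$ (j, j)))\<^sup>2)) \<and>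
      G $$ (j, Suc j) = complex_of_real (sqrt (1 - (cmod (G $$ (j, j)))\<^sup>2)) \<and>
      G $$ (Suc j, Suc j) = - cnj (G $$ (j, j))"
    if j: "j mod 2 = s" "Suc j < n" for j
  proof -
    have \<sigma>: "partner s j = Suc j" using j by (simp add: partner_def)
    have \<sigma>': "partner s (Suc j) = j" using \<sigma>\<sigma>[of j] \<sigma> by simp
    have jn: "j < n" using j by simp
    have jm: "j < m" using less_m j by simp
    have "Suc j mod 2 \<noteq> s" using j(1) by (auto simp: mod_Suc)
    then have Sjm: "Suc j < m" using less_m[of "Suc j"] j(2) by fastforce
    obtain r where r: "r > 0" "G $$ (Suc j, j) = complex_of_real r"
      using partner_swap_lower_pos[OF s G p q(2) Gp, of j] j \<sigma> by auto
    obtain r' where r': "r' > 0" "?G' $$ (Suc j, j) = complex_of_real r'"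
      using partner_swap_lower_pos[OF s G' q p(2) Gq, of j] j \<sigma> by auto
    have g: "G $$ (j, Suc j) = complex_of_real r'"
      using r'(2) j jn G by (metis carrier_matD complex_cnj_cnj complex_cnj_complex_of_real mat_adjoint_index)
    let ?a = "G $$ (j, j)" and ?d = "G $$ (Suc j, Suc j)"
    have off: "G $$ (l, j) = 0" "G $$ (l, Suc j) = 0" "G $$ (j, l) = 0"
      if "l < n" "l \<noteq> j" "l \<noteq> Suc j" for l
      using that j jn \<sigma> \<sigma>' zero[of l j] zero[of l "Suc j"] zero[of j l] \<sigma>\<sigma>[of l] by metis+
    have c1: "cnj ?a * ?a + complex_of_real r * complex_of_real r = 1"
      using colG[OF jm jn] two[OF j(2), of "\<lambda>l. cnj (G $$ (l, j)) * G $$ (l, j)"] off r by simp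
    have c2: "?a * cnj ?a + complex_of_real r' * complex_of_real r' = 1"
      using rowG[OF jm jn] two[OF j(2), of "\<lambda>l. G $$ (j, l) * cnj (G $$ (j, l))"] off g by simp
    have c3: "cnj ?a * complex_of_real r' + complex_of_real r * ?d = 0"
      using colG[OF Sjm jn] two[OF j(2), of "\<lambda>l. cnj (G $$ (l, j)) * G $$ (l, Suc j)"] off g r by simp
    have "complex_of_real ((cmod ?a)\<^sup>2 + r\<^sup>2) = complex_of_real 1"
      unfolding of_real_add complex_norm_square using c1 by (simp add: power2_eq_square mult.commute)
    then have e1: "(cmod ?a)\<^sup>2 + r\<^sup>2 = 1" by (simp only: of_real_eq_iff)
    have "complex_of_real ((cmod ?a)\<^sup>2 + r'\<^sup>2) = complex_of_real 1"
      unfolding of_real_add complex_norm_square using c2 by (simp add: power2_eq_square mult.commute)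
    then have e2: "(cmod ?a)\<^sup>2 + r'\<^sup>2 = 1" by (simp only: of_real_eq_iff)
    have "r\<^sup>2 = r'\<^sup>2" using e1 e2 by simp
    then have rr: "r' = r" using r(1) r'(1) by (simp add: power2_eq_iff_nonneg)
    have sq: "sqrt (1 - (cmod ?a)\<^sup>2) = r"
      using e1 r(1) by (intro real_sqrt_unique) simp_all
    have "r\<^sup>2 > 0" using r(1) by simp
    then have "(cmod ?a)\<^sup>2 < 1" using e1 by linarith
    then have "cmod ?a < 1" by (simp add: power_less_one_iff)
    moreover have "complex_of_real r * (?d + cnj ?a) = 0" using c3 rr by (simp add: algebra_simps)
    then have "?d = - cnj ?a" using r(1) by (simp add: eq_neg_iff_add_eq_0)
    ultimately show ?thesis using r g rr sq by simp
  qed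
  then show "\<And>i. i mod 2 = s \<Longrightarrow> Suc i < n \<Longrightarrow> cmod (G $$ (i, i)) < 1" by blast
  have first: "G $$ (0, 0) = 1" if s1: "s = 1" and n0: "0 < n"
  proof -
    have \<sigma>: "partner s 0 = 0" using s1 by (simp add: partner_def)
    obtain r where r: "r > 0" "G $$ (0, 0) = complex_of_real r"
      using partner_swap_lower_pos[OF s G p q(2) Gp, of 0] n0 \<sigma> by auto
    have 0: "0 < m" using less_m[of 0] s1 n0 by fastforce
    have "(\<Sum>l<n. cnj (G $$ (l, 0)) * G $$ (l, 0)) = (\<Sum>l\<in>{0}. cnj (G $$ (l, 0)) * G $$ (l, 0))"
    proof (rule sum.mono_neutral_right)
      show "\<forall>l\<in>{..<n} - {0}. cnj (G $$ (l, 0)) * G $$ (l, 0) = 0"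
      proof
        fix l assume l: "l \<in> {..<n} - {0}"
        then have "l \<noteq> 0" by simp
        then have "0 \<noteq> partner s l" using \<sigma>\<sigma>[of l] \<sigma> by metis
        then show "cnj (G $$ (l, 0)) * G $$ (l, 0) = 0" using zero[of l 0] l by auto
      qed
    qed (use n0 in simp_all)
    then have "complex_of_real (r * r) = complex_of_real 1" using colG[OF 0 n0] r by simp
    then have "r * r = 1" by (simp only: of_real_eq_iff)
    then have "r = 1" using r(1) by (simp add: square_eq_1_iff)
    then show ?thesis using r by simp
  qed
  show "G = Theta_sum n s (\<lambda>i. cnj (G $$ (i, i)))"
  proof (rule eq_matI)
    fix i j assume "i < dim_row (Theta_sum n s (\<lambda>i. cnj (G $$ (i, i))))"
      "j < dim_col (Theta_sum n s (\<lambda>i. cnj (G $$ (i, i))))"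
    then have ij: "i < n" "j < n" by simp_all
    have "G $$ (i, j) = Theta_entry s (\<lambda>i. cnj (G $$ (i, i))) i j"
    proof (cases "i mod 2 = s")
      case True
      then have \<sigma>: "partner s i = Suc i" by (simp add: partner_def)
      consider "j = i" | "j = Suc i" | "j \<noteq> i" "j \<noteq> partner s i" using \<sigma> by blast
      then show ?thesis
      proof cases
        case 1
        then show ?thesis using True by (simp add: Theta_entry_def)
      next
        case 2
        then show ?thesis using True \<sigma> block[OF True] ij by (simp add: Theta_entry_def)
      next
        case 3
        then show ?thesis using zero[OF ij] by (simp add: Theta_entry_def)
      qed
    next
      case False
      show ?thesis
      proof (cases i)
        case 0
        then have s1: "s = 1" using False s by auto
        then have "partner s i = i" using 0 by (simp add: partner_def)
        then show ?thesis using 0 s1 first ij zero[OF ij] False by (auto simp: Theta_entry_def)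
      next
        case (Suc k)
        have k: "k mod 2 = s" using False s Suc by (simp add: mod_Suc split: if_splits)
        have \<sigma>: "partner s i = k" using False Suc by (simp add: partner_def)
        consider "j = i" | "j = k" | "j \<noteq> i" "j \<noteq> partner s i" using \<sigma> by blast
        then show ?thesis
        proof cases
          case 1
          then show ?thesis using False Suc block[OF k] ij by (simp add: Theta_entry_def)
        next
          case 2
          then show ?thesis using False \<sigma> Suc block[OF k] ij by (simp add: Theta_entry_def)
        next
          case 3
          then show ?thesis using zero[OF ij] by (simp add: Theta_entry_def)
        qed
      qed
    qed
    then show "G $$ (i, j) = Theta_sum n s (\<lambda>i. cnj (G $$ (i, i))) $$ (i, j)"
      using ij by (simp add: Theta_sum_def)
  qed (use G in simp_all)
qed

lemma change_of_basis_mult_vec: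
  assumes X: "X \<in> carrier_mat n n" and Z: "unitary_mat n Z" and B: "B \<in> carrier_mat n n"
    and u: "u \<in> carrier_vec n"
  shows "(mat_adjoint X * (B * Z)) *\<^sub>v (mat_adjoint Z *\<^sub>v u) = mat_adjoint X *\<^sub>v (B *\<^sub>v u)"
proof -
  have c: "mat_adjoint X \<in> carrier_mat n n" "Z \<in> carrier_mat n n" "B * Z \<in> carrier_mat n n"
    using X unitary_mat_carrier[OF Z] square_mat_mult_carrier[OF B] by simp_all
  have Zu: "mat_adjoint Z *\<^sub>v u \<in> carrier_vec n" using c u by simp
  show ?thesis
    unfolding assoc_mult_mat_vec[OF c(1,3) Zu] assoc_mult_mat_vec[OF B c(2) Zu]
      unitary_mat_mult_adjoint_vec[OF Z u] ..
qed

text \<open>The situation of \<open>partner_swap_eq_Theta_sum\<close> in the coordinates given by two orthonormal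
  bases, the columns of \<open>X\<close> and those of \<open>Z\<close>.\<close>

lemma change_of_basis_Theta_sum:
  assumes s: "s < 2" and X: "unitary_mat n X" and Z: "unitary_mat n Z" and B: "B \<in> carrier_mat n n"
    and a: "\<And>i. i < n \<Longrightarrow> a i \<in> carrier_vec n" "\<And>i. i < n \<Longrightarrow> leads n i (mat_adjoint X *\<^sub>v a i)"
    and b: "\<And>i. i < n \<Longrightarrow> b i \<in> carrier_vec n" "\<And>i. i < n \<Longrightarrow> leads n i (mat_adjoint Z *\<^sub>v b i)"
    and Ba: "\<And>i. i < n \<Longrightarrow> partner s i < n \<Longrightarrow> B *\<^sub>v a i = b (partner s i)"
    and Bb: "\<And>i. i < n \<Longrightarrow> partner s i < n \<Longrightarrow> mat_adjoint B *\<^sub>v b i = a (partner s i)"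
  shows "\<exists>\<alpha>. mat_adjoint Z * (B * X) = Theta_sum n s \<alpha> \<and> (\<forall>i. i mod 2 = s \<longrightarrow> Suc i < n \<longrightarrow> cmod (\<alpha> i) < 1)"
proof -
  have c: "X \<in> carrier_mat n n" "Z \<in> carrier_mat n n" "mat_adjoint X \<in> carrier_mat n n"
    "mat_adjoint Z \<in> carrier_mat n n" "mat_adjoint B \<in> carrier_mat n n"
    using unitary_mat_carrier[OF X] unitary_mat_carrier[OF Z] B by simp_all
  define G where "G = mat_adjoint Z * (B * X)"
  have G: "G \<in> carrier_mat n n" unfolding G_def using c B by (intro square_mat_mult_carrier)
  have G': "mat_adjoint G = mat_adjoint X * (mat_adjoint B * Z)"
    unfolding G_def mat_adjoint_mult[OF c(4) square_mat_mult_carrier[OF B c(1)]] mat_adjoint_mult[OF B c(1)]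
      mat_adjoint_adjoint by (rule square_mat_assoc[OF c(3,5,2)])
  note main = partner_swap_eq_Theta_sum[OF s G, of "\<lambda>i. mat_adjoint X *\<^sub>v a i" "\<lambda>i. mat_adjoint Z *\<^sub>v b i"]
  have Gp: "G *\<^sub>v (mat_adjoint X *\<^sub>v a i) = mat_adjoint Z *\<^sub>v b (partner s i)" if "i < n" "partner s i < n" for i
    unfolding G_def change_of_basis_mult_vec[OF c(2) X B a(1)[OF that(1)]] Ba[OF that] ..
  have Gq: "mat_adjoint G *\<^sub>v (mat_adjoint Z *\<^sub>v b i) = mat_adjoint X *\<^sub>v a (partner s i)"
    if "i < n" "partner s i < n" for i
    unfolding G' change_of_basis_mult_vec[OF c(1) Z c(5) b(1)[OF that(1)]] Bb[OF that] ..
  have pq: "mat_adjoint X *\<^sub>v a i \<in> carrier_vec n" "mat_adjoint Z *\<^sub>v b i \<in> carrier_vec n" if "i < n" for i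
    using mat_mult_vec_carrier[OF c(3) a(1)[OF that]] mat_mult_vec_carrier[OF c(4) b(1)[OF that]] by blast+
  have "G = Theta_sum n s (\<lambda>i. cnj (G $$ (i, i)))"
    by (rule main(1)) (use pq a(2) b(2) Gp Gq in blast)+
  moreover have "cmod (G $$ (i, i)) < 1" if "i mod 2 = s" "Suc i < n" for i
    by (rule main(2)[OF _ _ _ _ _ _ that]) (use pq a(2) b(2) Gp Gq in blast)+
  ultimately show ?thesis unfolding G_def[symmetric] by (intro exI[of _ "\<lambda>i. cnj (G $$ (i, i))"]) simp
qed

lemma vnorm_change_of_basis_le:
  assumes X: "unitary_mat n X" and Z: "unitary_mat n Z" and B: "B \<in> carrier_mat n n"
    and contr: "\<And>v. v \<in> carrier_vec n \<Longrightarrow> vnorm (B *\<^sub>v v) \<le> vnorm v" and v: "v \<in> carrier_vec n"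
  shows "vnorm ((mat_adjoint X * (B * Z)) *\<^sub>v v) \<le> vnorm v"
proof -
  note c = unitary_mat_carrier[OF X] unitary_mat_carrier[OF Z]
  have Zv: "Z *\<^sub>v v \<in> carrier_vec n" using c v by simp
  have BZv: "B *\<^sub>v (Z *\<^sub>v v) \<in> carrier_vec n" using B Zv by simp
  have "(mat_adjoint X * (B * Z)) *\<^sub>v v = mat_adjoint X *\<^sub>v (B *\<^sub>v (Z *\<^sub>v v))"
    unfolding assoc_mult_mat_vec[OF mat_adjoint_carrier[OF c(1)] square_mat_mult_carrier[OF B c(2)] v]
      assoc_mult_mat_vec[OF B c(2) v] ..
  then show ?thesis
    using unitary_mat_vnorm(2)[OF X BZv] contr[OF Zv] unitary_mat_vnorm(1)[OF Z v] by simp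
qed

text \<open>Orthonormalise the Krylov vectors in the zigzag order (columns of \<open>X\<close>) and in the reflected
  zigzag order (columns of \<open>Z\<close>). Write \<open>A\<close> as a product of \<open>A\<close> and the identity, with the order
  of the factors chosen so that the reflected index range is again \<open>I\<close>, and insert the second basis
  between the factors.\<close>

theorem CMV_conditions_imp_cutoff_CMV:
  assumes n: "n \<ge> 1" and A: "A \<in> carrier_mat n n" and \<delta>: "\<delta> \<in> carrier_vec n"
    and cond: "CMV_conditions n A \<delta>"
  obtains \<alpha> P where "verblunsky \<alpha>" "cutoff_CMV_in_basis n A \<delta> \<alpha> P"
proof -
  let ?x = "krylov A \<delta>"
  note cond' = cond[unfolded CMV_conditions_iff[OF A \<delta> n]]
  have span: "cspan n (?x ` {krylov_lo n..krylov_hi n}) = carrier_vec n"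
    and contr: "\<And>v. v \<in> carrier_vec n \<Longrightarrow> vnorm (A *\<^sub>v v) \<le> vnorm v"
    and nonunitary: "\<not> unitary_mat n A"
    using cond' by blast+
  have shift: "A *\<^sub>v ?x j = ?x (j + 1)" "mat_adjoint A *\<^sub>v ?x (j + 1) = ?x j"
    if "krylov_lo n \<le> j" "j + 1 \<le> krylov_hi n" for j
    using cond' that by simp_all
  have x: "?x j \<in> carrier_vec n" for j by (rule krylov_carrier[OF A \<delta>])
  \<comment> \<open>the centre of the reflection \<open>j \<mapsto> e - j\<close> that maps the index interval onto itself\<close>
  define e :: int where "e = (if odd n then 0 else 1)"
  have lo_hi: "krylov_lo n = e - krylov_hi n"
  proof (cases rule: nat_parity_cases[of n])
    case (1 m)
    then obtain k where k: "m = Suc k" using n by (cases m) auto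
    have "n - 1 = Suc (2 * k)" "n div 2 = Suc k" "even n" using 1 k by simp_all
    then show ?thesis by (simp add: e_def krylov_lo_def krylov_hi_def)
  qed (simp add: e_def krylov_lo_def krylov_hi_def)
  define a where "a i = ?x (zigzag i)" for i
  define b where "b i = ?x (e - zigzag i)" for i
  have ab: "a i \<in> carrier_vec n" "b i \<in> carrier_vec n" for i unfolding a_def b_def by (rule x)+
  have "a ` {..<n} = ?x ` {krylov_lo n..krylov_hi n}"
    unfolding a_def image_image[symmetric] zigzag_image[OF n] ..
  then have span_a: "cspan n (a ` {..<n}) = carrier_vec n" using span by simp
  have "b ` {..<n} = ?x ` ((\<lambda>j. e - j) ` {krylov_lo n..krylov_hi n})"
    unfolding zigzag_image[OF n, symmetric] b_def image_image ..
  also have "(\<lambda>j. e - j) ` {krylov_lo n..krylov_hi n} = {krylov_lo n..krylov_hi n}" using lo_hi by simp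
  finally have span_b: "cspan n (b ` {..<n}) = carrier_vec n" using span by simp
  obtain X where X: "unitary_mat n X" "\<And>i. i < n \<Longrightarrow> leads n i (mat_adjoint X *\<^sub>v a i)"
    using exists_unitary_leading[OF ab(1) span_a] by blast
  obtain Z where Z: "unitary_mat n Z" "\<And>i. i < n \<Longrightarrow> leads n i (mat_adjoint Z *\<^sub>v b i)"
    using exists_unitary_leading[OF ab(2) span_b] by blast
  \<comment> \<open>The identity matches \<open>a\<close> and \<open>b\<close> along the reflection \<open>j \<mapsto> -j\<close> of positions if \<open>n\<close> is
    odd, and along \<open>j \<mapsto> 1 - j\<close> if \<open>n\<close> is even; \<open>A\<close> realises the other reflection.\<close>
  define Lh where "Lh = (if odd n then A else 1\<^sub>m n)"
  define Mh where "Mh = (if odd n then 1\<^sub>m n else A)"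
  have LM: "Lh \<in> carrier_mat n n" "Mh \<in> carrier_mat n n" and LMA: "Lh * Mh = A"
    unfolding Lh_def Mh_def using A square_mat_one[OF A] by simp_all
  have range: "krylov_lo n \<le> zigzag i" "zigzag i \<le> krylov_hi n" if "i < n" for i
    using less_iff_zigzag[OF n, of i] that by simp_all
  have zp: "zigzag (partner 0 i) = 1 - zigzag i" "zigzag (partner 1 i) = - zigzag i" for i
    using zigzag_partner[of 0 i] zigzag_partner[of 1 i] by simp_all
  have L: "Lh *\<^sub>v b i = a (partner 0 i) \<and> mat_adjoint Lh *\<^sub>v a i = b (partner 0 i)"
    if i: "i < n" "partner 0 i < n" for i
  proof (cases "odd n")
    case True
    have "krylov_lo n \<le> - zigzag i" "- zigzag i + 1 \<le> krylov_hi n" "krylov_lo n \<le> zigzag i - 1" "zigzag i - 1 + 1 \<le> krylov_hi n"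
      using range[OF i(1)] range[OF i(2)] lo_hi True unfolding zp e_def by simp_all
    from shift[OF this(1,2)] shift[OF this(3,4)] show ?thesis
      using True by (simp add: Lh_def a_def b_def zp e_def)
  next
    case False
    then show ?thesis using x by (simp add: Lh_def a_def b_def zp e_def)
  qed
  have M: "Mh *\<^sub>v a i = b (partner 1 i) \<and> mat_adjoint Mh *\<^sub>v b i = a (partner 1 i)"
    if i: "i < n" "partner 1 i < n" for i
  proof (cases "odd n")
    case True
    then show ?thesis using x by (simp add: Mh_def a_def b_def zp[unfolded One_nat_def] e_def)
  next
    case False
    have "krylov_lo n \<le> zigzag i" "zigzag i + 1 \<le> krylov_hi n" "krylov_lo n \<le> - zigzag i" "- zigzag i + 1 \<le> krylov_hi n"
      using range[OF i(1)] range[OF i(2)] lo_hi False unfolding zp e_def by simp_all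
    from shift[OF this(1,2)] shift[OF this(3,4)] show ?thesis
      using False by (simp add: Mh_def a_def b_def zp[unfolded One_nat_def] e_def add.commute)
  qed
  have "\<exists>\<alpha>. mat_adjoint X * (Lh * Z) = Theta_sum n 0 \<alpha> \<and> (\<forall>i. i mod 2 = 0 \<longrightarrow> Suc i < n \<longrightarrow> cmod (\<alpha> i) < 1)"
    by (rule change_of_basis_Theta_sum[OF _ Z(1) X(1) LM(1), where a = b and b = a])
       (use ab X(2) Z(2) L in \<open>simp_all\<close>)
  then obtain \<alpha>0 where \<alpha>0: "mat_adjoint X * (Lh * Z) = Theta_sum n 0 \<alpha>0"
    "\<And>i. i mod 2 = 0 \<Longrightarrow> Suc i < n \<Longrightarrow> cmod (\<alpha>0 i) < 1" by blast
  have "\<exists>\<alpha>. mat_adjoint Z * (Mh * X) = Theta_sum n 1 \<alpha> \<and> (\<forall>i. i mod 2 = 1 \<longrightarrow> Suc i < n \<longrightarrow> cmod (\<alpha> i) < 1)"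
    by (rule change_of_basis_Theta_sum[OF _ X(1) Z(1) LM(2), where a = a and b = b])
       (use ab X(2) Z(2) M in \<open>simp_all\<close>)
  then obtain \<alpha>1 where \<alpha>1: "mat_adjoint Z * (Mh * X) = Theta_sum n 1 \<alpha>1"
    "\<And>i. i mod 2 = 1 \<Longrightarrow> Suc i < n \<Longrightarrow> cmod (\<alpha>1 i) < 1" by blast
  define \<alpha> where "\<alpha> i = (if i < n then if i mod 2 = 0 then \<alpha>0 i else \<alpha>1 i else 0)" for i
  have Leq: "Theta_sum n 0 \<alpha> = mat_adjoint X * (Lh * Z)"
    unfolding \<alpha>0(1) by (rule Theta_sum_cong) (simp_all add: \<alpha>_def)
  have Meq: "Theta_sum n 1 \<alpha> = mat_adjoint Z * (Mh * X)"
    unfolding \<alpha>1(1) by (rule Theta_sum_cong) (simp_all add: \<alpha>_def)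
  note Xc = unitary_mat_carrier[OF X(1)] and Zc = unitary_mat_carrier[OF Z(1)]
  note Xc' = mat_adjoint_carrier[OF Xc] and Zc' = mat_adjoint_carrier[OF Zc]
  have XX: "X * mat_adjoint X = 1\<^sub>m n" "mat_adjoint X * X = 1\<^sub>m n" and ZZ: "Z * mat_adjoint Z = 1\<^sub>m n"
    using X(1) Z(1) by (simp_all add: unitary_mat_def)
  let ?C = "cutoff_CMV n \<alpha>"
  have "?C = mat_adjoint X * (Lh * ((Z * mat_adjoint Z) * (Mh * X)))"
    unfolding cutoff_CMV_eq Leq Meq using Xc Zc Xc' Zc' LM by (simp only: square_mat[where n = n])
  also have "\<dots> = mat_adjoint X * ((Lh * Mh) * X)"
    unfolding ZZ using Xc LM by (simp only: square_mat[where n = n])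
  finally have C: "?C = mat_adjoint X * (A * X)" unfolding LMA .
  have "X * ?C * mat_adjoint X = (X * mat_adjoint X) * (A * (X * mat_adjoint X))"
    unfolding C using Xc Xc' A by (simp only: square_mat[where n = n])
  also have "\<dots> = A" unfolding XX using A by (simp only: square_mat_one)
  finally have AC: "X * ?C * mat_adjoint X = A" .
  obtain m where m: "n = Suc m" using n by (cases n) auto
  \<comment> \<open>the truncated block sits in the factor that contains \<open>A\<close>, which is a contraction\<close>
  have \<alpha>m: "cmod (\<alpha> m) \<le> 1"
  proof (cases "odd n")
    case True
    then have m2: "m mod 2 = 0" using m by simp
    have "vnorm (Theta_sum n 0 \<alpha> *\<^sub>v unit_vec n m) \<le> vnorm (unit_vec n m)"
      unfolding Leq using True vnorm_change_of_basis_le[OF X(1) Z(1) A contr unit_vec_carrier] by (simp add: Lh_def)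
    then show ?thesis using Theta_sum_last[OF m _ m2] m by (simp add: vnorm_smult)
  next
    case False
    then have m2: "m mod 2 = 1" using m by presburger
    have "vnorm (Theta_sum n 1 \<alpha> *\<^sub>v unit_vec n m) \<le> vnorm (unit_vec n m)"
      unfolding Meq using False vnorm_change_of_basis_le[OF Z(1) X(1) A contr unit_vec_carrier] by (simp add: Mh_def)
    then show ?thesis using Theta_sum_last[OF m _ m2] m by (simp add: vnorm_smult)
  qed
  have \<alpha>_less: "cmod (\<alpha> i) < 1" if "i \<noteq> m" for i
    using that m \<alpha>0(2)[of i] \<alpha>1(2)[of i] by (simp add: \<alpha>_def)
  have \<alpha>_le: "cmod (\<alpha> i) \<le> 1" for i using \<alpha>m \<alpha>_less[of i] by (cases "i = m") simp_all
  have "cmod (\<alpha> m) \<noteq> 1"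
  proof
    assume "cmod (\<alpha> m) = 1"
    then have "cmod (\<alpha> (n - 1)) = 1" using m by simp
    then have "unitary_mat n (Theta_sum n 0 \<alpha>)" "unitary_mat n (Theta_sum n 1 \<alpha>)"
      using \<alpha>_le by (intro Theta_sum_unitary; simp)+
    then have "unitary_mat n ?C" unfolding cutoff_CMV_eq by (rule unitary_mat_mult)
    then have "unitary_mat n A"
      unfolding AC[symmetric] using X(1) by (intro unitary_mat_mult unitary_mat_adjoint)
    then show False using nonunitary by blast
  qed
  then have "cmod (\<alpha> i) < 1" for i using \<alpha>m \<alpha>_less[of i] by (cases "i = m") simp_all
  then have verb: "verblunsky \<alpha>" by (simp add: verblunsky_def)
  define r where "r = complex_of_real (vnorm \<delta>)"
  have a0: "a 0 = \<delta>" unfolding a_def using krylov_0[OF A \<delta>] by simp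
  have lead0: "leads n 0 (mat_adjoint X *\<^sub>v \<delta>)" using X(2)[of 0] n a0 by simp
  then obtain t where t: "t > 0" "(mat_adjoint X *\<^sub>v \<delta>) $ 0 = complex_of_real t"
    using n unfolding leads_def by auto
  have X\<delta>: "mat_adjoint X *\<^sub>v \<delta> = complex_of_real t \<cdot>\<^sub>v unit_vec n 0"
  proof (rule eq_vecI)
    fix i assume "i < dim_vec (complex_of_real t \<cdot>\<^sub>v unit_vec n 0)"
    then have "i < n" by simp
    then show "(mat_adjoint X *\<^sub>v \<delta>) $ i = (complex_of_real t \<cdot>\<^sub>v unit_vec n 0) $ i"
      using lead0 t(2) unfolding leads_def by (cases "i = 0") (simp_all add: unit_vec_def)
  qed (use Xc in simp)
  have "vnorm \<delta> = vnorm (mat_adjoint X *\<^sub>v \<delta>)" using unitary_mat_vnorm(2)[OF X(1) \<delta>] by simp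
  also have "\<dots> = t" unfolding X\<delta> using t(1) n by (simp add: vnorm_smult)
  finally have rt: "r = complex_of_real t" unfolding r_def by simp
  have r0: "r \<noteq> 0" using t(1) rt by simp
  \<comment> \<open>\<open>X\<close> sends the first unit vector to \<open>\<delta> / \<parallel>\<delta>\<parallel>\<close>, so rescaling makes \<open>\<delta>\<close> the first basis
  vector\<close>
  define P where "P = r \<cdot>\<^sub>m X"
  define Q where "Q = (1 / r) \<cdot>\<^sub>m mat_adjoint X"
  have PQ: "P \<in> carrier_mat n n" "Q \<in> carrier_mat n n" unfolding P_def Q_def using Xc by simp_all
  have smult: "(c \<cdot>\<^sub>m B) * (d \<cdot>\<^sub>m D) = (c * d) \<cdot>\<^sub>m (B * D)" 
    if "B \<in> carrier_mat n n" "D \<in> carrier_mat n n" for c d :: complex and B D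
    using that by (intro eq_matI) (simp_all add: sum_distrib_left scalar_prod_def mult.assoc mult.left_commute)
  have one: "1 \<cdot>\<^sub>m B = B" for B :: "complex mat" by (intro eq_matI) simp_all
  have "mat_adjoint P = r \<cdot>\<^sub>m mat_adjoint X"
    unfolding P_def using Xc by (intro eq_matI) (simp_all add: r_def)
  then have "mat_adjoint P * P = (r * r) \<cdot>\<^sub>m 1\<^sub>m n" unfolding P_def using smult[OF Xc' Xc] XX by simp
  also have "r * r = complex_of_real ((vnorm \<delta>)\<^sup>2)" by (simp add: r_def power2_eq_square)
  finally have PP: "mat_adjoint P * P = complex_of_real ((vnorm \<delta>)\<^sup>2) \<cdot>\<^sub>m 1\<^sub>m n" .
  have "P *\<^sub>v unit_vec n 0 = X *\<^sub>v (complex_of_real t \<cdot>\<^sub>v unit_vec n 0)"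
    unfolding P_def rt using Xc by (intro eq_vecI) simp_all
  also have "\<dots> = \<delta>" unfolding X\<delta>[symmetric] by (rule unitary_mat_mult_adjoint_vec[OF X(1) \<delta>])
  finally have P0: "P *\<^sub>v unit_vec n 0 = \<delta>" .
  have "P * ?C * Q = X * ?C * mat_adjoint X"
  proof -
    have "P * ?C = r \<cdot>\<^sub>m (X * ?C)"
      unfolding P_def by (rule mult_smult_assoc_mat[OF Xc cutoff_CMV_carrier])
    then show ?thesis unfolding Q_def
      using smult[OF square_mat_mult_carrier[OF Xc cutoff_CMV_carrier] Xc', where c = r and d = "1 / r"] r0 one by simp
  qed
  then have "similar_mat_wit A ?C P Q"
    using A PQ AC r0 unfolding P_def Q_def
    by (intro similar_mat_witI[of _ _ n]) (simp_all add: smult[OF Xc Xc'] smult[OF Xc' Xc] XX one)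
  then have "cutoff_CMV_in_basis n A \<delta> \<alpha> P"
    unfolding cutoff_CMV_in_basis_def using PQ PP P0 by blast
  then show ?thesis using verb that by blast
qed


section \<open>Uniqueness of the Verblunsky coefficients\<close>

lemma Theta_entry_partner_nonzero:
  assumes "cmod (\<alpha> (min i (partner s i))) < 1" "partner s i \<noteq> i"
  shows "Theta_entry s \<alpha> i (partner s i) \<noteq> 0"
proof -
  have "(cmod (\<alpha> (min i (partner s i))))\<^sup>2 < 1" using assms by (simp add: power_less_one_iff)
  then show ?thesis using assms(2) by (simp add: Theta_entry_def)
qed

text \<open>For an even \<open>j\<close> the diagonal entry \<open>cnj \<alpha>\<^sub>j\<close> belongs to \<open>\<L>\<close>, and for an odd one to
  \<open>\<M>\<close>. Combined with the entry of the other factor that leads back to the partner \<open>j - 1\<close>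
  of \<open>j\<close>, it gives an entry of the product to which no other path contributes. If \<open>j = 0\<close>, the
  partner is \<open>0\<close> itself.\<close>

lemma cutoff_CMV_entry_even:
  assumes j: "j < n" "even j"
  shows "cutoff_CMV n \<alpha> $$ (j, partner 1 j) = cnj (\<alpha> j) * Theta_entry 1 \<alpha> j (partner 1 j)"
proof -
  have pj: "partner 1 j \<le> j" using j by (simp add: partner_def even_iff_mod_2_eq_zero)
  have "cutoff_CMV n \<alpha> $$ (j, partner 1 j) = (\<Sum>l<n. Theta_entry 0 \<alpha> j l * Theta_entry 1 \<alpha> l (partner 1 j))"
    unfolding cutoff_CMV_eq using j pj
    by (simp add: Theta_sum_def scalar_prod_def atLeast0LessThan)
  also have "\<dots> = (\<Sum>l\<in>{j}. Theta_entry 0 \<alpha> j l * Theta_entry 1 \<alpha> l (partner 1 j))"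
  proof (rule sum.mono_neutral_right)
    show "\<forall>l\<in>{..<n} - {j}. Theta_entry 0 \<alpha> j l * Theta_entry 1 \<alpha> l (partner 1 j) = 0"
    proof
      fix l assume l: "l \<in> {..<n} - {j}"
      show "Theta_entry 0 \<alpha> j l * Theta_entry 1 \<alpha> l (partner 1 j) = 0"
      proof (cases "l = partner 0 j")
        case True
        then have "l > j" using j by (simp add: partner_def even_iff_mod_2_eq_zero)
        moreover have "partner 1 j \<noteq> partner 1 l"
          using l partner_partner[OF one_less_2] by (metis DiffD2 singletonI)
        ultimately have "Theta_entry 1 \<alpha> l (partner 1 j) = 0"
          using pj by (intro Theta_entry_eq_0) simp_all
        then show ?thesis by simp
      next
        case False
        then show ?thesis using Theta_entry_eq_0[of l j 0] l by simp
      qed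
    qed
  qed (use j in simp_all)
  also have "\<dots> = cnj (\<alpha> j) * Theta_entry 1 \<alpha> j (partner 1 j)"
    using j by (simp add: Theta_entry_def[of 0] even_iff_mod_2_eq_zero)
  finally show ?thesis .
qed

lemma cutoff_CMV_entry_odd:
  assumes j: "j < n" "odd j"
  shows "cutoff_CMV n \<alpha> $$ (partner 0 j, j) = Theta_entry 0 \<alpha> (partner 0 j) j * cnj (\<alpha> j)"
proof -
  have z2: "(0::nat) < 2" by simp
  have jm: "j mod 2 = Suc 0" using j(2) by presburger
  have pj: "partner 0 j < j" using jm by (cases j) (simp_all add: partner_def)
  have "cutoff_CMV n \<alpha> $$ (partner 0 j, j) = (\<Sum>l<n. Theta_entry 0 \<alpha> (partner 0 j) l * Theta_entry 1 \<alpha> l j)"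
    unfolding cutoff_CMV_eq using j pj
    by (simp add: Theta_sum_def scalar_prod_def atLeast0LessThan)
  also have "\<dots> = (\<Sum>l\<in>{j}. Theta_entry 0 \<alpha> (partner 0 j) l * Theta_entry 1 \<alpha> l j)"
  proof (rule sum.mono_neutral_right)
    show "\<forall>l\<in>{..<n} - {j}. Theta_entry 0 \<alpha> (partner 0 j) l * Theta_entry 1 \<alpha> l j = 0"
    proof
      fix l assume l: "l \<in> {..<n} - {j}"
      show "Theta_entry 0 \<alpha> (partner 0 j) l * Theta_entry 1 \<alpha> l j = 0"
      proof (cases "l = partner 0 j")
        case True
        have "j \<noteq> partner 1 l"
        proof
          assume "j = partner 1 l"
          then have "partner 1 j = l" using partner_partner[OF one_less_2] by simp
          moreover have "partner 1 j > j" using jm by (simp add: partner_def)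
          ultimately show False using True pj by simp
        qed
        then have "Theta_entry 1 \<alpha> l j = 0" using l by (intro Theta_entry_eq_0) blast+
        then show ?thesis by simp
      next
        case False
        then have "Theta_entry 0 \<alpha> (partner 0 j) l = 0"
          using l partner_partner[OF z2, of j] by (intro Theta_entry_eq_0) auto
        then show ?thesis by simp
      qed
    qed
  qed (use j in simp_all)
  also have "\<dots> = Theta_entry 0 \<alpha> (partner 0 j) j * cnj (\<alpha> j)"
    using jm by (simp add: Theta_entry_def[of "Suc 0"])
  finally show ?thesis .
qed

text \<open>The entries just computed are \<open>cnj \<alpha>\<^sub>j\<close> times a nonzero number that depends on \<open>\<alpha>\<^sub>j\<^sub>-\<^sub>1\<close>
  only.\<close>

lemma cutoff_CMV_inj:
  assumes \<alpha>: "verblunsky \<alpha>" and \<beta>: "verblunsky \<beta>" and eq: "cutoff_CMV n \<alpha> = cutoff_CMV n \<beta>"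
    and j: "j < n"
  shows "\<alpha> j = \<beta> j"
  using j
proof (induction j rule: less_induct)
  case (less j)
  have \<alpha>1: "cmod (\<alpha> i) < 1" for i using \<alpha> by (simp add: verblunsky_def)
  show ?case
  proof (cases "even j")
    case True
    have "Theta_entry 1 \<alpha> j (partner 1 j) = Theta_entry 1 \<beta> j (partner 1 j) \<and>
        Theta_entry 1 \<alpha> j (partner 1 j) \<noteq> 0"
    proof (cases "j = 0")
      case True
      then show ?thesis by (simp add: partner_def Theta_entry_def)
    next
      case False
      then have pj: "partner 1 j < j" using True by (simp add: partner_def even_iff_mod_2_eq_zero)
      then have "\<alpha> (partner 1 j) = \<beta> (partner 1 j)" using less by simp
      then have "Theta_entry 1 \<alpha> j (partner 1 j) = Theta_entry 1 \<beta> j (partner 1 j)"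
        using pj by (simp add: Theta_entry_def min_def)
      moreover have "Theta_entry 1 \<alpha> j (partner 1 j) \<noteq> 0"
        using pj by (intro Theta_entry_partner_nonzero \<alpha>1) simp
      ultimately show ?thesis ..
    qed
    moreover have "cnj (\<alpha> j) * Theta_entry 1 \<alpha> j (partner 1 j) = cnj (\<beta> j) * Theta_entry 1 \<beta> j (partner 1 j)"
      using eq cutoff_CMV_entry_even[OF less.prems True] by metis
    ultimately show ?thesis by auto
  next
    case False
    have z2: "(0::nat) < 2" by simp
    have jm: "j mod 2 = Suc 0" using False by presburger
    have pj: "partner 0 j < j" using jm by (cases j) (simp_all add: partner_def)
    then have "\<alpha> (partner 0 j) = \<beta> (partner 0 j)" using less by simp
    then have "Theta_entry 0 \<alpha> (partner 0 j) j = Theta_entry 0 \<beta> (partner 0 j) j"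
      unfolding Theta_entry_commute[OF z2, of _ "partner 0 j" j]
      using pj by (simp add: Theta_entry_def min_def)
    moreover have "Theta_entry 0 \<alpha> (partner 0 j) j \<noteq> 0"
      unfolding Theta_entry_commute[OF z2, of _ "partner 0 j" j]
      using pj by (intro Theta_entry_partner_nonzero \<alpha>1) simp
    moreover have "Theta_entry 0 \<alpha> (partner 0 j) j * cnj (\<alpha> j) = Theta_entry 0 \<beta> (partner 0 j) j * cnj (\<beta> j)"
      using eq cutoff_CMV_entry_odd[OF less.prems False] by metis
    ultimately show ?thesis by auto
  qed
qed

text \<open>The intertwining unitary maps Krylov vectors to Krylov vectors. Both systems are triangular with
  positive diagonal, so it is the identity.\<close>

lemma unitary_equivalent_cutoff_CMV:
  assumes n: "n \<ge> 1" and \<alpha>: "verblunsky \<alpha>" and \<beta>: "verblunsky \<beta>"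
    and U: "unitary_mat n U" and e: "U *\<^sub>v unit_vec n 0 = unit_vec n 0"
    and eq: "cutoff_CMV n \<beta> = U * cutoff_CMV n \<alpha> * mat_adjoint U"
    and j: "j < n"
  shows "\<alpha> j = \<beta> j"
proof -
  let ?A = "cutoff_CMV n \<alpha>" and ?B = "cutoff_CMV n \<beta>" and ?e = "unit_vec n 0 :: complex vec"
  have Uc: "U \<in> carrier_mat n n" "mat_adjoint U \<in> carrier_mat n n" and UU: "mat_adjoint U * U = 1\<^sub>m n"
    using U by (simp_all add: unitary_mat_def)
  have A: "?A \<in> carrier_mat n n" "mat_adjoint ?A \<in> carrier_mat n n"
    and B: "?B \<in> carrier_mat n n" "mat_adjoint ?B \<in> carrier_mat n n" by simp_all
  have inter: "(U * X * mat_adjoint U) * U = U * X" if X: "X \<in> carrier_mat n n" for X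
  proof -
    have UX: "U * X \<in> carrier_mat n n" by (rule square_mat_mult_carrier[OF Uc(1) X])
    show ?thesis unfolding assoc_mult_mat[OF UX Uc(2,1)] UU by (rule square_mat_one(1)[OF UX])
  qed
  have BU: "?B * U = U * ?A" unfolding eq by (rule inter[OF A(1)])
  have "mat_adjoint ?B = U * mat_adjoint ?A * mat_adjoint U"
    unfolding eq mat_adjoint_mult[OF mult_carrier_mat[OF Uc(1) A(1)] Uc(2)] mat_adjoint_mult[OF Uc(1) A(1)]
    using assoc_mult_mat[OF Uc(1) A(2) Uc(2)] by simp
  then have BU': "mat_adjoint ?B * U = U * mat_adjoint ?A" using inter[OF A(2)] by simp
  have kr: "U *\<^sub>v krylov ?A ?e i = krylov ?B ?e i" for i
  proof -
    have "krylov ?B (U *\<^sub>v ?e) i = U *\<^sub>v krylov ?A ?e i"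
      unfolding krylov_def pow_mat_intertwine[OF A(1) B(1) Uc(1) unit_vec_carrier BU]
        pow_mat_intertwine[OF A(2) B(2) Uc(1) unit_vec_carrier BU'] by (cases "i \<ge> 0") simp_all
    then show ?thesis unfolding e by (rule sym)
  qed
  have "U = 1\<^sub>m n"
  proof (rule unitary_fixing_leads[OF Uc(1) UU, where p = "\<lambda>i. krylov ?A ?e (zigzag i)"])
    fix i
    show "krylov ?A ?e (zigzag i) \<in> carrier_vec n \<and> leads n i (krylov ?A ?e (zigzag i))"
      using krylov_carrier[OF A(1) unit_vec_carrier] leads_krylov_cutoff_CMV[OF \<alpha>] by blast
    show "leads n i (U *\<^sub>v krylov ?A ?e (zigzag i))"
      unfolding kr by (rule leads_krylov_cutoff_CMV[OF \<beta>])
  qed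
  then have "?B = ?A" using eq by (simp only: mat_adjoint_one square_mat_one A)
  then show ?thesis using cutoff_CMV_inj[OF \<alpha> \<beta> _ j] by simp
qed

lemma inverse_scaled_unitary:
  fixes P Q :: "complex mat"
  assumes P: "P \<in> carrier_mat n n" "Q \<in> carrier_mat n n" and PQ: "P * Q = 1\<^sub>m n"
    and s: "mat_adjoint P * P = c \<cdot>\<^sub>m 1\<^sub>m n"
  shows "mat_adjoint P = c \<cdot>\<^sub>m Q"
proof -
  have P': "mat_adjoint P \<in> carrier_mat n n" using P by simp
  have "mat_adjoint P = mat_adjoint P * (P * Q)" unfolding PQ by (rule square_mat_one(1)[OF P', symmetric])
  also have "\<dots> = c \<cdot>\<^sub>m 1\<^sub>m n * Q" using assoc_mult_mat[OF P' P] s by simp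
  also have "\<dots> = c \<cdot>\<^sub>m Q" using mult_smult_assoc_mat[OF one_carrier_mat P(2), of c] square_mat_one(2)[OF P(2)] by simp
  finally show ?thesis .
qed

text \<open>Both bases are orthogonal with the same scale \<open>\<parallel>\<delta>\<parallel>\<close>, so the change from one to the other is
  unitary. It fixes the first unit vector, and it intertwines the two cutoff CMV matrices.\<close>

lemma cutoff_CMV_in_basis_unique:
  assumes n: "n \<ge> 1" and A: "A \<in> carrier_mat n n" and \<delta>: "\<delta> \<in> carrier_vec n"
    and \<alpha>: "verblunsky \<alpha>" "cutoff_CMV_in_basis n A \<delta> \<alpha> P"
    and \<beta>: "verblunsky \<beta>" "cutoff_CMV_in_basis n A \<delta> \<beta> P'"
    and j: "j < n"
  shows "\<alpha> j = \<beta> j"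
proof -
  let ?C = "cutoff_CMV n \<alpha>" and ?D = "cutoff_CMV n \<beta>"
  define s where "s = complex_of_real ((vnorm \<delta>)\<^sup>2)"
  obtain Q where Q: "similar_mat_wit A ?C P Q" using \<alpha> unfolding cutoff_CMV_in_basis_def by blast
  obtain Q' where Q': "similar_mat_wit A ?D P' Q'" using \<beta> unfolding cutoff_CMV_in_basis_def by blast
  have P: "P \<in> carrier_mat n n" "mat_adjoint P * P = s \<cdot>\<^sub>m 1\<^sub>m n" "P *\<^sub>v unit_vec n 0 = \<delta>"
    and P': "P' \<in> carrier_mat n n" "mat_adjoint P' * P' = s \<cdot>\<^sub>m 1\<^sub>m n" "P' *\<^sub>v unit_vec n 0 = \<delta>"
    using \<alpha> \<beta> unfolding cutoff_CMV_in_basis_def s_def by simp_all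
  note w = similar_mat_witD2[OF A Q] and w' = similar_mat_witD2[OF A Q']
  have "\<delta> \<noteq> 0\<^sub>v n"
  proof
    assume "\<delta> = 0\<^sub>v n"
    have "unit_vec n 0 = (Q * P) *\<^sub>v unit_vec n 0" using w by simp
    also have "\<dots> = Q *\<^sub>v (P *\<^sub>v unit_vec n 0)" 
      by (rule assoc_mult_mat_vec[of Q n n P n]) (use w in simp_all)
    also have "\<dots> = 0\<^sub>v n" unfolding P(3) \<open>\<delta> = 0\<^sub>v n\<close> using w by (intro mult_mat_vec_zero) simp
    finally have "unit_vec n 0 = (0\<^sub>v n :: complex vec)" .
    then show False using n arg_cong[of "unit_vec n 0" "0\<^sub>v n :: complex vec" "\<lambda>v. v $ 0"] by simp
  qed
  then have s0: "s \<noteq> 0" using vnorm_eq_0[OF \<delta>] unfolding s_def by fastforce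
  have adjP: "mat_adjoint P = s \<cdot>\<^sub>m Q" and adjP': "mat_adjoint P' = s \<cdot>\<^sub>m Q'"
    using inverse_scaled_unitary[of P n Q s] inverse_scaled_unitary[of P' n Q' s] P P' w w' by simp_all
  define U where "U = Q' * P"
  have Qc: "Q \<in> carrier_mat n n" "Q' \<in> carrier_mat n n" using w w' by simp_all
  have Uc: "U \<in> carrier_mat n n" unfolding U_def by (rule square_mat_mult_carrier[OF Qc(2) P(1)])
  have cs: "cnj s = s" unfolding s_def by simp
  have adjU: "mat_adjoint U = Q * P'"
  proof (rule eq_matI)
    fix i k assume "i < dim_row (Q * P')" "k < dim_col (Q * P')"
    then have ik: "i < n" "k < n" using Qc P' by simp_all
    have "mat_adjoint U $$ (i, k) = (\<Sum>l<n. cnj (Q' $$ (k, l)) * cnj (P $$ (l, i)))"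
      using ik Qc P unfolding U_def by (simp add: scalar_prod_def atLeast0LessThan)
    also have "\<dots> = (\<Sum>l<n. P' $$ (l, k) / s * (s * Q $$ (i, l)))"
    proof (rule sum.cong[OF refl])
      fix l assume "l \<in> {..<n}"
      then have l: "l < n" by simp
      have "cnj (P $$ (l, i)) = s * Q $$ (i, l)"
        using arg_cong[OF adjP, of "\<lambda>B. B $$ (i, l)"] ik l P Qc by simp
      moreover have "cnj (P' $$ (l, k)) = s * Q' $$ (k, l)"
        using arg_cong[OF adjP', of "\<lambda>B. B $$ (k, l)"] ik l P' Qc by simp
      then have "P' $$ (l, k) = s * cnj (Q' $$ (k, l))"
        using cs by (metis complex_cnj_cnj complex_cnj_mult)
      ultimately show "cnj (Q' $$ (k, l)) * cnj (P $$ (l, i)) = P' $$ (l, k) / s * (s * Q $$ (i, l))"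
        using s0 by simp
    qed
    also have "\<dots> = (Q * P') $$ (i, k)"
      using ik Qc P' s0 by (simp add: scalar_prod_def atLeast0LessThan mult.commute)
    finally show "mat_adjoint U $$ (i, k) = (Q * P') $$ (i, k)" .
  qed (use Uc Qc P' in simp_all)
  have UU: "mat_adjoint U * U = 1\<^sub>m n"
  proof -
    have "Q * P' * (Q' * P) = Q * ((P' * Q') * P)"
      using Qc P(1) P'(1) by (simp only: square_mat[where n = n])
    also have "\<dots> = 1\<^sub>m n" using w w' P(1) by (simp only: square_mat_one)
    finally show ?thesis unfolding adjU unfolding U_def .
  qed
  have UU': "U * mat_adjoint U = 1\<^sub>m n"
    using mat_mult_left_right_inverse[OF mat_adjoint_carrier[OF Uc] Uc UU] .
  have Ue: "U *\<^sub>v unit_vec n 0 = unit_vec n 0"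
  proof -
    have "U *\<^sub>v unit_vec n 0 = Q' *\<^sub>v (P' *\<^sub>v unit_vec n 0)"
      unfolding U_def P'(3) P(3)[symmetric] 
      by (rule assoc_mult_mat_vec[OF Qc(2) P(1) unit_vec_carrier])
    also have "\<dots> = (Q' * P') *\<^sub>v unit_vec n 0" by (rule assoc_mult_mat_vec[OF Qc(2) P'(1) unit_vec_carrier, symmetric])
    finally show ?thesis using w' by simp
  qed
  have "?D = Q' * A * P'"
  proof -
    have "Q' * A * P' = Q' * (P' * ?D * Q') * P'" unfolding similar_mat_witD2(3)[OF A Q', symmetric] ..
    also have "\<dots> = (Q' * P') * ?D * (Q' * P')"
      using Qc P'(1) by (simp only: square_mat[where n = n] cutoff_CMV_carrier)
    finally show ?thesis using w' by (simp only: square_mat_one cutoff_CMV_carrier)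
  qed
  also have "\<dots> = U * ?C * mat_adjoint U"
  proof -
    have "Q' * A * P' = Q' * (P * ?C * Q) * P'" unfolding similar_mat_witD2(3)[OF A Q, symmetric] ..
    then show ?thesis unfolding adjU unfolding U_def using Qc P(1) P'(1)
      by (simp only: square_mat[where n = n] cutoff_CMV_carrier)
  qed
  finally show ?thesis
    using unitary_equivalent_cutoff_CMV[OF n \<alpha>(1) \<beta>(1) _ Ue _ j] Uc UU UU' by (simp add: unitary_mat_def)
qed


section \<open>The characterisation\<close>

theorem theorem3p3:
  fixes n :: nat
  assumes "n \<ge> 1"
  shows
    "(\<forall>\<alpha>. verblunsky \<alpha> \<longrightarrow> CMV_conditions n (cutoff_CMV n \<alpha>) (unit_vec n 0)) \<and>
     (\<forall>A \<delta>. A \<in> carrier_mat n n \<and> \<delta> \<in> carrier_vec n \<and> CMV_conditions n A \<delta> \<longrightarrow>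
        (\<exists>\<alpha> P. verblunsky \<alpha> \<and> cutoff_CMV_in_basis n A \<delta> \<alpha> P)) \<and>
     (\<forall>A \<delta> \<alpha> \<beta> P P'. A \<in> carrier_mat n n \<and> \<delta> \<in> carrier_vec n \<and>
        verblunsky \<alpha> \<and> cutoff_CMV_in_basis n A \<delta> \<alpha> P \<and>
        verblunsky \<beta> \<and> cutoff_CMV_in_basis n A \<delta> \<beta> P' \<longrightarrow>
        (\<forall>j < n. \<alpha> j = \<beta> j)) \<and>
     (\<forall>\<alpha> \<beta>. verblunsky \<alpha> \<and> verblunsky \<beta> \<and> (\<exists>j < n. \<alpha> j \<noteq> \<beta> j) \<longrightarrow>
        \<not> (\<exists>U. unitary_mat n U \<and> U *\<^sub>v unit_vec n 0 = unit_vec n 0 \<and>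
              cutoff_CMV n \<beta> = U * cutoff_CMV n \<alpha> * mat_adjoint U))"
proof (intro conjI allI impI)
  fix \<alpha> assume "verblunsky \<alpha>"
  then show "CMV_conditions n (cutoff_CMV n \<alpha>) (unit_vec n 0)"
    by (rule CMV_conditions_cutoff_CMV[OF assms])
next
  fix A \<delta> assume "A \<in> carrier_mat n n \<and> \<delta> \<in> carrier_vec n \<and> CMV_conditions n A \<delta>"
  then show "\<exists>\<alpha> P. verblunsky \<alpha> \<and> cutoff_CMV_in_basis n A \<delta> \<alpha> P"
    using CMV_conditions_imp_cutoff_CMV[OF assms, of A \<delta>] by metis
next
  fix A \<delta> \<alpha> \<beta> P P' j
  assume "A \<in> carrier_mat n n \<and> \<delta> \<in> carrier_vec n \<and>
    verblunsky \<alpha> \<and> cutoff_CMV_in_basis n A \<delta> \<alpha> P \<and> verblunsky \<beta> \<and> cutoff_CMV_in_basis n A \<delta> \<beta> P'"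
    and "j < n"
  then show "\<alpha> j = \<beta> j" using cutoff_CMV_in_basis_unique[OF assms] by blast
next
  fix \<alpha> \<beta> assume "verblunsky \<alpha> \<and> verblunsky \<beta> \<and> (\<exists>j < n. \<alpha> j \<noteq> \<beta> j)"
  then show "\<not> (\<exists>U. unitary_mat n U \<and> U *\<^sub>v unit_vec n 0 = unit_vec n 0 \<and>
      cutoff_CMV n \<beta> = U * cutoff_CMV n \<alpha> * mat_adjoint U)"
    using unitary_equivalent_cutoff_CMV[OF assms] by blast
qed

end
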